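(* Let $\theta\in\mathbb{R}$ and let $\mathcal{A}(\mathrm{SL}_\theta(2,\mathbb{H}))$ be the $*$-algebra defined in the context, generated by the entries $A_{ij}$ of the matrix $A_\theta$. With the coproduct $\Delta(A_{ij})=\sum_k A_{ik}\otimes A_{kj}$, the counit $\epsilon(A_{ij})=\delta_{ij}$ and the antipode $S(A_{ij})=(-1)^{i+j}\hat A_{ji}$ (where $\hat A_{ji}$ are the algebraic complements defined in the context), the datum $(\mathcal{A}(\mathrm{SL}_\theta(2,\mathbb{H})),\Delta,\epsilon,S)$ constitutes a Hopf algebra.
   Context: Let $\theta\in\mathbb{R}$, $\mu=e^{\pi \mathrm{i}\theta}$, and let $\eta=(\eta_{ij})$ be $$\eta=\begin{pmatrix}1&1&\bar\mu&\mu\\1&1&\mu&\bar\mu\\ \mu&\bar\mu&1&1\\ \bar\mu&\mu&1&1\end{pmatrix}.$$ $\mathcal{A}(M_\theta(2,\mathbb{H}))$ is the unital complex $*$-algebra generated by the entries of $$A_\theta=(A_{ij})=\begin{pmatrix}a_1&a_2&b_1&b_2\\-a_2^*&a_1^*&-b_2^*&b_1^*\\c_1&c_2&d_1&d_2\\-c_2^*&c_1^*&-d_2^*&d_1^*\end{pmatrix}$$ with relations $A_{ij}A_{kl}=\eta_{ki}\eta_{jl}A_{kl}A_{ij}$ for all $i,j,k,l\in\{1,\dots,4\}$. The determinant is $\det(A_\theta)=\sum_{\sigma\in S_4}(-1)^{|\sigma|}\varepsilon^{\sigma(1)\sigma(2)\sigma(3)\sigma(4)}A_{1,\sigma(1)}A_{2,\sigma(2)}A_{3,\sigma(3)}A_{4,\sigma(4)}$,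 where $\varepsilon^{ijkl}=\mu$ if $(i,j,k,l)$ is $(1,3,2,4)$ or one of its cyclic rotations, $\varepsilon^{ijkl}=\bar\mu$ if $(i,j,k,l)$ is $(1,4,2,3)$ or one of its cyclic rotations, and $\varepsilon^{ijkl}=1$ for all other permutations. It is a central element. $\mathcal{A}(\mathrm{SL}_\theta(2,\mathbb{H}))$ is the quotient of $\mathcal{A}(M_\theta(2,\mathbb{H}))$ by the two-sided ideal generated by $\det(A_\theta)-1$; images of the $A_{ij}$ are denoted by the same symbols. For $i,l\in\{1,\dots,4\}$ the algebraic complement is $$\hat A_{il}=\sum_{\sigma\in S_3}(-1)^{|\sigma|}\,\varepsilon^{\sigma_1\dots\sigma_{i-1}\,l\,\sigma_{i+1}\dots\sigma_4}\,\eta_{\sigma_1 l}\eta_{\sigma_2 l}\cdots\eta_{\sigma_{i-1}l}\;A_{1,\sigma_1}\cdots A_{i-1,\sigma_{i-1}}A_{i+1,\sigma_{i+1}}\cdots A_{4,\sigma_4},$$ where $(\sigma_1,\dots,\sigma_{i-1},\sigma_{i+1},\dots,\sigma_4)=\sigma(1,\dots,l-1,l+1,\dots,4)$ runs over the permutations of the three elements of $\{1,2,3,4\}\setminus\{l\}$, and $|\sigma|$ is the parity of $\sigma$ as a permutation of three objects. $\Delta$ and $\epsilon$ are extended as algebra maps and $S$ as an algebra anti-homomorphism. *)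

theory Defs
  imports
    Complex_Main
    "HOL-Library.Poly_Mapping"
    "HOL-Algebra.QuotRing"
    "HOL-Algebra.Module"
    "HOL-Algebra.Algebraic_Closure_Type"
    "HOL-Combinatorics.Permutations"
begin

section \<open>Complex algebras\<close>

text \<open>
  The locale \<^locale>\<open>algebra\<close> of HOL-Algebra is about commutative algebras. Here a (unital,
  associative, not necessarily commutative) complex algebra is carried by the same record type
  \<^type>\<open>module\<close>.
\<close>

abbreviation complex_ring :: "complex ring"
  where "complex_ring \<equiv> ring_of_type_algebra"

definition complex_numbers_algebra :: "(complex, complex) module"
  where "complex_numbers_algebra = ring.extend complex_ring (module.fields (*))"

locale complex_algebra = module complex_ring A + ring A for A (structure) +
  assumes smult_mult_left:
      "\<lbrakk>x \<in> carrier A; y \<in> carrier A\<rbrakk> \<Longrightarrow> (c \<odot> x) \<otimes> y = c \<odot> (x \<otimes> y)"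
    and smult_mult_right:
      "\<lbrakk>x \<in> carrier A; y \<in> carrier A\<rbrakk> \<Longrightarrow> x \<otimes> (c \<odot> y) = c \<odot> (x \<otimes> y)"

definition linear_maps ::
    "(complex, 'a, 'm) module_scheme \<Rightarrow> (complex, 'b, 'n) module_scheme \<Rightarrow> ('a \<Rightarrow> 'b) set"
  where "linear_maps A B = {f \<in> carrier A \<rightarrow> carrier B.
    (\<forall>x\<in>carrier A. \<forall>y\<in>carrier A. f (x \<oplus>\<^bsub>A\<^esub> y) = f x \<oplus>\<^bsub>B\<^esub> f y) \<and>
    (\<forall>c. \<forall>x\<in>carrier A. f (c \<odot>\<^bsub>A\<^esub> x) = c \<odot>\<^bsub>B\<^esub> f x)}"

definition algebra_homs ::
    "(complex, 'a, 'm) module_scheme \<Rightarrow> (complex, 'b, 'n) module_scheme \<Rightarrow> ('a \<Rightarrow> 'b) set"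
  where "algebra_homs A B = linear_maps A B \<inter> ring_hom A B"

definition algebra_antihoms ::
    "(complex, 'a, 'm) module_scheme \<Rightarrow> (complex, 'b, 'n) module_scheme \<Rightarrow> ('a \<Rightarrow> 'b) set"
  where "algebra_antihoms A B = {f \<in> linear_maps A B.
    f \<one>\<^bsub>A\<^esub> = \<one>\<^bsub>B\<^esub> \<and>
    (\<forall>x\<in>carrier A. \<forall>y\<in>carrier A. f (x \<otimes>\<^bsub>A\<^esub> y) = f y \<otimes>\<^bsub>B\<^esub> f x)}"

definition quotient_algebra ::
    "(complex, 'a, 'm) module_scheme \<Rightarrow> 'a set \<Rightarrow> (complex, 'a set) module"
  where "quotient_algebra A I =
    ring.extend (A Quot I) (module.fields (\<lambda>c Y. \<Union>x\<in>Y. I +>\<^bsub>A\<^esub> (c \<odot>\<^bsub>A\<^esub> x)))"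

definition monoid_algebra :: "('k, 'm) monoid_scheme \<Rightarrow> (complex, 'k \<Rightarrow>\<^sub>0 complex) module"
  where "monoid_algebra G =
    \<lparr>carrier = {p. Poly_Mapping.keys p \<subseteq> carrier G},
     monoid.mult = (\<lambda>p q. \<Sum>k\<in>Poly_Mapping.keys p. \<Sum>l\<in>Poly_Mapping.keys q.
       Poly_Mapping.single (k \<otimes>\<^bsub>G\<^esub> l) (Poly_Mapping.lookup p k * Poly_Mapping.lookup q l)),
     one = Poly_Mapping.single \<one>\<^bsub>G\<^esub> 1,
     zero = 0,
     add = (+),
     module.smult = (\<lambda>c. Poly_Mapping.map ((*) c))\<rparr>"

section \<open>Tensor products\<close>

text \<open>
  The monoid algebra of the multiplicative monoid of pairs is the free vector space on
  \<open>carrier A \<times> carrier B\<close> with the product \<open>(a, b)(a', b') = (aa', bb')\<close>; dividing by the subspace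
  spanned by the bilinearity relators gives \<open>A \<otimes> B\<close>.
\<close>

definition bilinearity_relators ::
    "(complex, 'a, 'm) module_scheme \<Rightarrow> (complex, 'b, 'n) module_scheme
      \<Rightarrow> ('a \<times> 'b \<Rightarrow>\<^sub>0 complex) set"
  where "bilinearity_relators A B =
    {Poly_Mapping.single (x \<oplus>\<^bsub>A\<^esub> x', y) 1 - Poly_Mapping.single (x, y) 1
        - Poly_Mapping.single (x', y) 1 | x x' y.
      x \<in> carrier A \<and> x' \<in> carrier A \<and> y \<in> carrier B} \<union>
    {Poly_Mapping.single (x, y \<oplus>\<^bsub>B\<^esub> y') 1 - Poly_Mapping.single (x, y) 1
        - Poly_Mapping.single (x, y') 1 | x y y'.
      x \<in> carrier A \<and> y \<in> carrier B \<and> y' \<in> carrier B} \<union>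
    {Poly_Mapping.single (c \<odot>\<^bsub>A\<^esub> x, y) 1 - Poly_Mapping.single (x, y) c | c x y.
      x \<in> carrier A \<and> y \<in> carrier B} \<union>
    {Poly_Mapping.single (x, c \<odot>\<^bsub>B\<^esub> y) 1 - Poly_Mapping.single (x, y) c | c x y.
      x \<in> carrier A \<and> y \<in> carrier B}"

definition tensor_null ::
    "(complex, 'a, 'm) module_scheme \<Rightarrow> (complex, 'b, 'n) module_scheme
      \<Rightarrow> ('a \<times> 'b \<Rightarrow>\<^sub>0 complex) set"
  where "tensor_null A B =
    \<Inter>{H. submodule H complex_ring (monoid_algebra (A \<times>\<times> B)) \<and> bilinearity_relators A B \<subseteq> H}"

definition tensor_algebra ::
    "(complex, 'a, 'm) module_scheme \<Rightarrow> (complex, 'b, 'n) module_scheme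
      \<Rightarrow> (complex, ('a \<times> 'b \<Rightarrow>\<^sub>0 complex) set) module"
  where "tensor_algebra A B = quotient_algebra (monoid_algebra (A \<times>\<times> B)) (tensor_null A B)"

definition pure_tensor ::
    "(complex, 'a, 'm) module_scheme \<Rightarrow> (complex, 'b, 'n) module_scheme
      \<Rightarrow> 'a \<Rightarrow> 'b \<Rightarrow> ('a \<times> 'b \<Rightarrow>\<^sub>0 complex) set"
  where "pure_tensor A B a b =
    tensor_null A B +>\<^bsub>monoid_algebra (A \<times>\<times> B)\<^esub> Poly_Mapping.single (a, b) 1"

text \<open>
  The linear map on \<open>A \<otimes> B\<close> induced by a bilinear map \<open>\<beta>\<close>: for bilinear \<open>\<beta>\<close> all representatives of a
  class have the same image, so that \<^const>\<open>the_elem\<close> is applied to a singleton.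
\<close>

definition tensor_lift ::
    "(complex, 'c, 'm) module_scheme \<Rightarrow> ('a \<Rightarrow> 'b \<Rightarrow> 'c)
      \<Rightarrow> ('a \<times> 'b \<Rightarrow>\<^sub>0 complex) set \<Rightarrow> 'c"
  where "tensor_lift M \<beta> T =
    the_elem ((\<lambda>p. \<Oplus>\<^bsub>M\<^esub>k\<in>Poly_Mapping.keys p. Poly_Mapping.lookup p k \<odot>\<^bsub>M\<^esub> \<beta> (fst k) (snd k)) ` T)"

definition tensor_map ::
    "(complex, 'c, 'm) module_scheme \<Rightarrow> (complex, 'd, 'n) module_scheme
      \<Rightarrow> ('a \<Rightarrow> 'c) \<Rightarrow> ('b \<Rightarrow> 'd)
      \<Rightarrow> ('a \<times> 'b \<Rightarrow>\<^sub>0 complex) set \<Rightarrow> ('c \<times> 'd \<Rightarrow>\<^sub>0 complex) set"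
  where "tensor_map C D f g = tensor_lift (tensor_algebra C D) (\<lambda>a b. pure_tensor C D (f a) (g b))"

text \<open>The canonical isomorphism \<open>(A \<otimes> B) \<otimes> C \<rightarrow> A \<otimes> (B \<otimes> C)\<close>.\<close>

definition tensor_assoc ::
    "(complex, 'a, 'm) module_scheme \<Rightarrow> (complex, 'b, 'n) module_scheme
      \<Rightarrow> (complex, 'c, 'k) module_scheme
      \<Rightarrow> (('a \<times> 'b \<Rightarrow>\<^sub>0 complex) set \<times> 'c \<Rightarrow>\<^sub>0 complex) set
      \<Rightarrow> ('a \<times> ('b \<times> 'c \<Rightarrow>\<^sub>0 complex) set \<Rightarrow>\<^sub>0 complex) set"
  where "tensor_assoc A B C =
    (let ABC = tensor_algebra A (tensor_algebra B C)
     in tensor_lift ABC (\<lambda>t c. tensor_lift ABC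
          (\<lambda>a b. pure_tensor A (tensor_algebra B C) a (pure_tensor B C b c)) t))"

section \<open>Hopf algebras\<close>

text \<open>
  In \<open>counit_left\<close> and \<open>counit_right\<close> the identifications \<open>\<complex> \<otimes> A = A = A \<otimes> \<complex>\<close> are built in:
  they state \<open>(\<epsilon> \<otimes> id) \<circ> \<Delta> = id = (id \<otimes> \<epsilon>) \<circ> \<Delta>\<close>. In the antipode axioms the outer
  \<^const>\<open>tensor_lift\<close> is the multiplication map \<open>A \<otimes> A \<rightarrow> A\<close>.
\<close>

locale hopf_algebra = complex_algebra A for A (structure) +
  fixes \<Delta> :: "'a \<Rightarrow> ('a \<times> 'a \<Rightarrow>\<^sub>0 complex) set"
    and \<epsilon> :: "'a \<Rightarrow> complex"
    and S :: "'a \<Rightarrow> 'a"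
  assumes comult_hom: "\<Delta> \<in> algebra_homs A (tensor_algebra A A)"
    and counit_hom: "\<epsilon> \<in> algebra_homs A complex_numbers_algebra"
    and antipode_linear: "S \<in> linear_maps A A"
    and coassoc: "x \<in> carrier A \<Longrightarrow>
      tensor_assoc A A A (tensor_map (tensor_algebra A A) A \<Delta> (\<lambda>a. a) (\<Delta> x)) =
      tensor_map A (tensor_algebra A A) (\<lambda>a. a) \<Delta> (\<Delta> x)"
    and counit_left: "x \<in> carrier A \<Longrightarrow> tensor_lift A (\<lambda>a b. \<epsilon> a \<odot> b) (\<Delta> x) = x"
    and counit_right: "x \<in> carrier A \<Longrightarrow> tensor_lift A (\<lambda>a b. \<epsilon> b \<odot> a) (\<Delta> x) = x"
    and antipode_left: "x \<in> carrier A \<Longrightarrow>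
      tensor_lift A (\<lambda>a b. a \<otimes> b) (tensor_map A A S (\<lambda>a. a) (\<Delta> x)) = \<epsilon> x \<odot> \<one>"
    and antipode_right: "x \<in> carrier A \<Longrightarrow>
      tensor_lift A (\<lambda>a b. a \<otimes> b) (tensor_map A A (\<lambda>a. a) S (\<Delta> x)) = \<epsilon> x \<odot> \<one>"

section \<open>Complex *-algebras given by generators and relations\<close>

record 'a star_algebra = "(complex, 'a) module" +
  star :: "'a \<Rightarrow> 'a"

text \<open>Words in the letters \<open>(g, False)\<close>, which stands for \<open>g\<close>, and \<open>(g, True)\<close>, which stands for \<open>g\<^sup>*\<close>.\<close>

definition word_monoid :: "('g \<times> bool) list monoid"
  where "word_monoid = \<lparr>carrier = UNIV, monoid.mult = (@), one = []\<rparr>"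

definition word_star :: "('g \<times> bool) list \<Rightarrow> ('g \<times> bool) list"
  where "word_star w = rev (map (\<lambda>(g, b). (g, \<not> b)) w)"

definition free_star_algebra :: "(('g \<times> bool) list \<Rightarrow>\<^sub>0 complex) star_algebra"
  where "free_star_algebra = module.extend (monoid_algebra word_monoid)
    (star_algebra.fields (\<lambda>p. \<Sum>w\<in>Poly_Mapping.keys p.
      Poly_Mapping.single (word_star w) (cnj (Poly_Mapping.lookup p w))))"

definition free_generator :: "'g \<Rightarrow> ('g \<times> bool) list \<Rightarrow>\<^sub>0 complex"
  where "free_generator g = Poly_Mapping.single [(g, False)] 1"

definition star_ideal_generated :: "('a, 'm) star_algebra_scheme \<Rightarrow> 'a set \<Rightarrow> 'a set"
  where "star_ideal_generated A R = \<Inter>{I. ideal I A \<and> star A ` I \<subseteq> I \<and> R \<subseteq> I}"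

definition quotient_star_algebra ::
    "('a, 'm) star_algebra_scheme \<Rightarrow> 'a set \<Rightarrow> 'a set star_algebra"
  where "quotient_star_algebra A I = module.extend (quotient_algebra A I)
    (star_algebra.fields (\<lambda>Y. \<Union>x\<in>Y. I +>\<^bsub>A\<^esub> star A x))"

section \<open>The quantum group\<close>

text \<open>Matrix indices are natural numbers in \<open>{1..4}\<close>; list positions start at \<open>0\<close>.\<close>

definition \<mu> :: "real \<Rightarrow> complex"
  where "\<mu> \<theta> = exp (complex_of_real pi * \<i> * complex_of_real \<theta>)"

definition \<eta> :: "real \<Rightarrow> nat \<Rightarrow> nat \<Rightarrow> complex"
  where "\<eta> \<theta> i j =
    [[1, 1, cnj (\<mu> \<theta>), \<mu> \<theta>],
     [1, 1, \<mu> \<theta>, cnj (\<mu> \<theta>)],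
     [\<mu> \<theta>, cnj (\<mu> \<theta>), 1, 1],
     [cnj (\<mu> \<theta>), \<mu> \<theta>, 1, 1]] ! (i - 1) ! (j - 1)"

definition det_phase :: "real \<Rightarrow> nat list \<Rightarrow> complex"
  where "det_phase \<theta> js =
    (if \<exists>n. js = rotate n [1, 3, 2, 4] then \<mu> \<theta>
     else if \<exists>n. js = rotate n [1, 4, 2, 3] then cnj (\<mu> \<theta>)
     else 1)"

datatype quaternion_gen =
  a\<^sub>1 | a\<^sub>2 | b\<^sub>1 | b\<^sub>2 | c\<^sub>1 | c\<^sub>2 | d\<^sub>1 | d\<^sub>2

definition free_matrix :: "nat \<Rightarrow> nat \<Rightarrow> (quaternion_gen \<times> bool) list \<Rightarrow>\<^sub>0 complex"
  where "free_matrix i j =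
    (let x = free_generator; xs = (\<lambda>g. star free_star_algebra (free_generator g)) in
      [[x a\<^sub>1, x a\<^sub>2, x b\<^sub>1, x b\<^sub>2],
       [- xs a\<^sub>2, xs a\<^sub>1, - xs b\<^sub>2, xs b\<^sub>1],
       [x c\<^sub>1, x c\<^sub>2, x d\<^sub>1, x d\<^sub>2],
       [- xs c\<^sub>2, xs c\<^sub>1, - xs d\<^sub>2, xs d\<^sub>1]] ! (i - 1) ! (j - 1))"

definition M_relators :: "real \<Rightarrow> ((quaternion_gen \<times> bool) list \<Rightarrow>\<^sub>0 complex) set"
  where "M_relators \<theta> =
    (let F = free_star_algebra; A = free_matrix in
      {A i j \<otimes>\<^bsub>F\<^esub> A k l \<ominus>\<^bsub>F\<^esub> (\<eta> \<theta> k i * \<eta> \<theta> j l) \<odot>\<^bsub>F\<^esub> (A k l \<otimes>\<^bsub>F\<^esub> A i j) | i j k l.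
        i \<in> {1..4} \<and> j \<in> {1..4} \<and> k \<in> {1..4} \<and> l \<in> {1..4}})"

definition M_ideal :: "real \<Rightarrow> ((quaternion_gen \<times> bool) list \<Rightarrow>\<^sub>0 complex) set"
  where "M_ideal \<theta> = star_ideal_generated free_star_algebra (M_relators \<theta>)"

definition M_algebra :: "real \<Rightarrow> ((quaternion_gen \<times> bool) list \<Rightarrow>\<^sub>0 complex) set star_algebra"
  where "M_algebra \<theta> = quotient_star_algebra free_star_algebra (M_ideal \<theta>)"

definition M_matrix ::
    "real \<Rightarrow> nat \<Rightarrow> nat \<Rightarrow> ((quaternion_gen \<times> bool) list \<Rightarrow>\<^sub>0 complex) set"
  where "M_matrix \<theta> i j = M_ideal \<theta> +>\<^bsub>free_star_algebra\<^esub> free_matrix i j"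

definition quantum_det ::
    "real \<Rightarrow> (complex, 'a, 'm) module_scheme \<Rightarrow> (nat \<Rightarrow> nat \<Rightarrow> 'a) \<Rightarrow> 'a"
  where "quantum_det \<theta> R A =
    (\<Oplus>\<^bsub>R\<^esub>\<sigma>\<in>{\<sigma>. \<sigma> permutes {1..4}}.
      (of_int (sign \<sigma>) * det_phase \<theta> [\<sigma> 1, \<sigma> 2, \<sigma> 3, \<sigma> 4]) \<odot>\<^bsub>R\<^esub>
      (A 1 (\<sigma> 1) \<otimes>\<^bsub>R\<^esub> A 2 (\<sigma> 2) \<otimes>\<^bsub>R\<^esub> A 3 (\<sigma> 3) \<otimes>\<^bsub>R\<^esub> A 4 (\<sigma> 4)))"

text \<open>
  In the sum below \<open>js\<close> is the list \<open>(\<sigma>\<^sub>1, \<dots>, \<sigma>\<^sub>i\<^sub>-\<^sub>1, \<sigma>\<^sub>i\<^sub>+\<^sub>1, \<dots>, \<sigma>\<^sub>4)\<close>, the image under \<open>\<sigma>\<close> of the list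
  of column indices other than \<open>l\<close>.
\<close>

definition algebraic_complement ::
    "real \<Rightarrow> (complex, 'a, 'm) module_scheme \<Rightarrow> (nat \<Rightarrow> nat \<Rightarrow> 'a) \<Rightarrow> nat \<Rightarrow> nat \<Rightarrow> 'a"
  where "algebraic_complement \<theta> R A i l =
    (\<Oplus>\<^bsub>R\<^esub>\<sigma>\<in>{\<sigma>. \<sigma> permutes ({1..4} - {l})}.
      let rows = filter (\<lambda>k. k \<noteq> i) [1, 2, 3, 4];
          js = map \<sigma> (filter (\<lambda>k. k \<noteq> l) [1, 2, 3, 4])
      in (of_int (sign \<sigma>) * det_phase \<theta> (take (i - 1) js @ l # drop (i - 1) js)
            * (\<Prod>m<i - 1. \<eta> \<theta> (js ! m) l)) \<odot>\<^bsub>R\<^esub>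
         foldr (\<lambda>x y. x \<otimes>\<^bsub>R\<^esub> y) (map2 A rows js) \<one>\<^bsub>R\<^esub>)"

definition SL_ideal :: "real \<Rightarrow> ((quaternion_gen \<times> bool) list \<Rightarrow>\<^sub>0 complex) set set"
  where "SL_ideal \<theta> =
    Idl\<^bsub>M_algebra \<theta>\<^esub> {quantum_det \<theta> (M_algebra \<theta>) (M_matrix \<theta>) \<ominus>\<^bsub>M_algebra \<theta>\<^esub> \<one>\<^bsub>M_algebra \<theta>\<^esub>}"

definition SL_algebra ::
    "real \<Rightarrow> ((quaternion_gen \<times> bool) list \<Rightarrow>\<^sub>0 complex) set set star_algebra"
  where "SL_algebra \<theta> = quotient_star_algebra (M_algebra \<theta>) (SL_ideal \<theta>)"

definition SL_matrix ::
    "real \<Rightarrow> nat \<Rightarrow> nat \<Rightarrow> ((quaternion_gen \<times> bool) list \<Rightarrow>\<^sub>0 complex) set set"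
  where "SL_matrix \<theta> i j = SL_ideal \<theta> +>\<^bsub>M_algebra \<theta>\<^esub> M_matrix \<theta> i j"

end

theory Submission
  imports Defs "HOL-Combinatorics.Multiset_Permutations"
begin

text \<open>
  Let \<open>E(j)\<close> be the coefficient of the word \<open>A\<^sub>1\<^sub>j\<^sub>1 A\<^sub>2\<^sub>j\<^sub>2 A\<^sub>3\<^sub>j\<^sub>3 A\<^sub>4\<^sub>j\<^sub>4\<close> in the determinant, extended by \<open>0\<close> to words \<open>j\<close>
  with repeated letters. Exchanging neighbouring letters multiplies \<open>E\<close> by \<open>-\<eta>\<close>, and by the defining
  relations the sums \<open>F(i) = \<Sum>\<^sub>j E(j) A\<^sub>i\<^sub>1\<^sub>j\<^sub>1 \<dots> A\<^sub>i\<^sub>4\<^sub>j\<^sub>4\<close> behave in the same way; hence \<open>F(i) = E(i) det A\<close>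
  for all words \<open>i\<close>. Splitting off the first factor gives the right inverse of \<open>A\<close> by algebraic
  complements. The transposed matrix satisfies the same relations for the conjugate phases, and
  comparing the two expansions of \<open>\<Sum>\<^sub>i\<^sub>j E(i)\<^sup>-\<^sup>1 E(j) A\<^sub>i\<^sub>1\<^sub>j\<^sub>1 \<dots> A\<^sub>i\<^sub>4\<^sub>j\<^sub>4\<close> shows that it has the same determinant, so \<open>A\<close>
  also has a left inverse, which must be the same matrix. Conjugating the relations with the
  inverse shows that it satisfies them in the opposite algebra, where its determinant is \<open>1\<close>; this
  defines the antipode. The coproduct exists because entrywise commuting matrices satisfying the
  relations have a product satisfying them, with multiplicative determinant. All Hopf algebra axioms
  then need to be checked on the matrix entries only.
\<close>

section \<open>Complex algebras\<close>

text \<open>The determinant theory sees the phases only through \<open>h i j * h j i = 1\<close> and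
  \<open>h i i = 1\<close>, so it is developed for arbitrary size and phases; one theorem then
  serves the matrix, its transpose, its inverse and the product in the tensor square. Admitting
  words with repeated letters makes it uniform: that an expansion along a wrong row vanishes is the
  case \<open>E(i) = 0\<close> of the same identity. The left inverse cannot be read off from the
  expansion that yields the right inverse, because there the entries stand on the wrong side of the
  minors. A separate obstacle is the star. The matrix algebra is a quotient by an ideal stable under
  the star, whereas coproduct, counit and antipode are constructed as maps respecting the algebra
  structure only. The star permutes the relators up to sign, so this ideal is the ordinary two-sided
  one; and the eight generators with their stars are, up to sign, the sixteen entries. Hence a map
  out of the algebra is given by any sixteen elements satisfying the relations.\<close>

lemma complex_ring_simps [simp]:
  "carrier complex_ring = UNIV" "x \<oplus>\<^bsub>complex_ring\<^esub> y = x + y" "x \<otimes>\<^bsub>complex_ring\<^esub> y = x * y"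
  "\<zero>\<^bsub>complex_ring\<^esub> = 0" "\<one>\<^bsub>complex_ring\<^esub> = 1"
  by (simp_all add: ring_of_type_algebra_def)

text \<open>Negatives are supplied by the scalar \<open>-1\<close>, so an instance has to provide
  its record operations only and the existence of additive inverses follows from
  \<open>l_inv\<close>.\<close>

lemma complex_algebraI:
  fixes A (structure)
  assumes a_closed: "\<And>x y. x \<in> carrier A \<Longrightarrow> y \<in> carrier A \<Longrightarrow> x \<oplus> y \<in> carrier A"
    and zero_closed: "\<zero> \<in> carrier A"
    and a_assoc: "\<And>x y z. x \<in> carrier A \<Longrightarrow> y \<in> carrier A \<Longrightarrow> z \<in> carrier A \<Longrightarrow>
      (x \<oplus> y) \<oplus> z = x \<oplus> (y \<oplus> z)"
    and a_comm: "\<And>x y. x \<in> carrier A \<Longrightarrow> y \<in> carrier A \<Longrightarrow> x \<oplus> y = y \<oplus> x"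
    and l_zero: "\<And>x. x \<in> carrier A \<Longrightarrow> \<zero> \<oplus> x = x"
    and l_inv: "\<And>x. x \<in> carrier A \<Longrightarrow> (-1) \<odot> x \<oplus> x = \<zero>"
    and m_closed: "\<And>x y. x \<in> carrier A \<Longrightarrow> y \<in> carrier A \<Longrightarrow> x \<otimes> y \<in> carrier A"
    and one_closed: "\<one> \<in> carrier A"
    and m_assoc: "\<And>x y z. x \<in> carrier A \<Longrightarrow> y \<in> carrier A \<Longrightarrow> z \<in> carrier A \<Longrightarrow>
      (x \<otimes> y) \<otimes> z = x \<otimes> (y \<otimes> z)"
    and l_one: "\<And>x. x \<in> carrier A \<Longrightarrow> \<one> \<otimes> x = x"
    and r_one: "\<And>x. x \<in> carrier A \<Longrightarrow> x \<otimes> \<one> = x"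
    and l_distr: "\<And>x y z. x \<in> carrier A \<Longrightarrow> y \<in> carrier A \<Longrightarrow> z \<in> carrier A \<Longrightarrow>
      (x \<oplus> y) \<otimes> z = x \<otimes> z \<oplus> y \<otimes> z"
    and r_distr: "\<And>x y z. x \<in> carrier A \<Longrightarrow> y \<in> carrier A \<Longrightarrow> z \<in> carrier A \<Longrightarrow>
      z \<otimes> (x \<oplus> y) = z \<otimes> x \<oplus> z \<otimes> y"
    and smult_closed: "\<And>c x. x \<in> carrier A \<Longrightarrow> c \<odot> x \<in> carrier A"
    and smult_l_distr: "\<And>c d x. x \<in> carrier A \<Longrightarrow> (c + d) \<odot> x = c \<odot> x \<oplus> d \<odot> x"
    and smult_r_distr: "\<And>c x y. x \<in> carrier A \<Longrightarrow> y \<in> carrier A \<Longrightarrow> c \<odot> (x \<oplus> y) = c \<odot> x \<oplus> c \<odot> y"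
    and smult_assoc: "\<And>c d x. x \<in> carrier A \<Longrightarrow> (c * d) \<odot> x = c \<odot> (d \<odot> x)"
    and smult_one: "\<And>x. x \<in> carrier A \<Longrightarrow> 1 \<odot> x = x"
    and smult_mult_left: "\<And>c x y. x \<in> carrier A \<Longrightarrow> y \<in> carrier A \<Longrightarrow> (c \<odot> x) \<otimes> y = c \<odot> (x \<otimes> y)"
    and smult_mult_right: "\<And>c x y. x \<in> carrier A \<Longrightarrow> y \<in> carrier A \<Longrightarrow> x \<otimes> (c \<odot> y) = c \<odot> (x \<otimes> y)"
  shows "complex_algebra A"
proof -
  have "\<exists>y\<in>carrier A. y \<oplus> x = \<zero>" if "x \<in> carrier A" for x
    using that l_inv smult_closed by blast
  then have ab: "abelian_group A"
    by (intro abelian_groupI a_closed zero_closed a_assoc a_comm l_zero)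
  have r: "ring A"
    by (intro ringI[OF ab] monoidI m_closed one_closed m_assoc l_one r_one l_distr r_distr)
  have m: "module complex_ring A"
    by (rule moduleI)
      (simp_all add: ab cring_from_type_algebra smult_closed smult_l_distr smult_r_distr smult_assoc smult_one)
  show ?thesis
    by (intro complex_algebra.intro complex_algebra_axioms.intro m r smult_mult_left smult_mult_right)
qed

context abelian_monoid
begin

lemma finsum_swap:
  assumes "finite I" "finite J" "\<And>i j. i \<in> I \<Longrightarrow> j \<in> J \<Longrightarrow> f i j \<in> carrier G"
  shows "(\<Oplus>i\<in>I. \<Oplus>j\<in>J. f i j) = (\<Oplus>j\<in>J. \<Oplus>i\<in>I. f i j)"
  using assms(1,3)
proof (induction I rule: finite_induct)
  case (insert x F)
  have "(\<Oplus>i\<in>insert x F. \<Oplus>j\<in>J. f i j) = (\<Oplus>j\<in>J. f x j) \<oplus> (\<Oplus>i\<in>F. \<Oplus>j\<in>J. f i j)"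
    using insert by (intro finsum_insert) (auto intro!: finsum_closed)
  also have "\<dots> = (\<Oplus>j\<in>J. f x j) \<oplus> (\<Oplus>j\<in>J. \<Oplus>i\<in>F. f i j)"
    using insert by simp
  also have "\<dots> = (\<Oplus>j\<in>J. f x j \<oplus> (\<Oplus>i\<in>F. f i j))"
    using insert by (intro finsum_addf[symmetric]) (auto intro!: finsum_closed)
  also have "\<dots> = (\<Oplus>j\<in>J. \<Oplus>i\<in>insert x F. f i j)"
    using insert by (intro finsum_cong') (auto intro!: finsum_closed finsum_insert[symmetric])
  finally show ?case .
qed simp

lemma finsum_delta:
  assumes "finite I" "a \<in> I" "f a \<in> carrier G"
  shows "(\<Oplus>i\<in>I. if i = a then f i else \<zero>) = f a"
proof -
  have "(\<Oplus>i\<in>I. if i = a then f i else \<zero>) = (\<Oplus>i\<in>{a}. f i)"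
    by (rule add.finprod_mono_neutral_cong_right) (use assms in auto)
  then show ?thesis using assms by simp
qed

end

lemma (in abelian_monoid) finsum_eqI:
  assumes "\<And>i. i \<in> I \<Longrightarrow> g i \<in> carrier G" "\<And>i. i \<in> I \<Longrightarrow> f i = g i"
  shows "finsum G f I = finsum G g I"
  using assms by (intro finsum_cong') auto

context complex_algebra
begin

lemma smult_zero_left [simp]: "x \<in> carrier A \<Longrightarrow> 0 \<odot> x = \<zero>"
  using smult_l_null[of x] by simp

lemma smult_zero_right [simp]: "c \<odot> \<zero> = \<zero>"
  using smult_r_null[of c] by simp

lemma smult_minus_one: "x \<in> carrier A \<Longrightarrow> (-1) \<odot> x = \<ominus> x"
proof -
  assume x: "x \<in> carrier A"
  have "(-1) \<odot> x \<oplus> x = (-1 + 1) \<odot> x"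
    using smult_l_distr[of "-1" 1 x] smult_one[of x] x by simp
  then have "(-1) \<odot> x \<oplus> x = \<zero>" using x by simp
  then show ?thesis using x M.minus_equality by (metis UNIV_I complex_ring_simps(1) smult_closed)
qed

lemma smult_smult: "x \<in> carrier A \<Longrightarrow> c \<odot> (d \<odot> x) = (c * d) \<odot> x"
  using smult_assoc1[of c d x] by simp

lemma smult_add_left: "x \<in> carrier A \<Longrightarrow> (c + d) \<odot> x = c \<odot> x \<oplus> d \<odot> x"
  using smult_l_distr[of c d x] by simp

lemma smult_add_right: "x \<in> carrier A \<Longrightarrow> y \<in> carrier A \<Longrightarrow> c \<odot> (x \<oplus> y) = c \<odot> x \<oplus> c \<odot> y"
  using smult_r_distr[of c x y] by simp

lemma one_smult [simp]: "x \<in> carrier A \<Longrightarrow> 1 \<odot> x = x"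
  using smult_one by simp

lemma smult_in [simp, intro]: "x \<in> carrier A \<Longrightarrow> c \<odot> x \<in> carrier A"
  by simp

lemma minus_smult: "x \<in> carrier A \<Longrightarrow> (- c) \<odot> x = \<ominus> (c \<odot> x)"
  using smult_minus_one[of "c \<odot> x"] by (simp add: smult_smult)

lemma smult_cancel:
  assumes "c \<noteq> 0" "c \<odot> x = c \<odot> y" "x \<in> carrier A" "y \<in> carrier A"
  shows "x = y"
proof -
  have "inverse c \<odot> (c \<odot> x) = inverse c \<odot> (c \<odot> y)" by (simp add: assms)
  then show ?thesis using assms(1,3,4) by (simp add: smult_smult)
qed

lemma finsum_smult:
  assumes "\<And>i. i \<in> I \<Longrightarrow> f i \<in> carrier A"
  shows "c \<odot> (\<Oplus>i\<in>I. f i) = (\<Oplus>i\<in>I. c \<odot> f i)"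
  using assms
  by (induction I rule: infinite_finite_induct) (auto simp: smult_add_right Pi_def)

lemma finsum_mult_left:
  assumes "\<And>i. i \<in> I \<Longrightarrow> f i \<in> carrier A" "x \<in> carrier A"
  shows "x \<otimes> (\<Oplus>i\<in>I. f i) = (\<Oplus>i\<in>I. x \<otimes> f i)"
  using assms
  by (induction I rule: infinite_finite_induct) (auto simp: r_distr Pi_def)

lemma finsum_mult_right:
  assumes "\<And>i. i \<in> I \<Longrightarrow> f i \<in> carrier A" "x \<in> carrier A"
  shows "(\<Oplus>i\<in>I. f i) \<otimes> x = (\<Oplus>i\<in>I. f i \<otimes> x)"
  using assms
  by (induction I rule: infinite_finite_induct) (auto simp: l_distr Pi_def)

lemma finsum_scalar:
  assumes "finite I" "x \<in> carrier A"
  shows "(\<Oplus>i\<in>I. c i \<odot> x) = (\<Sum>i\<in>I. c i) \<odot> x"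
  using assms
  by (induction I rule: finite_induct) (auto simp: smult_add_left Pi_def)

end

lemma (in complex_algebra) add_minus_cancel:
  "x \<in> carrier A \<Longrightarrow> y \<in> carrier A \<Longrightarrow> x \<oplus> y \<ominus> x \<ominus> y = \<zero>"
  by (metis M.a_comm M.add.inv_closed M.minus_eq M.r_neg M.a_assoc M.a_closed M.r_zero)

lemma (in complex_algebra) smult_diff:
  "x \<in> carrier A \<Longrightarrow> y \<in> carrier A \<Longrightarrow> c \<odot> (x \<ominus> y) = c \<odot> x \<ominus> c \<odot> y"
  by (simp add: a_minus_def smult_add_right smult_smult mult.commute flip: smult_minus_one)

section \<open>Homomorphisms\<close>

lemma linear_mapsI:
  assumes "\<And>x. x \<in> carrier A \<Longrightarrow> f x \<in> carrier B"
    and "\<And>x y. x \<in> carrier A \<Longrightarrow> y \<in> carrier A \<Longrightarrow> f (x \<oplus>\<^bsub>A\<^esub> y) = f x \<oplus>\<^bsub>B\<^esub> f y"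
    and "\<And>c x. x \<in> carrier A \<Longrightarrow> f (c \<odot>\<^bsub>A\<^esub> x) = c \<odot>\<^bsub>B\<^esub> f x"
  shows "f \<in> linear_maps A B"
  using assms by (auto simp: linear_maps_def)

lemma linear_mapsD:
  assumes "f \<in> linear_maps A B"
  shows "x \<in> carrier A \<Longrightarrow> f x \<in> carrier B"
    and "x \<in> carrier A \<Longrightarrow> y \<in> carrier A \<Longrightarrow> f (x \<oplus>\<^bsub>A\<^esub> y) = f x \<oplus>\<^bsub>B\<^esub> f y"
    and "x \<in> carrier A \<Longrightarrow> f (c \<odot>\<^bsub>A\<^esub> x) = c \<odot>\<^bsub>B\<^esub> f x"
  using assms by (auto simp: linear_maps_def)

lemma algebra_homsI:
  assumes "f \<in> linear_maps A B"
    and "\<And>x y. x \<in> carrier A \<Longrightarrow> y \<in> carrier A \<Longrightarrow> f (x \<otimes>\<^bsub>A\<^esub> y) = f x \<otimes>\<^bsub>B\<^esub> f y"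
    and "f \<one>\<^bsub>A\<^esub> = \<one>\<^bsub>B\<^esub>"
  shows "f \<in> algebra_homs A B"
  using assms by (auto simp: algebra_homs_def linear_maps_def intro!: ring_hom_memI)

lemma algebra_homsD:
  assumes "f \<in> algebra_homs A B"
  shows "f \<in> linear_maps A B"
    and "x \<in> carrier A \<Longrightarrow> f x \<in> carrier B"
    and "x \<in> carrier A \<Longrightarrow> y \<in> carrier A \<Longrightarrow> f (x \<oplus>\<^bsub>A\<^esub> y) = f x \<oplus>\<^bsub>B\<^esub> f y"
    and "x \<in> carrier A \<Longrightarrow> f (c \<odot>\<^bsub>A\<^esub> x) = c \<odot>\<^bsub>B\<^esub> f x"
    and "x \<in> carrier A \<Longrightarrow> y \<in> carrier A \<Longrightarrow> f (x \<otimes>\<^bsub>A\<^esub> y) = f x \<otimes>\<^bsub>B\<^esub> f y"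
    and "f \<one>\<^bsub>A\<^esub> = \<one>\<^bsub>B\<^esub>"
  using assms by (auto simp: algebra_homs_def linear_maps_def ring_hom_def)

lemma linear_maps_comp:
  assumes "f \<in> linear_maps A B" "g \<in> linear_maps B C"
  shows "(\<lambda>x. g (f x)) \<in> linear_maps A C"
  using assms by (auto simp: linear_mapsD intro!: linear_mapsI)

lemma algebra_homs_comp:
  assumes "f \<in> algebra_homs A B" "g \<in> algebra_homs B C"
  shows "(\<lambda>x. g (f x)) \<in> algebra_homs A C"
  by (rule algebra_homsI)
    (use assms in \<open>auto simp: algebra_homsD intro: linear_maps_comp algebra_homsD(1)\<close>)

lemma algebra_homs_id: "(\<lambda>x. x) \<in> algebra_homs A A"
  by (rule algebra_homsI) (auto intro: linear_mapsI)

lemma linear_maps_zero: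
  assumes "f \<in> linear_maps A B" "complex_algebra A" "complex_algebra B"
  shows "f \<zero>\<^bsub>A\<^esub> = \<zero>\<^bsub>B\<^esub>"
proof -
  interpret A: complex_algebra A by fact
  interpret B: complex_algebra B by fact
  have "f (0 \<odot>\<^bsub>A\<^esub> \<zero>\<^bsub>A\<^esub>) = 0 \<odot>\<^bsub>B\<^esub> f \<zero>\<^bsub>A\<^esub>"
    using A.zero_closed by (rule linear_mapsD(3)[OF assms(1)])
  then show ?thesis using linear_mapsD(1)[OF assms(1), of "\<zero>\<^bsub>A\<^esub>"] by simp
qed

lemma linear_maps_minus:
  assumes "f \<in> linear_maps A B" "complex_algebra A" "complex_algebra B" "x \<in> carrier A"
  shows "f (\<ominus>\<^bsub>A\<^esub> x) = \<ominus>\<^bsub>B\<^esub> f x"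
proof -
  interpret A: complex_algebra A by fact
  interpret B: complex_algebra B by fact
  show ?thesis
    using linear_mapsD(3)[OF assms(1,4), of "-1"] linear_mapsD(1)[OF assms(1,4)] assms(4)
    by (simp add: A.smult_minus_one B.smult_minus_one)
qed

lemma linear_maps_diff:
  assumes "f \<in> linear_maps A B" "complex_algebra A" "complex_algebra B"
    "x \<in> carrier A" "y \<in> carrier A"
  shows "f (x \<ominus>\<^bsub>A\<^esub> y) = f x \<ominus>\<^bsub>B\<^esub> f y"
proof -
  interpret A: complex_algebra A by fact
  interpret B: complex_algebra B by fact
  show ?thesis
    using assms by (simp add: a_minus_def linear_mapsD linear_maps_minus)
qed

lemma linear_maps_finsum:
  assumes "f \<in> linear_maps A B" "complex_algebra A" "complex_algebra B"
    "\<And>i. i \<in> I \<Longrightarrow> g i \<in> carrier A"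
  shows "f (\<Oplus>\<^bsub>A\<^esub>i\<in>I. g i) = (\<Oplus>\<^bsub>B\<^esub>i\<in>I. f (g i))"
proof -
  interpret A: complex_algebra A by fact
  interpret B: complex_algebra B by fact
  show ?thesis using assms(4)
    by (induction I rule: infinite_finite_induct)
      (use assms in \<open>auto simp: linear_maps_zero linear_mapsD Pi_def\<close>)
qed

lemma linear_maps_finsum_eq:
  assumes "f \<in> linear_maps A B" "complex_algebra A" "complex_algebra B"
    and "\<And>i. i \<in> I \<Longrightarrow> g i \<in> carrier A" "\<And>i. i \<in> I \<Longrightarrow> f (g i) = h i"
  shows "f (\<Oplus>\<^bsub>A\<^esub>i\<in>I. g i) = (\<Oplus>\<^bsub>B\<^esub>i\<in>I. h i)"
proof -
  interpret B: complex_algebra B by fact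
  have "(\<Oplus>\<^bsub>B\<^esub>i\<in>I. f (g i)) = (\<Oplus>\<^bsub>B\<^esub>i\<in>I. h i)"
    by (rule B.finsum_eqI) (use assms linear_mapsD(1)[OF assms(1)] in force)+
  then show ?thesis by (simp add: linear_maps_finsum[OF assms(1-3)] assms(4))
qed

text \<open>Used to pass from generators to generated ideals: once the relators lie in the kernel,
  so does the ideal they generate, by minimality.\<close>

lemma ideal_kernel:
  assumes "f \<in> algebra_homs A B" "complex_algebra A" "complex_algebra B"
  shows "ideal {x \<in> carrier A. f x = \<zero>\<^bsub>B\<^esub>} A"
proof -
  interpret A: complex_algebra A by fact
  interpret B: complex_algebra B by fact
  note lin = algebra_homsD(1)[OF assms(1)]
  show ?thesis
  proof (rule idealI)
    show "subgroup {x \<in> carrier A. f x = \<zero>\<^bsub>B\<^esub>} (add_monoid A)"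
    proof (rule A.add.subgroupI)
      have "\<zero>\<^bsub>A\<^esub> \<in> {x \<in> carrier A. f x = \<zero>\<^bsub>B\<^esub>}"
        by (simp add: linear_maps_zero[OF lin assms(2,3)])
      then show "{x \<in> carrier A. f x = \<zero>\<^bsub>B\<^esub>} \<noteq> {}" by blast
    next
      fix a assume "a \<in> {x \<in> carrier A. f x = \<zero>\<^bsub>B\<^esub>}"
      then show "\<ominus>\<^bsub>A\<^esub> a \<in> {x \<in> carrier A. f x = \<zero>\<^bsub>B\<^esub>}"
        by (simp add: linear_maps_minus[OF lin assms(2,3)])
    qed (auto simp: linear_mapsD[OF lin])
  qed (auto simp: algebra_homsD[OF assms(1)] A.ring_axioms)
qed

section \<open>Quotient algebras\<close>

lemma quotient_algebra_simps:
  "carrier (quotient_algebra A I) = a_rcosets\<^bsub>A\<^esub> I"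
  "monoid.mult (quotient_algebra A I) = rcoset_mult A I"
  "add (quotient_algebra A I) = set_add A"
  "\<one>\<^bsub>quotient_algebra A I\<^esub> = I +>\<^bsub>A\<^esub> \<one>\<^bsub>A\<^esub>"
  "\<zero>\<^bsub>quotient_algebra A I\<^esub> = I"
  "c \<odot>\<^bsub>quotient_algebra A I\<^esub> Y = (\<Union>x\<in>Y. I +>\<^bsub>A\<^esub> (c \<odot>\<^bsub>A\<^esub> x))"
  by (simp_all add: quotient_algebra_def ring.extend_def module.fields_def FactRing_def)

locale algebra_ideal = complex_algebra A + ideal I A for A (structure) and I
begin

text \<open>A ring ideal is automatically a linear subspace, because \<open>c \<odot> x\<close> is
  the product of \<open>c \<odot> \<one>\<close> with \<open>x\<close>.\<close>

lemma smult_ideal: "x \<in> I \<Longrightarrow> c \<odot> x \<in> I"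
proof -
  assume x: "x \<in> I"
  then have xc: "x \<in> carrier A" by simp
  have "(c \<odot> \<one>) \<otimes> x \<in> I" using x by (intro I_l_closed) auto
  then show ?thesis using xc by (simp add: smult_mult_left)
qed

lemma coset_eq_iff:
  assumes "x \<in> carrier A" "y \<in> carrier A"
  shows "I +> x = I +> y \<longleftrightarrow> x \<ominus> y \<in> I"
  using assms quotient_eq_iff_same_a_r_cos[OF is_ideal assms] by simp

lemma rcosets_iff: "Z \<in> a_rcosets I \<longleftrightarrow> (\<exists>x\<in>carrier A. Z = I +> x)"
  by (auto simp: A_RCOSETS_defs a_r_coset_def)

text \<open>Scaling respects congruence modulo \<open>I\<close>, so the union in
  \<open>quotient_algebra\<close> is taken over copies of a single coset.\<close>

lemma coset_smult:
  assumes "x \<in> carrier A"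
  shows "(\<Union>y\<in>I +> x. I +> (c \<odot> y)) = I +> (c \<odot> x)"
proof -
  have "I +> (c \<odot> y) = I +> (c \<odot> x)" if y: "y \<in> I +> x" for y
  proof -
    have yc: "y \<in> carrier A" using y assms a_elemrcos_carrier by blast
    have "y \<ominus> x \<in> I" using a_rcos_module_minus[OF ring_axioms assms yc] y by simp
    then have "c \<odot> (y \<ominus> x) \<in> I" by (rule smult_ideal)
    moreover have "c \<odot> (y \<ominus> x) = c \<odot> y \<ominus> c \<odot> x"
      using yc assms
      by (simp add: a_minus_def smult_add_right flip: smult_minus_one) (simp add: smult_smult mult.commute)
    ultimately show ?thesis using coset_eq_iff yc assms by simp
  qed
  moreover have "x \<in> I +> x" using assms by (rule a_rcos_self)
  ultimately show ?thesis by blast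
qed

lemma coset_zero: "I +> \<zero> = I"
  using a_rcos_zero[OF is_ideal] zero_closed by blast

lemma quot_carrier: "carrier (quotient_algebra A I) = (+>) I ` carrier A"
  by (auto simp: quotient_algebra_simps rcosets_iff)

lemma quot_ops:
  "x \<in> carrier A \<Longrightarrow> y \<in> carrier A \<Longrightarrow>
    (I +> x) \<oplus>\<^bsub>quotient_algebra A I\<^esub> (I +> y) = I +> (x \<oplus> y)"
  "x \<in> carrier A \<Longrightarrow> y \<in> carrier A \<Longrightarrow>
    (I +> x) \<otimes>\<^bsub>quotient_algebra A I\<^esub> (I +> y) = I +> (x \<otimes> y)"
  "x \<in> carrier A \<Longrightarrow> c \<odot>\<^bsub>quotient_algebra A I\<^esub> (I +> x) = I +> (c \<odot> x)"
  "\<one>\<^bsub>quotient_algebra A I\<^esub> = I +> \<one>"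
  "\<zero>\<^bsub>quotient_algebra A I\<^esub> = I +> \<zero>"
  by (simp_all add: quotient_algebra_simps a_rcos_sum rcoset_mult_add coset_smult coset_zero)

sublocale quot: complex_algebra "quotient_algebra A I"
proof (rule complex_algebraI)
  fix x y
  assume "x \<in> carrier (quotient_algebra A I)" "y \<in> carrier (quotient_algebra A I)"
  then obtain u v where "x = I +> u" "y = I +> v" "u \<in> carrier A" "v \<in> carrier A"
    by (auto simp: quot_carrier)
  then show "x \<oplus>\<^bsub>quotient_algebra A I\<^esub> y = y \<oplus>\<^bsub>quotient_algebra A I\<^esub> x"
    by (simp add: quot_ops a_comm)
qed (auto simp: quot_carrier quot_ops a_assoc m_assoc l_distr r_distr
       smult_add_left smult_add_right smult_smult smult_mult_left smult_mult_right smult_minus_one M.l_neg)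

lemma quot_hom: "(+>) I \<in> algebra_homs A (quotient_algebra A I)"
  by (intro algebra_homsI linear_mapsI) (auto simp: quot_carrier quot_ops)

text \<open>A map that kills \<open>I\<close> is constant on each coset, so the image of a coset is
  a singleton. This is the mechanism by which maps descend to quotients here, including
  \<open>tensor_lift\<close>.\<close>

lemma the_elem_coset:
  assumes "f \<in> linear_maps A B" "complex_algebra B" "\<And>x. x \<in> I \<Longrightarrow> f x = \<zero>\<^bsub>B\<^esub>" "x \<in> carrier A"
  shows "the_elem (f ` (I +> x)) = f x"
proof -
  interpret B: complex_algebra B by fact
  have "f y = f x" if y: "y \<in> I +> x" for y
  proof -
    have yc: "y \<in> carrier A" using y assms(4) a_elemrcos_carrier by blast
    have "y \<ominus> x \<in> I" using a_rcos_module_minus[OF ring_axioms assms(4) yc] y by simp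
    then have "f (y \<ominus> x) = \<zero>\<^bsub>B\<^esub>" by (rule assms(3))
    then show ?thesis
      using linear_maps_diff[OF assms(1) complex_algebra_axioms assms(2) yc assms(4)]
        linear_mapsD(1)[OF assms(1)] yc assms(4) by simp
  qed
  then have "f ` (I +> x) = {f x}" using a_rcos_self[OF assms(4)] by blast
  then show ?thesis by simp
qed

lemma quot_lift_linear:
  assumes "f \<in> linear_maps A B" "complex_algebra B" "\<And>x. x \<in> I \<Longrightarrow> f x = \<zero>\<^bsub>B\<^esub>"
  shows "(\<lambda>Z. the_elem (f ` Z)) \<in> linear_maps (quotient_algebra A I) B"
  using linear_mapsD[OF assms(1)]
  by (intro linear_mapsI) (auto simp: quot_carrier quot_ops the_elem_coset[OF assms])

lemma quot_lift_hom:
  assumes "f \<in> algebra_homs A B" "complex_algebra B" "\<And>x. x \<in> I \<Longrightarrow> f x = \<zero>\<^bsub>B\<^esub>"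
  shows "(\<lambda>Z. the_elem (f ` Z)) \<in> algebra_homs (quotient_algebra A I) B"
  using algebra_homsD[OF assms(1)]
  by (intro algebra_homsI quot_lift_linear assms)
    (auto simp: quot_carrier quot_ops the_elem_coset[OF _ assms(2,3)] assms)

end

section \<open>Monoid algebras\<close>

lemma keys_add_subset:
  "Poly_Mapping.keys p \<subseteq> K \<Longrightarrow> Poly_Mapping.keys q \<subseteq> K \<Longrightarrow> Poly_Mapping.keys (p + q) \<subseteq> K"
  using Poly_Mapping.keys_add[of p q] by blast

text \<open>The carrier of a monoid algebra is a condition on supports, so the induction has to keep
  every summand supported in \<open>K\<close>. The proof adds up the monomials of \<open>p\<close>
  one key at a time.\<close>

lemma poly_mapping_keys_induct [consumes 1, case_names zero single add]:
  fixes p :: "'k \<Rightarrow>\<^sub>0 'b::comm_monoid_add"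
  assumes "Poly_Mapping.keys p \<subseteq> K"
    and "P 0"
    and "\<And>k c. k \<in> K \<Longrightarrow> P (Poly_Mapping.single k c)"
    and "\<And>p q. Poly_Mapping.keys p \<subseteq> K \<Longrightarrow> Poly_Mapping.keys q \<subseteq> K \<Longrightarrow> P p \<Longrightarrow> P q \<Longrightarrow> P (p + q)"
  shows "P p"
proof -
  have "Poly_Mapping.keys (\<Sum>k\<in>S. Poly_Mapping.single k (Poly_Mapping.lookup p k)) \<subseteq> K \<and>
      P (\<Sum>k\<in>S. Poly_Mapping.single k (Poly_Mapping.lookup p k))" if "finite S" "S \<subseteq> K" for S
    using that
  proof (induction S rule: finite_induct)
    case (insert x F)
    have "Poly_Mapping.keys (Poly_Mapping.single x (Poly_Mapping.lookup p x)) \<subseteq> K"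
      using insert by auto
    then show ?case
      using insert assms(3,4)
      by (simp add: keys_add_subset)
  qed (use assms in auto)
  moreover have "(\<Sum>k\<in>Poly_Mapping.keys p. Poly_Mapping.single k (Poly_Mapping.lookup p k)) = p"
    by (rule poly_mapping_eqI)
      (auto simp: lookup_sum lookup_single when_def in_keys_iff sum.delta)
  ultimately show ?thesis using assms(1) by (metis finite_keys)
qed

text \<open>The sum that \<open>tensor_lift\<close> applies to a representative, isolated so that
  the same facts serve tensor products and free algebras.\<close>

definition linear_ext ::
    "(complex, 'c, 'm) module_scheme \<Rightarrow> ('k \<Rightarrow> 'c) \<Rightarrow> ('k \<Rightarrow>\<^sub>0 complex) \<Rightarrow> 'c"
  where "linear_ext M f p = (\<Oplus>\<^bsub>M\<^esub>k\<in>Poly_Mapping.keys p. Poly_Mapping.lookup p k \<odot>\<^bsub>M\<^esub> f k)"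

lemma monoid_algebra_simps:
  "p \<in> carrier (monoid_algebra G) \<longleftrightarrow> Poly_Mapping.keys p \<subseteq> carrier G"
  "p \<oplus>\<^bsub>monoid_algebra G\<^esub> q = p + q"
  "\<zero>\<^bsub>monoid_algebra G\<^esub> = 0"
  "\<one>\<^bsub>monoid_algebra G\<^esub> = Poly_Mapping.single \<one>\<^bsub>G\<^esub> 1"
  "c \<odot>\<^bsub>monoid_algebra G\<^esub> p = Poly_Mapping.map ((*) c) p"
  by (simp_all add: monoid_algebra_def)

lemma lookup_map_times: "Poly_Mapping.lookup (Poly_Mapping.map ((*) c) p) k = c * Poly_Mapping.lookup p k"
  for c :: complex
  by (simp add: Poly_Mapping.map.rep_eq when_def)

lemma map_times_single: "Poly_Mapping.map ((*) c) (Poly_Mapping.single k d) = Poly_Mapping.single k (c * d)"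
  for c :: complex
  by (rule poly_mapping_eqI) (simp add: lookup_map_times lookup_single when_def)

lemma map_times_add:
  "Poly_Mapping.map ((*) c) (p + q) = Poly_Mapping.map ((*) c) p + Poly_Mapping.map ((*) c) q"
  for c :: complex
  by (rule poly_mapping_eqI) (simp add: lookup_map_times lookup_add distrib_left)

lemma map_times_zero: "Poly_Mapping.map ((*) c) 0 = 0"
  for c :: complex
  by (rule poly_mapping_eqI) (simp add: lookup_map_times)

lemma keys_map_subset:
  "Poly_Mapping.keys p \<subseteq> K \<Longrightarrow> Poly_Mapping.keys (Poly_Mapping.map ((*) c) p) \<subseteq> K"
  for c :: complex
  by (auto simp: in_keys_iff lookup_map_times)

lemma monoid_algebra_single:
  "Poly_Mapping.single k a \<otimes>\<^bsub>monoid_algebra G\<^esub> Poly_Mapping.single l b = Poly_Mapping.single (k \<otimes>\<^bsub>G\<^esub> l) (a * b)"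
  by (simp add: monoid_algebra_def)

lemma monoid_algebra_distrib:
  "(p + q) \<otimes>\<^bsub>monoid_algebra G\<^esub> r = p \<otimes>\<^bsub>monoid_algebra G\<^esub> r + q \<otimes>\<^bsub>monoid_algebra G\<^esub> r"
  "r \<otimes>\<^bsub>monoid_algebra G\<^esub> (p + q) = r \<otimes>\<^bsub>monoid_algebra G\<^esub> p + r \<otimes>\<^bsub>monoid_algebra G\<^esub> q"
proof -
  show "(p + q) \<otimes>\<^bsub>monoid_algebra G\<^esub> r = p \<otimes>\<^bsub>monoid_algebra G\<^esub> r + q \<otimes>\<^bsub>monoid_algebra G\<^esub> r"
    unfolding monoid_algebra_def monoid.simps
    by (rule setsum_keys_plus_distrib) (simp_all add: distrib_right single_add sum.distrib)
  have "(\<Sum>l\<in>Poly_Mapping.keys (p + q). Poly_Mapping.single (k \<otimes>\<^bsub>G\<^esub> l)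
      (Poly_Mapping.lookup r k * Poly_Mapping.lookup (p + q) l)) =
    (\<Sum>l\<in>Poly_Mapping.keys p. Poly_Mapping.single (k \<otimes>\<^bsub>G\<^esub> l)
      (Poly_Mapping.lookup r k * Poly_Mapping.lookup p l)) +
    (\<Sum>l\<in>Poly_Mapping.keys q. Poly_Mapping.single (k \<otimes>\<^bsub>G\<^esub> l)
      (Poly_Mapping.lookup r k * Poly_Mapping.lookup q l))" for k
    by (rule setsum_keys_plus_distrib) (simp_all add: distrib_left single_add sum.distrib)
  then show "r \<otimes>\<^bsub>monoid_algebra G\<^esub> (p + q) = r \<otimes>\<^bsub>monoid_algebra G\<^esub> p + r \<otimes>\<^bsub>monoid_algebra G\<^esub> q"
    by (simp add: monoid_algebra_def sum.distrib)
qed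

lemma monoid_algebra_mult_zero:
  "0 \<otimes>\<^bsub>monoid_algebra G\<^esub> r = 0" "r \<otimes>\<^bsub>monoid_algebra G\<^esub> 0 = 0"
  by (simp_all add: monoid_algebra_def)

lemma (in monoid) monoid_algebra_mult_closed:
  assumes "Poly_Mapping.keys p \<subseteq> carrier G" "Poly_Mapping.keys q \<subseteq> carrier G"
  shows "Poly_Mapping.keys (p \<otimes>\<^bsub>monoid_algebra G\<^esub> q) \<subseteq> carrier G"
  using assms
proof (induction p rule: poly_mapping_keys_induct)
  case (single k c)
  from single(2) show ?case
    by (induction q rule: poly_mapping_keys_induct)
      (simp_all add: single(1) monoid_algebra_mult_zero monoid_algebra_single monoid_algebra_distrib keys_add_subset)
qed (simp_all add: monoid_algebra_mult_zero monoid_algebra_distrib keys_add_subset)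

lemma (in monoid) monoid_algebra_smult:
  assumes "Poly_Mapping.keys p \<subseteq> carrier G" "Poly_Mapping.keys q \<subseteq> carrier G"
  shows "Poly_Mapping.map ((*) c) p \<otimes>\<^bsub>monoid_algebra G\<^esub> q = Poly_Mapping.map ((*) c) (p \<otimes>\<^bsub>monoid_algebra G\<^esub> q)"
    and "p \<otimes>\<^bsub>monoid_algebra G\<^esub> Poly_Mapping.map ((*) c) q = Poly_Mapping.map ((*) c) (p \<otimes>\<^bsub>monoid_algebra G\<^esub> q)"
proof -
  have "Poly_Mapping.map ((*) c) p \<otimes>\<^bsub>monoid_algebra G\<^esub> q = Poly_Mapping.map ((*) c) (p \<otimes>\<^bsub>monoid_algebra G\<^esub> q) \<and>
    p \<otimes>\<^bsub>monoid_algebra G\<^esub> Poly_Mapping.map ((*) c) q = Poly_Mapping.map ((*) c) (p \<otimes>\<^bsub>monoid_algebra G\<^esub> q)"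
    using assms
  proof (induction p rule: poly_mapping_keys_induct)
    case (single k d)
    from single(2) show ?case
      by (induction q rule: poly_mapping_keys_induct)
        (simp_all add: monoid_algebra_mult_zero monoid_algebra_single monoid_algebra_distrib
          map_times_single map_times_add map_times_zero mult.assoc mult.left_commute)
  qed (simp_all add: monoid_algebra_mult_zero monoid_algebra_distrib map_times_add map_times_zero)
  then show "Poly_Mapping.map ((*) c) p \<otimes>\<^bsub>monoid_algebra G\<^esub> q = Poly_Mapping.map ((*) c) (p \<otimes>\<^bsub>monoid_algebra G\<^esub> q)"
    "p \<otimes>\<^bsub>monoid_algebra G\<^esub> Poly_Mapping.map ((*) c) q = Poly_Mapping.map ((*) c) (p \<otimes>\<^bsub>monoid_algebra G\<^esub> q)"
    by auto
qed

lemma (in monoid) monoid_algebra_assoc: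
  assumes "Poly_Mapping.keys p \<subseteq> carrier G" "Poly_Mapping.keys q \<subseteq> carrier G" "Poly_Mapping.keys r \<subseteq> carrier G"
  shows "p \<otimes>\<^bsub>monoid_algebra G\<^esub> q \<otimes>\<^bsub>monoid_algebra G\<^esub> r = p \<otimes>\<^bsub>monoid_algebra G\<^esub> (q \<otimes>\<^bsub>monoid_algebra G\<^esub> r)"
  using assms
proof (induction p rule: poly_mapping_keys_induct)
  case (single k a)
  from single(2,1,3) show ?case
  proof (induction q rule: poly_mapping_keys_induct)
    case (single l b)
    from single(3,1,2) show ?case
      by (induction r rule: poly_mapping_keys_induct)
        (simp_all add: monoid_algebra_mult_zero monoid_algebra_single monoid_algebra_distrib m_assoc mult_ac)
  qed (simp_all add: monoid_algebra_mult_zero monoid_algebra_distrib)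
qed (simp_all add: monoid_algebra_mult_zero monoid_algebra_distrib)

lemma (in monoid) monoid_algebra_one:
  assumes "Poly_Mapping.keys p \<subseteq> carrier G"
  shows "Poly_Mapping.single \<one> 1 \<otimes>\<^bsub>monoid_algebra G\<^esub> p = p" "p \<otimes>\<^bsub>monoid_algebra G\<^esub> Poly_Mapping.single \<one> 1 = p"
  using assms
  by (induction p rule: poly_mapping_keys_induct)
    (simp_all add: monoid_algebra_mult_zero monoid_algebra_single monoid_algebra_distrib)

lemma (in monoid) monoid_algebra: "complex_algebra (monoid_algebra G)"
  by (rule complex_algebraI, simp_all add: monoid_algebra_simps monoid_algebra_mult_closed
      monoid_algebra_smult monoid_algebra_assoc monoid_algebra_one monoid_algebra_distrib
      map_times_add add_ac keys_add_subset keys_map_subset)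
    (simp_all add: poly_mapping_eq_iff fun_eq_iff lookup_map_times lookup_add algebra_simps)

section \<open>Linear extension\<close>

context complex_algebra
begin

text \<open>Cancellation can make the keys of \<open>p + q\<close> smaller than the union of the
  keys of the summands. Summing over a common finite superset puts all three sums over one index
  set.\<close>

lemma linear_ext_superset:
  assumes "f \<in> K \<rightarrow> carrier A" "finite S" "Poly_Mapping.keys p \<subseteq> S" "S \<subseteq> K"
  shows "linear_ext A f p = (\<Oplus>k\<in>S. Poly_Mapping.lookup p k \<odot> f k)"
  unfolding linear_ext_def
proof (rule add.finprod_mono_neutral_cong_left)
  show "Poly_Mapping.lookup p i \<odot> f i = \<zero>" if "i \<in> S - Poly_Mapping.keys p" for i
    using that assms by (auto simp: in_keys_iff Pi_def subset_eq)
qed (use assms in auto)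

lemma linear_ext_closed:
  assumes "f \<in> K \<rightarrow> carrier A" "Poly_Mapping.keys p \<subseteq> K"
  shows "linear_ext A f p \<in> carrier A"
  unfolding linear_ext_def using assms by (intro finsum_closed) (auto simp: Pi_def subset_eq)

lemma linear_ext_add:
  assumes "f \<in> K \<rightarrow> carrier A" "Poly_Mapping.keys p \<subseteq> K" "Poly_Mapping.keys q \<subseteq> K"
  shows "linear_ext A f (p + q) = linear_ext A f p \<oplus> linear_ext A f q"
proof -
  define S where "S = Poly_Mapping.keys p \<union> Poly_Mapping.keys q"
  have S: "finite S" "S \<subseteq> K" "Poly_Mapping.keys p \<subseteq> S" "Poly_Mapping.keys q \<subseteq> S" "Poly_Mapping.keys (p + q) \<subseteq> S"
    using assms Poly_Mapping.keys_add[of p q] by (auto simp: S_def)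
  have fc: "f k \<in> carrier A" if "k \<in> S" for k
    using that S(2) assms(1) by (auto simp: Pi_def)
  have "linear_ext A f (p + q) = (\<Oplus>k\<in>S. Poly_Mapping.lookup (p + q) k \<odot> f k)"
    by (rule linear_ext_superset) (use assms S in auto)
  also have "\<dots> = (\<Oplus>k\<in>S. Poly_Mapping.lookup p k \<odot> f k \<oplus> Poly_Mapping.lookup q k \<odot> f k)"
    using fc by (intro finsum_cong') (auto simp: lookup_add smult_add_left)
  also have "\<dots> = linear_ext A f p \<oplus> linear_ext A f q"
    using S assms fc by (simp add: linear_ext_superset[of f K S] finsum_addf Pi_def)
  finally show ?thesis .
qed

lemma linear_ext_smult:
  assumes "f \<in> K \<rightarrow> carrier A" "Poly_Mapping.keys p \<subseteq> K"
  shows "linear_ext A f (Poly_Mapping.map ((*) c) p) = c \<odot> linear_ext A f p"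
proof -
  have fc: "f k \<in> carrier A" if "k \<in> Poly_Mapping.keys p" for k
    using that assms by (auto simp: Pi_def)
  have "linear_ext A f (Poly_Mapping.map ((*) c) p) =
      (\<Oplus>k\<in>Poly_Mapping.keys p. Poly_Mapping.lookup (Poly_Mapping.map ((*) c) p) k \<odot> f k)"
    by (rule linear_ext_superset) (use assms keys_map_subset[OF order.refl, of c p] in auto)
  also have "\<dots> = c \<odot> linear_ext A f p"
    unfolding linear_ext_def using fc
    by (subst finsum_smult) (auto simp: lookup_map_times smult_smult intro!: finsum_cong')
  finally show ?thesis .
qed

lemma linear_ext_zero [simp]: "linear_ext A f 0 = \<zero>"
  by (simp add: linear_ext_def)

lemma linear_ext_single:
  assumes "f k \<in> carrier A"
  shows "linear_ext A f (Poly_Mapping.single k c) = c \<odot> f k"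
  using assms by (cases "c = 0") (auto simp: linear_ext_def)

lemma linear_ext_linear:
  assumes "f \<in> carrier G \<rightarrow> carrier A"
  shows "linear_ext A f \<in> linear_maps (monoid_algebra G) A"
  using assms
  by (intro linear_mapsI)
    (simp_all add: monoid_algebra_simps linear_ext_closed linear_ext_add linear_ext_smult)

text \<open>Both sides of the product rule are bilinear in \<open>p\<close> and \<open>q\<close>, so
  the rule on single monomials suffices.\<close>

lemma linear_ext_hom:
  assumes "monoid G" "f \<in> carrier G \<rightarrow> carrier A"
    and mult: "\<And>k l. k \<in> carrier G \<Longrightarrow> l \<in> carrier G \<Longrightarrow> f (k \<otimes>\<^bsub>G\<^esub> l) = f k \<otimes> f l"
    and one: "f \<one>\<^bsub>G\<^esub> = \<one>"
  shows "linear_ext A f \<in> algebra_homs (monoid_algebra G) A"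
proof (rule algebra_homsI)
  interpret G: monoid G by fact
  have fc: "f k \<in> carrier A" if "k \<in> carrier G" for k
    using that assms(2) by auto
  note ext = linear_ext_closed[OF assms(2)] linear_ext_add[OF assms(2)]
  show "linear_ext A f (p \<otimes>\<^bsub>monoid_algebra G\<^esub> q) = linear_ext A f p \<otimes> linear_ext A f q"
    if "p \<in> carrier (monoid_algebra G)" "q \<in> carrier (monoid_algebra G)" for p q
    using that unfolding monoid_algebra_simps
  proof (induction p rule: poly_mapping_keys_induct)
    case (single k c)
    from single(2) show ?case
    proof (induction q rule: poly_mapping_keys_induct)
      case (single l d)
      then show ?case using \<open>k \<in> carrier G\<close>
        by (simp add: monoid_algebra_single linear_ext_single fc mult smult_mult_left smult_mult_right
            smult_smult mult_ac)
    next
      case (add q r)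
      have "Poly_Mapping.keys (Poly_Mapping.single k c) \<subseteq> carrier G"
        using \<open>k \<in> carrier G\<close> by simp
      then show ?case using add
        by (simp add: monoid_algebra_distrib ext r_distr G.monoid_algebra_mult_closed)
    qed (use \<open>k \<in> carrier G\<close> fc in \<open>simp add: monoid_algebra_mult_zero linear_ext_single\<close>)
  next
    case (add p r)
    then show ?case
      by (simp add: monoid_algebra_distrib ext l_distr G.monoid_algebra_mult_closed)
  qed (simp add: monoid_algebra_mult_zero ext)
  show "linear_ext A f \<one>\<^bsub>monoid_algebra G\<^esub> = \<one>"
    by (simp add: monoid_algebra_simps linear_ext_single fc one)
qed (rule linear_ext_linear[OF assms(2)])

end

section \<open>Tensor products\<close>

definition bilinear_maps ::
    "(complex, 'a, 'm) module_scheme \<Rightarrow> (complex, 'b, 'n) module_scheme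
      \<Rightarrow> (complex, 'c, 'k) module_scheme \<Rightarrow> ('a \<Rightarrow> 'b \<Rightarrow> 'c) set"
  where "bilinear_maps A B M = {\<beta>.
    (\<forall>x\<in>carrier A. (\<lambda>y. \<beta> x y) \<in> linear_maps B M) \<and>
    (\<forall>y\<in>carrier B. (\<lambda>x. \<beta> x y) \<in> linear_maps A M)}"

lemma bilinear_mapsI:
  assumes "\<And>x y. x \<in> carrier A \<Longrightarrow> y \<in> carrier B \<Longrightarrow> \<beta> x y \<in> carrier M"
    and "\<And>x x' y. x \<in> carrier A \<Longrightarrow> x' \<in> carrier A \<Longrightarrow> y \<in> carrier B \<Longrightarrow>
      \<beta> (x \<oplus>\<^bsub>A\<^esub> x') y = \<beta> x y \<oplus>\<^bsub>M\<^esub> \<beta> x' y"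
    and "\<And>x y y'. x \<in> carrier A \<Longrightarrow> y \<in> carrier B \<Longrightarrow> y' \<in> carrier B \<Longrightarrow>
      \<beta> x (y \<oplus>\<^bsub>B\<^esub> y') = \<beta> x y \<oplus>\<^bsub>M\<^esub> \<beta> x y'"
    and "\<And>c x y. x \<in> carrier A \<Longrightarrow> y \<in> carrier B \<Longrightarrow> \<beta> (c \<odot>\<^bsub>A\<^esub> x) y = c \<odot>\<^bsub>M\<^esub> \<beta> x y"
    and "\<And>c x y. x \<in> carrier A \<Longrightarrow> y \<in> carrier B \<Longrightarrow> \<beta> x (c \<odot>\<^bsub>B\<^esub> y) = c \<odot>\<^bsub>M\<^esub> \<beta> x y"
  shows "\<beta> \<in> bilinear_maps A B M"
  using assms by (auto simp: bilinear_maps_def intro!: linear_mapsI)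

lemma bilinear_mapsD:
  assumes "\<beta> \<in> bilinear_maps A B M"
  shows "x \<in> carrier A \<Longrightarrow> y \<in> carrier B \<Longrightarrow> \<beta> x y \<in> carrier M"
    and "x \<in> carrier A \<Longrightarrow> x' \<in> carrier A \<Longrightarrow> y \<in> carrier B \<Longrightarrow>
      \<beta> (x \<oplus>\<^bsub>A\<^esub> x') y = \<beta> x y \<oplus>\<^bsub>M\<^esub> \<beta> x' y"
    and "x \<in> carrier A \<Longrightarrow> y \<in> carrier B \<Longrightarrow> y' \<in> carrier B \<Longrightarrow>
      \<beta> x (y \<oplus>\<^bsub>B\<^esub> y') = \<beta> x y \<oplus>\<^bsub>M\<^esub> \<beta> x y'"
    and "x \<in> carrier A \<Longrightarrow> y \<in> carrier B \<Longrightarrow> \<beta> (c \<odot>\<^bsub>A\<^esub> x) y = c \<odot>\<^bsub>M\<^esub> \<beta> x y"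
    and "x \<in> carrier A \<Longrightarrow> y \<in> carrier B \<Longrightarrow> \<beta> x (c \<odot>\<^bsub>B\<^esub> y) = c \<odot>\<^bsub>M\<^esub> \<beta> x y"
  using assms unfolding bilinear_maps_def by (blast dest: linear_mapsD)+

locale algebra_pair = A: complex_algebra A + B: complex_algebra B
  for A :: "(complex, 'a, 'm) module_scheme" and B :: "(complex, 'b, 'n) module_scheme"
begin

abbreviation F where "F \<equiv> monoid_algebra (A \<times>\<times> B)"
abbreviation N where "N \<equiv> tensor_null A B"
abbreviation T where "T \<equiv> tensor_algebra A B"

interpretation G: monoid "A \<times>\<times> B"
  by (rule DirProd_monoid) (simp_all add: A.is_monoid B.is_monoid)

interpretation F: complex_algebra F
  by (rule G.monoid_algebra)

section \<open>The bilinearity relators generate an ideal of the monoid algebra\<close>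

lemma minus_F: "p \<in> carrier F \<Longrightarrow> q \<in> carrier F \<Longrightarrow> p \<ominus>\<^bsub>F\<^esub> q = p - q"
  using F.smult_minus_one[of q]
  by (simp add: a_minus_def monoid_algebra_simps poly_mapping_eq_iff fun_eq_iff
      lookup_map_times lookup_add lookup_minus flip: F.smult_minus_one)

lemma mult_diff_F:
  "r \<otimes>\<^bsub>F\<^esub> (p - q) = r \<otimes>\<^bsub>F\<^esub> p - r \<otimes>\<^bsub>F\<^esub> q" "(p - q) \<otimes>\<^bsub>F\<^esub> r = p \<otimes>\<^bsub>F\<^esub> r - q \<otimes>\<^bsub>F\<^esub> r"
  using monoid_algebra_distrib[where p = "p - q" and q = q and r = r and G = "A \<times>\<times> B"]
  by (simp_all add: eq_diff_eq)

lemma relators_subset: "bilinearity_relators A B \<subseteq> carrier F"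
proof -
  have *: "Poly_Mapping.keys (p - q) \<subseteq> K" if "Poly_Mapping.keys p \<subseteq> K" "Poly_Mapping.keys q \<subseteq> K"
    for p q :: "'a \<times> 'b \<Rightarrow>\<^sub>0 complex" and K
    using that keys_diff[of p q] by blast
  show ?thesis
    unfolding bilinearity_relators_def
    by (intro Un_least subsetI; elim CollectE exE conjE; simp add: monoid_algebra_simps *)
qed

lemma relatorsI:
  "x \<in> carrier A \<Longrightarrow> x' \<in> carrier A \<Longrightarrow> y \<in> carrier B \<Longrightarrow>
    Poly_Mapping.single (x \<oplus>\<^bsub>A\<^esub> x', y) 1 - Poly_Mapping.single (x, y) 1
      - Poly_Mapping.single (x', y) 1 \<in> bilinearity_relators A B"
  "x \<in> carrier A \<Longrightarrow> y \<in> carrier B \<Longrightarrow> y' \<in> carrier B \<Longrightarrow>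
    Poly_Mapping.single (x, y \<oplus>\<^bsub>B\<^esub> y') 1 - Poly_Mapping.single (x, y) 1
      - Poly_Mapping.single (x, y') 1 \<in> bilinearity_relators A B"
  "x \<in> carrier A \<Longrightarrow> y \<in> carrier B \<Longrightarrow>
    Poly_Mapping.single (c \<odot>\<^bsub>A\<^esub> x, y) 1 - Poly_Mapping.single (x, y) c \<in> bilinearity_relators A B"
  "x \<in> carrier A \<Longrightarrow> y \<in> carrier B \<Longrightarrow>
    Poly_Mapping.single (x, c \<odot>\<^bsub>B\<^esub> y) 1 - Poly_Mapping.single (x, y) c \<in> bilinearity_relators A B"
  unfolding bilinearity_relators_def by blast+

lemma null_subset: "N \<subseteq> carrier F"
  unfolding tensor_null_def using F.carrier_is_submodule relators_subset by blast

lemma relators_null: "bilinearity_relators A B \<subseteq> N"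
  unfolding tensor_null_def by blast

lemma null_minimal: "submodule H complex_ring F \<Longrightarrow> bilinearity_relators A B \<subseteq> H \<Longrightarrow> N \<subseteq> H"
  unfolding tensor_null_def by blast

lemma null_submodule: "submodule N complex_ring F"
proof (rule F.submoduleI)
  show "N \<subseteq> carrier F" by (rule null_subset)
  show "\<zero>\<^bsub>F\<^esub> \<in> N"
    unfolding tensor_null_def using subgroup.one_closed[OF submodule.axioms(1)] by fastforce
  show "\<ominus>\<^bsub>F\<^esub> a \<in> N" if "a \<in> N" for a
    using that unfolding tensor_null_def by (auto dest: F.submoduleE(3))
  show "a \<oplus>\<^bsub>F\<^esub> b \<in> N" if "a \<in> N" "b \<in> N" for a b
    using that unfolding tensor_null_def by (auto dest: F.submoduleE(5))
  show "c \<odot>\<^bsub>F\<^esub> a \<in> N" if "a \<in> N" for c a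
    using that F.submoduleE(4)[of _ c a] unfolding tensor_null_def by simp
qed

lemma null_smult: "a \<in> N \<Longrightarrow> c \<odot>\<^bsub>F\<^esub> a \<in> N"
  using F.submoduleE(4)[OF null_submodule] by simp

lemma null_add: "a \<in> N \<Longrightarrow> b \<in> N \<Longrightarrow> a \<oplus>\<^bsub>F\<^esub> b \<in> N"
  using F.submoduleE(5)[OF null_submodule] by simp

text \<open>Multiplication by a pair \<open>(u, v)\<close> acts in each component separately and is
  linear there, so it turns a relator into a relator of the same kind. For this reason the linear
  span of the relators is already an ideal.\<close>

lemma relators_mult:
  assumes "r \<in> bilinearity_relators A B" "u \<in> carrier A" "v \<in> carrier B"
  shows "Poly_Mapping.single (u, v) 1 \<otimes>\<^bsub>F\<^esub> r \<in> bilinearity_relators A B"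
    and "r \<otimes>\<^bsub>F\<^esub> Poly_Mapping.single (u, v) 1 \<in> bilinearity_relators A B"
proof -
  note mults = mult_diff_F monoid_algebra_single A.r_distr B.r_distr A.l_distr B.l_distr
      A.smult_mult_left A.smult_mult_right B.smult_mult_left B.smult_mult_right
  show "Poly_Mapping.single (u, v) 1 \<otimes>\<^bsub>F\<^esub> r \<in> bilinearity_relators A B"
    using assms(1)[unfolded bilinearity_relators_def]
    by (elim UnE CollectE exE conjE) (simp_all add: assms(2,3) mults relatorsI)
  show "r \<otimes>\<^bsub>F\<^esub> Poly_Mapping.single (u, v) 1 \<in> bilinearity_relators A B"
    using assms(1)[unfolded bilinearity_relators_def]
    by (elim UnE CollectE exE conjE) (simp_all add: assms(2,3) mults relatorsI)
qed

lemma null_mult: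
  assumes "p \<in> carrier F" "n \<in> N"
  shows "p \<otimes>\<^bsub>F\<^esub> n \<in> N \<and> n \<otimes>\<^bsub>F\<^esub> p \<in> N"
proof -
  \<comment> \<open>\<open>H\<close> collects the null elements whose products with everything
    remain null. It is a submodule containing the relators, hence all of \<open>N\<close> by
    minimality.\<close>
  define H where "H = {n \<in> N. \<forall>p\<in>carrier F. p \<otimes>\<^bsub>F\<^esub> n \<in> N \<and> n \<otimes>\<^bsub>F\<^esub> p \<in> N}"
  have HN: "n \<in> carrier F" if "n \<in> H" for n
    using that null_subset by (auto simp: H_def)
  have "submodule H complex_ring F"
  proof (rule F.submoduleI)
    have "\<zero>\<^bsub>F\<^esub> \<in> N"
      using subgroup.one_closed[OF submodule.axioms(1)[OF null_submodule]] by simp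
    then show "\<zero>\<^bsub>F\<^esub> \<in> H" by (auto simp: H_def)
    show "a \<oplus>\<^bsub>F\<^esub> b \<in> H" if "a \<in> H" "b \<in> H" for a b
      using that HN[OF that(1)] HN[OF that(2)] by (simp add: H_def F.r_distr F.l_distr null_add)
    show sm: "c \<odot>\<^bsub>F\<^esub> a \<in> H" if "a \<in> H" for c a
      using that HN[OF that] by (simp add: H_def F.smult_mult_left F.smult_mult_right null_smult)
    show "\<ominus>\<^bsub>F\<^esub> a \<in> H" if "a \<in> H" for a
      using sm[OF that, of "-1"] HN[OF that] by (simp add: F.smult_minus_one)
  qed (auto dest: HN)
  moreover have "r \<in> H" if r: "r \<in> bilinearity_relators A B" for r
  proof -
    have rF: "r \<in> carrier F" using r relators_subset by blast
    have "p \<otimes>\<^bsub>F\<^esub> r \<in> N \<and> r \<otimes>\<^bsub>F\<^esub> p \<in> N" if "p \<in> carrier F" for p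
      using that[unfolded monoid_algebra_simps]
    proof (induction p rule: poly_mapping_keys_induct)
      case zero
      then show ?case
        using subgroup.one_closed[OF submodule.axioms(1)[OF null_submodule]]
        by (simp add: monoid_algebra_mult_zero monoid_algebra_simps(3))
    next
      case (single k c)
      obtain u v where k: "k = (u, v)" "u \<in> carrier A" "v \<in> carrier B"
        using single by (cases k) auto
      have e: "Poly_Mapping.single k c = c \<odot>\<^bsub>F\<^esub> Poly_Mapping.single (u, v) 1"
        by (simp add: k monoid_algebra_simps map_times_single)
      have "Poly_Mapping.single (u, v) (1::complex) \<in> carrier F"
        using k by (simp add: monoid_algebra_simps)
      then show ?case
        unfolding e using rF relators_mult[OF r k(2,3)] relators_null
        by (auto simp: F.smult_mult_left F.smult_mult_right intro!: null_smult)
    next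
      case (add p q)
      then show ?case
        using null_add by (auto simp: monoid_algebra_distrib monoid_algebra_simps(2))
    qed
    then show ?thesis using r relators_null by (auto simp: H_def)
  qed
  ultimately have "N \<subseteq> H" by (intro null_minimal) auto
  then show ?thesis using assms by (auto simp: H_def)
qed

lemma null_ideal: "ideal N F"
  using null_submodule null_mult
  by (intro idealI F.ring_axioms) (auto dest: submodule.axioms(1))

interpretation Q: algebra_ideal F N
  rewrites "quotient_algebra F N = T"
  by (simp_all add: algebra_ideal_def F.complex_algebra_axioms null_ideal tensor_algebra_def)

lemma tensor_complex_algebra: "complex_algebra T"
  by (rule Q.quot.complex_algebra_axioms)

section \<open>Pure tensors\<close>

lemma single_F: "a \<in> carrier A \<Longrightarrow> b \<in> carrier B \<Longrightarrow> Poly_Mapping.single (a, b) c \<in> carrier F"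
  by (simp add: monoid_algebra_simps)

lemma pure_closed [simp, intro]:
  "a \<in> carrier A \<Longrightarrow> b \<in> carrier B \<Longrightarrow> pure_tensor A B a b \<in> carrier T"
  by (simp add: pure_tensor_def Q.quot_carrier single_F)

lemma smult_pure:
  "a \<in> carrier A \<Longrightarrow> b \<in> carrier B \<Longrightarrow>
    c \<odot>\<^bsub>T\<^esub> pure_tensor A B a b = N +>\<^bsub>F\<^esub> Poly_Mapping.single (a, b) c"
  by (simp add: pure_tensor_def Q.quot_ops single_F) (simp add: monoid_algebra_simps map_times_single)

lemma coset_eqI:
  assumes "p - q \<in> bilinearity_relators A B" "p \<in> carrier F" "q \<in> carrier F"
  shows "N +>\<^bsub>F\<^esub> p = N +>\<^bsub>F\<^esub> q"
  using assms relators_null by (auto simp: Q.coset_eq_iff minus_F)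

lemma pure_bilinear: "pure_tensor A B \<in> bilinear_maps A B T"
proof (rule bilinear_mapsI)
  fix x x' y assume x: "x \<in> carrier A" "x' \<in> carrier A" "y \<in> carrier B"
  show "pure_tensor A B (x \<oplus>\<^bsub>A\<^esub> x') y = pure_tensor A B x y \<oplus>\<^bsub>T\<^esub> pure_tensor A B x' y"
    unfolding pure_tensor_def Q.quot_ops(1)[OF single_F single_F, OF x(1,3) x(2,3)]
  proof (rule coset_eqI)
    show "Poly_Mapping.single (x \<oplus>\<^bsub>A\<^esub> x', y) 1 -
        (Poly_Mapping.single (x, y) 1 \<oplus>\<^bsub>F\<^esub> Poly_Mapping.single (x', y) 1) \<in> bilinearity_relators A B"
      using relatorsI(1)[OF x] by (simp only: monoid_algebra_simps(2) diff_diff_eq)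
  qed (use x in \<open>auto intro!: single_F F.a_closed\<close>)
next
  fix x y y' assume x: "x \<in> carrier A" "y \<in> carrier B" "y' \<in> carrier B"
  show "pure_tensor A B x (y \<oplus>\<^bsub>B\<^esub> y') = pure_tensor A B x y \<oplus>\<^bsub>T\<^esub> pure_tensor A B x y'"
    unfolding pure_tensor_def Q.quot_ops(1)[OF single_F single_F, OF x(1,2) x(1,3)]
  proof (rule coset_eqI)
    show "Poly_Mapping.single (x, y \<oplus>\<^bsub>B\<^esub> y') 1 -
        (Poly_Mapping.single (x, y) 1 \<oplus>\<^bsub>F\<^esub> Poly_Mapping.single (x, y') 1) \<in> bilinearity_relators A B"
      using relatorsI(2)[OF x] by (simp only: monoid_algebra_simps(2) diff_diff_eq)
  qed (use x in \<open>auto intro!: single_F F.a_closed\<close>)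
next
  fix c x y assume x: "x \<in> carrier A" "y \<in> carrier B"
  show "pure_tensor A B (c \<odot>\<^bsub>A\<^esub> x) y = c \<odot>\<^bsub>T\<^esub> pure_tensor A B x y"
    unfolding smult_pure[OF x] unfolding pure_tensor_def
    using x by (intro coset_eqI single_F relatorsI) auto
  show "pure_tensor A B x (c \<odot>\<^bsub>B\<^esub> y) = c \<odot>\<^bsub>T\<^esub> pure_tensor A B x y"
    unfolding smult_pure[OF x] unfolding pure_tensor_def
    using x by (intro coset_eqI single_F relatorsI) auto
qed auto

lemmas pure_simps = bilinear_mapsD(2-)[OF pure_bilinear]

lemma pure_mult:
  assumes "a \<in> carrier A" "a' \<in> carrier A" "b \<in> carrier B" "b' \<in> carrier B"
  shows "pure_tensor A B a b \<otimes>\<^bsub>T\<^esub> pure_tensor A B a' b' = pure_tensor A B (a \<otimes>\<^bsub>A\<^esub> a') (b \<otimes>\<^bsub>B\<^esub> b')"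
  using assms unfolding pure_tensor_def
  by (simp add: Q.quot_ops single_F monoid_algebra_single)

lemma pure_one: "\<one>\<^bsub>T\<^esub> = pure_tensor A B \<one>\<^bsub>A\<^esub> \<one>\<^bsub>B\<^esub>"
  unfolding pure_tensor_def Q.quot_ops by (simp add: monoid_algebra_simps)

text \<open>Scalar coefficients are absorbed into the first factor of a pure tensor, so sums of pure
  tensors exhaust the tensor product and no case for scalars arises. The zero class is a monomial
  with coefficient \<open>0\<close>.\<close>

lemma tensor_induct [consumes 1, case_names pure add]:
  assumes "t \<in> carrier T"
    and "\<And>a b. a \<in> carrier A \<Longrightarrow> b \<in> carrier B \<Longrightarrow> P (pure_tensor A B a b)"
    and "\<And>s t. s \<in> carrier T \<Longrightarrow> t \<in> carrier T \<Longrightarrow> P s \<Longrightarrow> P t \<Longrightarrow> P (s \<oplus>\<^bsub>T\<^esub> t)"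
  shows "P t"
proof -
  obtain p where p: "p \<in> carrier F" "t = N +>\<^bsub>F\<^esub> p"
    using assms(1) by (auto simp: Q.quot_carrier)
  have single: "P (N +>\<^bsub>F\<^esub> Poly_Mapping.single k c)" if "k \<in> carrier (A \<times>\<times> B)" for k c
  proof -
    obtain u v where k: "k = (u, v)" "u \<in> carrier A" "v \<in> carrier B"
      using \<open>k \<in> carrier (A \<times>\<times> B)\<close> by (cases k) (simp add: DirProd_def)
    show ?thesis
      using assms(2)[of "c \<odot>\<^bsub>A\<^esub> u" v] k by (simp add: pure_simps smult_pure)
  qed
  have "P (N +>\<^bsub>F\<^esub> p)"
    using p(1)[unfolded monoid_algebra_simps]
  proof (induction p rule: poly_mapping_keys_induct)
    case zero
    show ?case using single[of "(\<zero>\<^bsub>A\<^esub>, \<zero>\<^bsub>B\<^esub>)" 0] by simp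
  next
    case (single k c)
    then show ?case by (rule \<open>\<And>k c. k \<in> carrier (A \<times>\<times> B) \<Longrightarrow> P (N +>\<^bsub>F\<^esub> Poly_Mapping.single k c)\<close>)
  next
    case (add p q)
    then have "p \<in> carrier F" "q \<in> carrier F" by (simp_all add: monoid_algebra_simps)
    then show ?case
      using assms(3)[of "N +>\<^bsub>F\<^esub> p" "N +>\<^bsub>F\<^esub> q"] add
      by (simp add: Q.quot_carrier Q.quot_ops) (simp add: monoid_algebra_simps(2))
  qed
  then show ?thesis by (simp add: p)
qed

section \<open>The universal property of the tensor product\<close>

lemma tensor_lift_linear_ext:
  "tensor_lift M \<beta> Z = the_elem (linear_ext M (\<lambda>k. \<beta> (fst k) (snd k)) ` Z)"
  by (simp add: tensor_lift_def linear_ext_def)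

context
  fixes M :: "(complex, 'c, 'k) module_scheme" and \<beta>
  assumes M: "complex_algebra M" and \<beta>: "\<beta> \<in> bilinear_maps A B M"
begin

interpretation M: complex_algebra M by (rule M)

lemma linear_ext_bilinear: "linear_ext M (\<lambda>k. \<beta> (fst k) (snd k)) \<in> linear_maps F M"
  by (rule M.linear_ext_linear) (auto simp: bilinear_mapsD[OF \<beta>])

text \<open>The kernel of the linear extension is a submodule, and bilinearity of
  \<open>\<beta>\<close> says exactly that it contains the relators; so it contains the smallest
  such submodule.\<close>

lemma linear_ext_null:
  assumes "n \<in> N"
  shows "linear_ext M (\<lambda>k. \<beta> (fst k) (snd k)) n = \<zero>\<^bsub>M\<^esub>" (is "?f n = _")
proof -
  note lin = linear_ext_bilinear
  define H where "H = {p \<in> carrier F. ?f p = \<zero>\<^bsub>M\<^esub>}"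
  have fs: "?f (Poly_Mapping.single (a, b) c) = c \<odot>\<^bsub>M\<^esub> \<beta> a b" if "a \<in> carrier A" "b \<in> carrier B" for a b c
    using M.linear_ext_single[of "\<lambda>k. \<beta> (fst k) (snd k)" "(a, b)"] that bilinear_mapsD(1)[OF \<beta> that] by simp
  have fd: "?f (p - q) = ?f p \<ominus>\<^bsub>M\<^esub> ?f q" if "p \<in> carrier F" "q \<in> carrier F" for p q
    using linear_maps_diff[OF lin F.complex_algebra_axioms M that] minus_F[OF that] by simp
  have dF: "p - q \<in> carrier F" if "p \<in> carrier F" "q \<in> carrier F" for p q
    using F.minus_closed[OF that] minus_F[OF that] by simp
  have "submodule H complex_ring F"
    by (rule F.submoduleI)
      (auto simp: H_def linear_maps_zero[OF lin F.complex_algebra_axioms M]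
        linear_maps_minus[OF lin F.complex_algebra_axioms M] linear_mapsD[OF lin])
  moreover have "bilinearity_relators A B \<subseteq> H"
  proof
    fix r assume r: "r \<in> bilinearity_relators A B"
    from r have "?f r = \<zero>\<^bsub>M\<^esub>"
      unfolding bilinearity_relators_def
      by (elim UnE CollectE exE conjE) (simp_all add: fd fs dF single_F bilinear_mapsD[OF \<beta>] M.add_minus_cancel)
    then show "r \<in> H" using r relators_subset by (auto simp: H_def)
  qed
  ultimately have "N \<subseteq> H" by (rule null_minimal)
  then show ?thesis using assms by (auto simp: H_def)
qed

lemma tensor_lift_linear: "tensor_lift M \<beta> \<in> linear_maps T M"
  using Q.quot_lift_linear[OF linear_ext_bilinear M linear_ext_null]
  by (simp add: tensor_lift_linear_ext[abs_def])

lemma tensor_lift_pure: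
  assumes "a \<in> carrier A" "b \<in> carrier B"
  shows "tensor_lift M \<beta> (pure_tensor A B a b) = \<beta> a b"
  using Q.the_elem_coset[OF linear_ext_bilinear M linear_ext_null single_F[OF assms, of 1]] assms
    M.linear_ext_single[of "\<lambda>k. \<beta> (fst k) (snd k)" "(a, b)" 1] bilinear_mapsD(1)[OF \<beta> assms]
  by (simp add: tensor_lift_linear_ext pure_tensor_def)

text \<open>Additivity in both arguments reduces the product rule to pure tensors, where it is the
  hypothesis on \<open>\<beta>\<close>.\<close>

lemma tensor_lift_hom:
  assumes "\<And>a a' b b'. a \<in> carrier A \<Longrightarrow> a' \<in> carrier A \<Longrightarrow> b \<in> carrier B \<Longrightarrow> b' \<in> carrier B \<Longrightarrow>
      \<beta> (a \<otimes>\<^bsub>A\<^esub> a') (b \<otimes>\<^bsub>B\<^esub> b') = \<beta> a b \<otimes>\<^bsub>M\<^esub> \<beta> a' b'"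
    and "\<beta> \<one>\<^bsub>A\<^esub> \<one>\<^bsub>B\<^esub> = \<one>\<^bsub>M\<^esub>"
  shows "tensor_lift M \<beta> \<in> algebra_homs T M"
proof (rule algebra_homsI[OF tensor_lift_linear])
  note lin = linear_mapsD[OF tensor_lift_linear]
  show "tensor_lift M \<beta> (s \<otimes>\<^bsub>T\<^esub> t) = tensor_lift M \<beta> s \<otimes>\<^bsub>M\<^esub> tensor_lift M \<beta> t"
    if "s \<in> carrier T" "t \<in> carrier T" for s t
    using that
  proof (induction s rule: tensor_induct)
    case (pure a b)
    from pure(3) show ?case
      by (induction t rule: tensor_induct)
        (use pure(1,2) in \<open>simp_all add: pure_mult tensor_lift_pure assms lin Q.quot.r_distr M.r_distr
          bilinear_mapsD(1)[OF \<beta>]\<close>)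
  qed (simp_all add: lin Q.quot.l_distr M.l_distr)
  show "tensor_lift M \<beta> \<one>\<^bsub>T\<^esub> = \<one>\<^bsub>M\<^esub>"
    by (simp add: pure_one tensor_lift_pure assms)
qed

end

end

sublocale algebra_pair \<subseteq> T: complex_algebra "tensor_algebra A B"
  by (rule tensor_complex_algebra)

lemma tensor_map_bilinear:
  assumes "complex_algebra C" "complex_algebra D" "f \<in> linear_maps A C" "g \<in> linear_maps B D"
  shows "(\<lambda>a b. pure_tensor C D (f a) (g b)) \<in> bilinear_maps A B (tensor_algebra C D)"
proof -
  interpret CD: algebra_pair C D
    using assms by (simp add: algebra_pair_def)
  show ?thesis
    by (rule bilinear_mapsI)
      (simp_all add: CD.pure_simps linear_mapsD[OF assms(3)] linear_mapsD[OF assms(4)])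
qed

context algebra_pair
begin

lemma tensor_map_linear:
  assumes "complex_algebra C" "complex_algebra D" "f \<in> linear_maps A C" "g \<in> linear_maps B D"
  shows "tensor_map C D f g \<in> linear_maps T (tensor_algebra C D)"
proof -
  interpret CD: algebra_pair C D
    using assms by (simp add: algebra_pair_def)
  show ?thesis
    unfolding tensor_map_def
    by (intro tensor_lift_linear tensor_map_bilinear assms CD.tensor_complex_algebra)
qed

lemma tensor_map_pure:
  assumes "complex_algebra C" "complex_algebra D" "f \<in> linear_maps A C" "g \<in> linear_maps B D"
    "a \<in> carrier A" "b \<in> carrier B"
  shows "tensor_map C D f g (pure_tensor A B a b) = pure_tensor C D (f a) (g b)"
proof -
  interpret CD: algebra_pair C D
    using assms by (simp add: algebra_pair_def)
  show ?thesis
    unfolding tensor_map_def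
    by (intro tensor_lift_pure tensor_map_bilinear assms CD.tensor_complex_algebra)
qed

lemma tensor_map_hom:
  assumes "complex_algebra C" "complex_algebra D" "f \<in> algebra_homs A C" "g \<in> algebra_homs B D"
  shows "tensor_map C D f g \<in> algebra_homs T (tensor_algebra C D)"
proof -
  interpret CD: algebra_pair C D
    using assms by (simp add: algebra_pair_def)
  show ?thesis
    unfolding tensor_map_def
    by (intro tensor_lift_hom tensor_map_bilinear assms CD.tensor_complex_algebra algebra_homsD(1))
      (simp_all add: algebra_homsD[OF assms(3)] algebra_homsD[OF assms(4)] CD.pure_mult CD.pure_one)
qed

lemma pure_finsum_left:
  assumes "\<And>i. i \<in> I \<Longrightarrow> f i \<in> carrier A" "b \<in> carrier B"
  shows "pure_tensor A B (\<Oplus>\<^bsub>A\<^esub>i\<in>I. f i) b = (\<Oplus>\<^bsub>T\<^esub>i\<in>I. pure_tensor A B (f i) b)"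
  by (rule linear_maps_finsum[where f = "\<lambda>a. pure_tensor A B a b" and A = A and B = T])
    (auto intro!: linear_mapsI A.complex_algebra_axioms tensor_complex_algebra simp: assms pure_simps)

lemma pure_finsum_right:
  assumes "\<And>i. i \<in> I \<Longrightarrow> f i \<in> carrier B" "a \<in> carrier A"
  shows "pure_tensor A B a (\<Oplus>\<^bsub>B\<^esub>i\<in>I. f i) = (\<Oplus>\<^bsub>T\<^esub>i\<in>I. pure_tensor A B a (f i))"
  by (rule linear_maps_finsum[where f = "\<lambda>b. pure_tensor A B a b" and A = B and B = T])
    (auto intro!: linear_mapsI B.complex_algebra_axioms tensor_complex_algebra simp: assms pure_simps)

end

section \<open>Associativity of the tensor product\<close>

locale algebra_triple = AB: algebra_pair A B + BC: algebra_pair B C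
  for A :: "(complex, 'a, 'm) module_scheme" and B :: "(complex, 'b, 'n) module_scheme"
    and C :: "(complex, 'c, 'k) module_scheme"
begin

abbreviation U where "U \<equiv> tensor_algebra A (tensor_algebra B C)"

interpretation AU: algebra_pair A "tensor_algebra B C"
  by (simp add: algebra_pair_def AB.A.complex_algebra_axioms BC.tensor_complex_algebra)

interpretation UC: algebra_pair "tensor_algebra A B" C
  by (simp add: algebra_pair_def BC.B.complex_algebra_axioms AB.tensor_complex_algebra)

lemma assoc_inner_bilinear:
  assumes "c \<in> carrier C"
  shows "(\<lambda>a b. pure_tensor A (tensor_algebra B C) a (pure_tensor B C b c)) \<in> bilinear_maps A B U"
  using assms by (intro bilinear_mapsI) (simp_all add: AU.pure_simps BC.pure_simps)

lemmas assoc_inner_linear = linear_mapsD[OF AB.tensor_lift_linear[OF AU.tensor_complex_algebra assoc_inner_bilinear]]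
lemmas assoc_inner_pure = AB.tensor_lift_pure[OF AU.tensor_complex_algebra assoc_inner_bilinear]

text \<open>For fixed \<open>c\<close> the inner lift is linear in \<open>t\<close> by construction.
  Linearity in \<open>c\<close> compares lifts of different bilinear maps and has to be proved by
  induction on \<open>t\<close>.\<close>

lemma assoc_outer_bilinear:
  "(\<lambda>t c. tensor_lift U (\<lambda>a b. pure_tensor A (tensor_algebra B C) a (pure_tensor B C b c)) t)
    \<in> bilinear_maps (tensor_algebra A B) C U" (is "?\<beta> \<in> _")
proof (rule bilinear_mapsI)
  fix t c c' assume t: "t \<in> carrier (tensor_algebra A B)" and c: "c \<in> carrier C" "c' \<in> carrier C"
  from t show "?\<beta> t (c \<oplus>\<^bsub>C\<^esub> c') = ?\<beta> t c \<oplus>\<^bsub>U\<^esub> ?\<beta> t c'"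
  proof (induction t rule: AB.tensor_induct)
    case (pure a b)
    then show ?case using c by (simp add: assoc_inner_pure BC.pure_simps AU.pure_simps)
  next
    case (add s t)
    then show ?case using c
      by (simp add: assoc_inner_linear)
        (simp add: AU.T.a_assoc AU.T.a_comm AU.T.a_lcomm assoc_inner_linear)
  qed
next
  fix t c and k :: complex
  assume t: "t \<in> carrier (tensor_algebra A B)" and c: "c \<in> carrier C"
  from t show "?\<beta> t (k \<odot>\<^bsub>C\<^esub> c) = k \<odot>\<^bsub>U\<^esub> ?\<beta> t c"
  proof (induction t rule: AB.tensor_induct)
    case (pure a b)
    then show ?case using c by (simp add: assoc_inner_pure BC.pure_simps AU.pure_simps)
  next
    case (add s t)
    then show ?case using c by (simp add: assoc_inner_linear AU.T.smult_add_right)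
  qed
qed (simp_all add: assoc_inner_linear)

lemma tensor_assoc_pure:
  assumes "a \<in> carrier A" "b \<in> carrier B" "c \<in> carrier C"
  shows "tensor_assoc A B C (pure_tensor (tensor_algebra A B) C (pure_tensor A B a b) c) =
    pure_tensor A (tensor_algebra B C) a (pure_tensor B C b c)"
  unfolding tensor_assoc_def Let_def using assms
  by (simp add: UC.tensor_lift_pure[OF AU.tensor_complex_algebra assoc_outer_bilinear] assoc_inner_pure)

text \<open>Multiplicativity of the associator is what allows coassociativity to be tested on
  algebra generators instead of on all elements.\<close>

lemma tensor_assoc_hom: "tensor_assoc A B C \<in> algebra_homs (tensor_algebra (tensor_algebra A B) C) U"
  unfolding tensor_assoc_def Let_def
proof (rule UC.tensor_lift_hom[OF AU.tensor_complex_algebra assoc_outer_bilinear])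
  let ?\<beta> = "\<lambda>c t. tensor_lift U (\<lambda>a b. pure_tensor A (tensor_algebra B C) a (pure_tensor B C b c)) t"
  fix s t c d
  assume st: "s \<in> carrier (tensor_algebra A B)" "t \<in> carrier (tensor_algebra A B)"
    and cd: "c \<in> carrier C" "d \<in> carrier C"
  from st show "?\<beta> (c \<otimes>\<^bsub>C\<^esub> d) (s \<otimes>\<^bsub>tensor_algebra A B\<^esub> t) = ?\<beta> c s \<otimes>\<^bsub>U\<^esub> ?\<beta> d t"
  proof (induction s rule: AB.tensor_induct)
    case (pure a b)
    from pure(3) show ?case
    proof (induction t rule: AB.tensor_induct)
      case (pure a' b')
      then show ?case using \<open>a \<in> carrier A\<close> \<open>b \<in> carrier B\<close> cd
        by (simp add: AB.pure_mult BC.pure_mult AU.pure_mult assoc_inner_pure)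
    next
      case (add s t)
      then show ?case using \<open>a \<in> carrier A\<close> \<open>b \<in> carrier B\<close> cd
        by (simp add: AB.T.r_distr AU.T.r_distr assoc_inner_linear)
    qed
  next
    case (add s s')
    then show ?case using cd
      by (simp add: AB.T.l_distr AU.T.l_distr assoc_inner_linear)
  qed
qed (simp add: AB.pure_one BC.pure_one AU.pure_one assoc_inner_pure)

end

section \<open>Algebras generated by a set\<close>

text \<open>The unital subalgebra generated by \<open>Y\<close>; zero and negatives arise from the
  scalar rule.\<close>

inductive_set alg_span :: "(complex, 'a, 'm) module_scheme \<Rightarrow> 'a set \<Rightarrow> 'a set"
  for A (structure) and Y where
  base: "y \<in> Y \<Longrightarrow> y \<in> alg_span A Y"
| one: "\<one> \<in> alg_span A Y"
| add: "x \<in> alg_span A Y \<Longrightarrow> y \<in> alg_span A Y \<Longrightarrow> x \<oplus> y \<in> alg_span A Y"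
| smult: "x \<in> alg_span A Y \<Longrightarrow> c \<odot> x \<in> alg_span A Y"
| mult: "x \<in> alg_span A Y \<Longrightarrow> y \<in> alg_span A Y \<Longrightarrow> x \<otimes> y \<in> alg_span A Y"

lemma (in complex_algebra) alg_span_closed:
  assumes "Y \<subseteq> carrier A" "x \<in> alg_span A Y"
  shows "x \<in> carrier A"
  using assms(2) by (induction rule: alg_span.induct) (use assms(1) in auto)

lemma algebra_homs_eq_span:
  assumes "f \<in> algebra_homs A B" "g \<in> algebra_homs A B" "complex_algebra A" "Y \<subseteq> carrier A"
    and "\<And>y. y \<in> Y \<Longrightarrow> f y = g y" "x \<in> alg_span A Y"
  shows "f x = g x"
proof -
  note [simp] = complex_algebra.alg_span_closed[OF assms(3,4)]
  from assms(6) show ?thesis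
    by (induction rule: alg_span.induct)
      (simp_all add: assms(5) algebra_homsD[OF assms(1)] algebra_homsD[OF assms(2)])
qed

lemma alg_span_hom:
  assumes "f \<in> algebra_homs A B" "complex_algebra A" "Y \<subseteq> carrier A" "x \<in> alg_span A Y"
  shows "f x \<in> alg_span B (f ` Y)"
proof -
  note [simp] = complex_algebra.alg_span_closed[OF assms(2,3)]
  from assms(4) show ?thesis
    by (induction rule: alg_span.induct)
      (simp_all add: algebra_homsD[OF assms(1)] alg_span.intros)
qed

lemma complex_numbers_algebra: "complex_algebra complex_numbers_algebra"
  by (rule complex_algebraI)
    (simp_all add: complex_numbers_algebra_def ring.extend_def module.fields_def
      ring_of_type_algebra_def algebra_simps)

lemma complex_numbers_simps:
  "carrier complex_numbers_algebra = UNIV"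
  "x \<otimes>\<^bsub>complex_numbers_algebra\<^esub> y = x * y"
  "x \<oplus>\<^bsub>complex_numbers_algebra\<^esub> y = x + y"
  "\<one>\<^bsub>complex_numbers_algebra\<^esub> = 1"
  "\<zero>\<^bsub>complex_numbers_algebra\<^esub> = 0"
  "c \<odot>\<^bsub>complex_numbers_algebra\<^esub> x = c * x"
  by (simp_all add: complex_numbers_algebra_def ring.extend_def module.fields_def ring_of_type_algebra_def)

section \<open>Matrix Hopf algebras\<close>

text \<open>The criterion to which the theorem is reduced: for an algebra generated by the entries
  of a matrix, the Hopf axioms follow from their instances on entries. The two antipode conditions
  say that applying \<open>S\<close> entrywise gives the two-sided inverse of the matrix.\<close>

locale matrix_bialgebra = complex_algebra A for A (structure) +
  fixes I :: "'i set" and a :: "'i \<Rightarrow> 'i \<Rightarrow> 'a"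
    and \<Delta> :: "'a \<Rightarrow> ('a \<times> 'a \<Rightarrow>\<^sub>0 complex) set" and \<epsilon> :: "'a \<Rightarrow> complex" and S :: "'a \<Rightarrow> 'a"
  assumes fin: "finite I"
    and entry: "\<And>i j. i \<in> I \<Longrightarrow> j \<in> I \<Longrightarrow> a i j \<in> carrier A"
    and span: "carrier A \<subseteq> alg_span A {a i j | i j. i \<in> I \<and> j \<in> I}"
    and comult: "\<Delta> \<in> algebra_homs A (tensor_algebra A A)"
    and comult_entry: "\<And>i j. i \<in> I \<Longrightarrow> j \<in> I \<Longrightarrow>
      \<Delta> (a i j) = (\<Oplus>\<^bsub>tensor_algebra A A\<^esub>k\<in>I. pure_tensor A A (a i k) (a k j))"
    and counit: "\<epsilon> \<in> algebra_homs A complex_numbers_algebra"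
    and counit_entry: "\<And>i j. i \<in> I \<Longrightarrow> j \<in> I \<Longrightarrow> \<epsilon> (a i j) = (if i = j then 1 else 0)"
    and antipode: "S \<in> algebra_antihoms A A"
    and antipode_left_entry: "\<And>i j. i \<in> I \<Longrightarrow> j \<in> I \<Longrightarrow>
      (\<Oplus>k\<in>I. S (a i k) \<otimes> a k j) = (if i = j then \<one> else \<zero>)"
    and antipode_right_entry: "\<And>i j. i \<in> I \<Longrightarrow> j \<in> I \<Longrightarrow>
      (\<Oplus>k\<in>I. a i k \<otimes> S (a k j)) = (if i = j then \<one> else \<zero>)"
begin

abbreviation "AA \<equiv> tensor_algebra A A"

abbreviation "gens \<equiv> {a i j | i j. i \<in> I \<and> j \<in> I}"

lemma gens: "gens \<subseteq> carrier A"
  using entry by auto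

interpretation T: algebra_triple A A A
  by (simp add: algebra_triple_def algebra_pair_def complex_algebra_axioms)

interpretation AU: algebra_pair A "tensor_algebra A A"
  by (simp add: algebra_pair_def complex_algebra_axioms T.AB.tensor_complex_algebra)

interpretation UC: algebra_pair "tensor_algebra A A" A
  by (simp add: algebra_pair_def complex_algebra_axioms T.AB.tensor_complex_algebra)

lemma S_linear: "S \<in> linear_maps A A" and S_one: "S \<one> = \<one>"
  and S_mult: "x \<in> carrier A \<Longrightarrow> y \<in> carrier A \<Longrightarrow> S (x \<otimes> y) = S y \<otimes> S x"
  using antipode by (auto simp: algebra_antihoms_def)

lemmas S_simps = linear_mapsD[OF S_linear] S_one S_mult

lemma comult_closed: "x \<in> carrier A \<Longrightarrow> \<Delta> x \<in> carrier AA"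
  by (rule algebra_homsD(2)[OF comult])

lemma eq_on_gens:
  assumes "f \<in> algebra_homs A B" "g \<in> algebra_homs A B" "x \<in> carrier A"
    "\<And>i j. i \<in> I \<Longrightarrow> j \<in> I \<Longrightarrow> f (a i j) = g (a i j)"
  shows "f x = g x"
  by (rule algebra_homs_eq_span[OF assms(1,2) complex_algebra_axioms gens]) (use assms span in auto)

text \<open>Both sides are composites of algebra homomorphisms, so it suffices to compare them on
  entries. There each is the double sum of \<open>a i l\<close>, \<open>a l k\<close>,
  \<open>a k j\<close> tensored together, and only the order of summation differs.\<close>

lemma coassociative:
  assumes "x \<in> carrier A"
  shows "tensor_assoc A A A (tensor_map AA A \<Delta> (\<lambda>a. a) (\<Delta> x)) = tensor_map A AA (\<lambda>a. a) \<Delta> (\<Delta> x)"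
proof (rule eq_on_gens[OF _ _ assms])
  note idh = algebra_homs_id[of A]
  note AA = T.AB.tensor_complex_algebra
  note homL = T.AB.tensor_map_hom[OF AA complex_algebra_axioms comult idh]
  note homR = T.AB.tensor_map_hom[OF complex_algebra_axioms AA idh comult]
  show "(\<lambda>x. tensor_assoc A A A (tensor_map AA A \<Delta> (\<lambda>a. a) (\<Delta> x))) \<in> algebra_homs A T.U"
    by (intro algebra_homs_comp[OF algebra_homs_comp[OF comult homL] T.tensor_assoc_hom])
  show "(\<lambda>x. tensor_map A AA (\<lambda>a. a) \<Delta> (\<Delta> x)) \<in> algebra_homs A T.U"
    by (intro algebra_homs_comp[OF comult homR])
  fix i j assume ij: "i \<in> I" "j \<in> I"
  have "tensor_map AA A \<Delta> (\<lambda>a. a) (\<Delta> (a i j)) =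
      (\<Oplus>\<^bsub>tensor_algebra AA A\<^esub>k\<in>I. pure_tensor AA A (\<Delta> (a i k)) (a k j))"
    unfolding comult_entry[OF ij] using ij
    by (intro linear_maps_finsum_eq[OF algebra_homsD(1)[OF homL] AA UC.tensor_complex_algebra])
      (simp_all add: entry
        T.AB.tensor_map_pure[OF AA complex_algebra_axioms algebra_homsD(1)[OF comult] algebra_homsD(1)[OF idh]])
  also have "\<dots> = (\<Oplus>\<^bsub>tensor_algebra AA A\<^esub>k\<in>I. \<Oplus>\<^bsub>tensor_algebra AA A\<^esub>l\<in>I.
      pure_tensor AA A (pure_tensor A A (a i l) (a l k)) (a k j))"
    using ij
    by (intro UC.T.finsum_eqI)
      (simp_all add: entry comult_entry UC.pure_finsum_left UC.T.finsum_closed)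
  finally have "tensor_assoc A A A (tensor_map AA A \<Delta> (\<lambda>a. a) (\<Delta> (a i j))) =
      tensor_assoc A A A (\<Oplus>\<^bsub>tensor_algebra AA A\<^esub>k\<in>I. \<Oplus>\<^bsub>tensor_algebra AA A\<^esub>l\<in>I.
        pure_tensor AA A (pure_tensor A A (a i l) (a l k)) (a k j))"
    by simp
  also have "\<dots> =
      (\<Oplus>\<^bsub>T.U\<^esub>k\<in>I. \<Oplus>\<^bsub>T.U\<^esub>l\<in>I. pure_tensor A AA (a i l) (pure_tensor A A (a l k) (a k j)))"
    using ij
    by (intro linear_maps_finsum_eq[OF algebra_homsD(1)[OF T.tensor_assoc_hom]
          UC.tensor_complex_algebra AU.tensor_complex_algebra])
      (simp_all add: entry UC.T.finsum_closed T.tensor_assoc_pure)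
  also have "\<dots> = (\<Oplus>\<^bsub>T.U\<^esub>l\<in>I. \<Oplus>\<^bsub>T.U\<^esub>k\<in>I. pure_tensor A AA (a i l) (pure_tensor A A (a l k) (a k j)))"
    using ij fin by (intro AU.T.finsum_swap) (simp_all add: entry)
  also have "\<dots> = (\<Oplus>\<^bsub>T.U\<^esub>l\<in>I. pure_tensor A AA (a i l) (\<Delta> (a l j)))"
    using ij
    by (intro AU.T.finsum_eqI)
      (simp_all add: entry comult_closed, simp add: comult_entry entry AU.pure_finsum_right)
  also have "\<dots> = tensor_map A AA (\<lambda>a. a) \<Delta> (\<Delta> (a i j))"
    unfolding comult_entry[OF ij] using ij
    by (intro linear_maps_finsum_eq[OF algebra_homsD(1)[OF homR] AA AU.tensor_complex_algebra, symmetric])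
      (simp_all add: entry comult_closed
        T.AB.tensor_map_pure[OF complex_algebra_axioms AA algebra_homsD(1)[OF idh] algebra_homsD(1)[OF comult]])
  finally show "tensor_assoc A A A (tensor_map AA A \<Delta> (\<lambda>a. a) (\<Delta> (a i j))) =
    tensor_map A AA (\<lambda>a. a) \<Delta> (\<Delta> (a i j))" .
qed

lemmas counit_simps = algebra_homsD[OF counit, unfolded complex_numbers_simps]

text \<open>Values of \<open>\<epsilon>\<close> are scalars and commute with everything, so both
  contractions are algebra homomorphisms. On entries the Kronecker delta selects a single
  summand.\<close>

lemma counit_axiom:
  assumes "x \<in> carrier A"
  shows "tensor_lift A (\<lambda>a b. \<epsilon> a \<odot> b) (\<Delta> x) = x" "tensor_lift A (\<lambda>a b. \<epsilon> b \<odot> a) (\<Delta> x) = x"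
proof -
  have bl: "(\<lambda>a b. \<epsilon> a \<odot> b) \<in> bilinear_maps A A A" "(\<lambda>a b. \<epsilon> b \<odot> a) \<in> bilinear_maps A A A"
    by (auto intro!: bilinear_mapsI simp: counit_simps smult_add_left smult_add_right smult_smult mult.commute)
  have hom: "tensor_lift A (\<lambda>a b. \<epsilon> a \<odot> b) \<in> algebra_homs AA A"
    "tensor_lift A (\<lambda>a b. \<epsilon> b \<odot> a) \<in> algebra_homs AA A"
    by (auto intro!: T.AB.tensor_lift_hom complex_algebra_axioms bl
      simp: counit_simps smult_mult_left smult_mult_right smult_smult mult.commute)
  have delta: "(\<Oplus>k\<in>I. (if k = i then 1 else 0 :: complex) \<odot> f k) = f i" if "i \<in> I" "\<And>k. k \<in> I \<Longrightarrow> f k \<in> carrier A"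
    for i f
  proof -
    have "(\<Oplus>k\<in>I. (if k = i then 1 else 0 :: complex) \<odot> f k) = (\<Oplus>k\<in>I. if k = i then f k else \<zero>)"
      using that by (intro finsum_cong') auto
    then show ?thesis using that fin by (simp add: finsum_delta)
  qed
  show "tensor_lift A (\<lambda>a b. \<epsilon> a \<odot> b) (\<Delta> x) = x"
  proof (rule eq_on_gens[OF algebra_homs_comp[OF comult hom(1)] algebra_homs_id assms])
    fix i j assume ij: "i \<in> I" "j \<in> I"
    have "tensor_lift A (\<lambda>a b. \<epsilon> a \<odot> b) (\<Delta> (a i j)) = (\<Oplus>k\<in>I. \<epsilon> (a i k) \<odot> a k j)"
      unfolding comult_entry[OF ij] using ij
      by (intro linear_maps_finsum_eq[OF algebra_homsD(1)[OF hom(1)] T.AB.tensor_complex_algebra complex_algebra_axioms])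
        (simp_all add: entry T.AB.tensor_lift_pure[OF complex_algebra_axioms bl(1)])
    also have "\<dots> = (\<Oplus>k\<in>I. (if k = i then 1 else 0 :: complex) \<odot> a k j)"
      using ij by (intro finsum_cong') (auto simp: counit_entry entry)
    finally show "tensor_lift A (\<lambda>a b. \<epsilon> a \<odot> b) (\<Delta> (a i j)) = a i j"
      using ij by (simp add: delta entry)
  qed
  show "tensor_lift A (\<lambda>a b. \<epsilon> b \<odot> a) (\<Delta> x) = x"
  proof (rule eq_on_gens[OF algebra_homs_comp[OF comult hom(2)] algebra_homs_id assms])
    fix i j assume ij: "i \<in> I" "j \<in> I"
    have "tensor_lift A (\<lambda>a b. \<epsilon> b \<odot> a) (\<Delta> (a i j)) = (\<Oplus>k\<in>I. \<epsilon> (a k j) \<odot> a i k)"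
      unfolding comult_entry[OF ij] using ij
      by (intro linear_maps_finsum_eq[OF algebra_homsD(1)[OF hom(2)] T.AB.tensor_complex_algebra complex_algebra_axioms])
        (simp_all add: entry T.AB.tensor_lift_pure[OF complex_algebra_axioms bl(2)])
    also have "\<dots> = (\<Oplus>k\<in>I. (if k = j then 1 else 0 :: complex) \<odot> a i k)"
      using ij by (intro finsum_cong') (auto simp: counit_entry entry)
    finally show "tensor_lift A (\<lambda>a b. \<epsilon> b \<odot> a) (\<Delta> (a i j)) = a i j"
      using ij by (simp add: delta entry)
  qed
qed

section \<open>The antipode axioms\<close>

lemma mult_bilinear: "(\<lambda>a b. a \<otimes> b) \<in> bilinear_maps A A A"
  by (rule bilinear_mapsI) (simp_all add: l_distr r_distr smult_mult_left smult_mult_right)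

lemmas mult_map = T.AB.tensor_lift_linear[OF complex_algebra_axioms mult_bilinear]
  T.AB.tensor_lift_pure[OF complex_algebra_axioms mult_bilinear]

abbreviation "convL t \<equiv> tensor_lift A (\<lambda>a b. a \<otimes> b) (tensor_map A A S (\<lambda>a. a) t)"
abbreviation "convR t \<equiv> tensor_lift A (\<lambda>a b. a \<otimes> b) (tensor_map A A (\<lambda>a. a) S t)"

lemma conv_linear: "(\<lambda>t. convL t) \<in> linear_maps AA A" "(\<lambda>t. convR t) \<in> linear_maps AA A"
  by (intro linear_maps_comp[OF T.AB.tensor_map_linear mult_map(1)] complex_algebra_axioms S_linear
    algebra_homsD(1)[OF algebra_homs_id])+

lemma conv_pure:
  assumes "x \<in> carrier A" "y \<in> carrier A"
  shows "convL (pure_tensor A A x y) = S x \<otimes> y" "convR (pure_tensor A A x y) = x \<otimes> S y"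
  using assms
  by (simp_all add: T.AB.tensor_map_pure complex_algebra_axioms S_linear algebra_homsD(1)[OF algebra_homs_id]
    mult_map(2) S_simps)

lemmas convL_simps = linear_mapsD[OF conv_linear(1)]
lemmas convR_simps = linear_mapsD[OF conv_linear(2)]

text \<open>The map \<open>convL\<close> is not multiplicative in general, and this is the
  substitute: since \<open>S\<close> reverses products, a pure tensor multiplied on the right wraps
  the value of \<open>convL\<close> between \<open>S c\<close> and \<open>d\<close>.\<close>

lemma convL_mult:
  assumes "u \<in> carrier AA" "c \<in> carrier A" "d \<in> carrier A"
  shows "convL (u \<otimes>\<^bsub>AA\<^esub> pure_tensor A A c d) = S c \<otimes> convL u \<otimes> d"
  using assms(1)
proof (induction u rule: T.AB.tensor_induct)
  case (pure a b)
  then show ?case using assms by (simp add: T.AB.pure_mult conv_pure S_simps m_assoc)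
next
  case (add s t)
  then show ?case using assms by (simp add: T.AB.T.l_distr convL_simps l_distr r_distr S_simps)
qed

lemma convR_mult:
  assumes "u \<in> carrier AA" "c \<in> carrier A" "d \<in> carrier A"
  shows "convR (pure_tensor A A c d \<otimes>\<^bsub>AA\<^esub> u) = c \<otimes> convR u \<otimes> S d"
  using assms(1)
proof (induction u rule: T.AB.tensor_induct)
  case (pure a b)
  then show ?case using assms by (simp add: T.AB.pure_mult conv_pure S_simps m_assoc)
next
  case (add s t)
  then show ?case using assms by (simp add: T.AB.T.r_distr convR_simps l_distr r_distr S_simps)
qed

text \<open>A scalar value can be pulled out from between \<open>S c\<close> and \<open>d\<close>.
  So \<open>convL\<close> behaves multiplicatively as soon as its value on the left factor is a
  scalar, which is what the antipode axiom asserts.\<close>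

lemma convL_scalar:
  assumes "u \<in> carrier AA" "v \<in> carrier AA" "convL u = e \<odot> \<one>"
  shows "convL (u \<otimes>\<^bsub>AA\<^esub> v) = e \<odot> convL v"
  using assms(2)
proof (induction v rule: T.AB.tensor_induct)
  case (pure c d)
  then show ?case
    using assms by (simp add: convL_mult conv_pure S_simps smult_mult_left smult_mult_right)
next
  case (add s t)
  then show ?case using assms by (simp add: T.AB.T.r_distr convL_simps smult_add_right)
qed

lemma convR_scalar:
  assumes "u \<in> carrier AA" "v \<in> carrier AA" "convR u = e \<odot> \<one>"
  shows "convR (v \<otimes>\<^bsub>AA\<^esub> u) = e \<odot> convR v"
  using assms(2)
proof (induction v rule: T.AB.tensor_induct)
  case (pure c d)
  then show ?case
    using assms by (simp add: convR_mult conv_pure S_simps smult_mult_left smult_mult_right)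
next
  case (add s t)
  then show ?case using assms by (simp add: T.AB.T.l_distr convR_simps smult_add_right)
qed

lemmas comult_simps = algebra_homsD[OF comult]

lemma antipode_axiom:
  assumes "x \<in> carrier A"
  shows "convL (\<Delta> x) = \<epsilon> x \<odot> \<one>" "convR (\<Delta> x) = \<epsilon> x \<odot> \<one>"
proof -
  note [simp] = alg_span_closed[OF gens]
  have "x \<in> alg_span A gens" using assms span by blast
  then have "convL (\<Delta> x) = \<epsilon> x \<odot> \<one> \<and> convR (\<Delta> x) = \<epsilon> x \<odot> \<one>"
  proof (induction rule: alg_span.induct)
    case (base y)
    then obtain i j where ij: "i \<in> I" "j \<in> I" "y = a i j" by blast
    have "convL (\<Delta> y) = (\<Oplus>k\<in>I. S (a i k) \<otimes> a k j)"
      unfolding ij(3) comult_entry[OF ij(1,2)] using ij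
      by (intro linear_maps_finsum_eq[OF conv_linear(1) T.AB.tensor_complex_algebra complex_algebra_axioms])
        (simp_all add: entry conv_pure S_simps)
    moreover have "convR (\<Delta> y) = (\<Oplus>k\<in>I. a i k \<otimes> S (a k j))"
      unfolding ij(3) comult_entry[OF ij(1,2)] using ij
      by (intro linear_maps_finsum_eq[OF conv_linear(2) T.AB.tensor_complex_algebra complex_algebra_axioms])
        (simp_all add: entry conv_pure S_simps)
    ultimately show ?case
      using ij by (simp add: antipode_left_entry antipode_right_entry counit_entry)
  next
    case one
    then show ?case by (simp add: comult_simps T.AB.pure_one conv_pure S_simps counit_simps)
  next
    case (add x y)
    then show ?case
      by (simp add: comult_simps convL_simps convR_simps counit_simps smult_add_left)
  next
    case (smult x c)
    then show ?case
      by (simp add: comult_simps convL_simps convR_simps counit_simps smult_smult)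
  next
    case (mult x y)
    \<comment> \<open>In \<open>convL\<close> the left factor \<open>\<Delta> x\<close> collapses to
      a scalar, in \<open>convR\<close> the right factor \<open>\<Delta> y\<close>.\<close>
    then show ?case
      by (simp add: comult_simps convL_scalar[of "\<Delta> x" "\<Delta> y" "\<epsilon> x"] convR_scalar[of "\<Delta> y" "\<Delta> x" "\<epsilon> y"]
          counit_simps smult_smult mult.commute)
  qed
  then show "convL (\<Delta> x) = \<epsilon> x \<odot> \<one>" "convR (\<Delta> x) = \<epsilon> x \<odot> \<one>" by auto
qed

theorem hopf_algebra: "hopf_algebra A \<Delta> \<epsilon> S"
  by unfold_locales
    (simp_all add: comult counit S_linear coassociative counit_axiom antipode_axiom)

end

section \<open>Quantum determinants\<close>

text \<open>
  On permutations, \<open>qeps (\<eta> \<theta>)\<close> is the coefficient \<open>(-1)\<^bsup>|\<sigma>|\<^esup> \<epsilon>\<^bsup>\<sigma>(1)\<dots>\<sigma>(4)\<^esup>\<close> of the determinant. Writing it as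
  a product over pairs of positions makes the effect of exchanging neighbours evident.
\<close>

definition pair_sign :: "(nat \<Rightarrow> nat \<Rightarrow> complex) \<Rightarrow> nat \<Rightarrow> nat \<Rightarrow> complex"
  where "pair_sign h a b = (if a < b then 1 else if a = b then 0 else - h b a)"

primrec qeps :: "(nat \<Rightarrow> nat \<Rightarrow> complex) \<Rightarrow> nat list \<Rightarrow> complex"
  where "qeps h [] = 1"
  | "qeps h (x # xs) = (\<Prod>y\<leftarrow>xs. pair_sign h x y) * qeps h xs"

definition words :: "nat \<Rightarrow> nat \<Rightarrow> nat list set"
  where "words n m = {js. set js \<subseteq> {1..n} \<and> length js = m}"

definition word :: "('a, 'm) monoid_scheme \<Rightarrow> (nat \<Rightarrow> nat \<Rightarrow> 'a) \<Rightarrow> nat list \<Rightarrow> nat list \<Rightarrow> 'a"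
  where "word A M is js = foldr (\<lambda>x y. x \<otimes>\<^bsub>A\<^esub> y) (map2 M is js) \<one>\<^bsub>A\<^esub>"

text \<open>The sum \<open>F(i)\<close>, for a row word of any length. Column words with repetitions
  are included but carry the coefficient \<open>0\<close>; letting the columns range over all words
  keeps the index set stable under exchanges and easy to split.\<close>

definition qminor :: "(complex, 'a, 'm) module_scheme \<Rightarrow> nat \<Rightarrow> (nat \<Rightarrow> nat \<Rightarrow> complex) \<Rightarrow>
    (nat \<Rightarrow> nat \<Rightarrow> 'a) \<Rightarrow> nat list \<Rightarrow> 'a"
  where "qminor A n h M is = (\<Oplus>\<^bsub>A\<^esub>js\<in>words n (length is). qeps h js \<odot>\<^bsub>A\<^esub> word A M is js)"

abbreviation qdet where "qdet A n h M \<equiv> qminor A n h M [1..<Suc n]"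

text \<open>Any rearrangement is a sequence of exchanges of neighbours: each letter of
  \<open>ys\<close> in turn is carried to the front of what remains of \<open>xs\<close>. Stated for
  a property of lists, it applies directly to identities that are stable under such
  exchanges.\<close>

lemma mset_swap_closed:
  assumes swap: "\<And>us x y vs. P (us @ x # y # vs) \<Longrightarrow> P (us @ y # x # vs)"
    and "mset xs = mset ys" "P xs"
  shows "P ys"
proof -
  have front: "P (us @ as @ y # bs) \<Longrightarrow> P (us @ y # as @ bs)" for us as y bs
  proof (induction as arbitrary: bs rule: rev_induct)
    case (snoc a as)
    from snoc(2) have "P (us @ as @ y # a # bs)"
      using swap[of "us @ as" a y bs] by simp
    then show ?case using snoc(1) by simp
  qed simp
  \<comment> \<open>The prefix \<open>us\<close> holds the letters already in place, and has to vary
    in the induction.\<close>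
  have "P (us @ ys)" if "mset xs = mset ys" "P (us @ xs)" for us
    using that
  proof (induction ys arbitrary: us xs)
    case (Cons y ys)
    then have "y \<in> set xs" by (metis list.set_intros(1) mset_eq_setD)
    then obtain as bs where xs: "xs = as @ y # bs" by (meson split_list)
    have "P (us @ y # as @ bs)" using Cons(3) front unfolding xs by blast
    moreover have "mset (as @ bs) = mset ys" using Cons(2) unfolding xs by simp
    ultimately show ?case using Cons(1)[of "as @ bs" "us @ [y]"] by simp
  qed simp
  from this[of "[]"] show ?thesis using assms by simp
qed

lemma finite_words [simp]: "finite (words n m)"
proof -
  have "words n m = {js. set js \<subseteq> {1..n} \<and> length js = m}" by (simp add: words_def)
  then show ?thesis using finite_lists_length_eq[of "{1..n}" m] by simp
qed

lemma words_0 [simp]: "words n 0 = {[]}"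
  by (auto simp: words_def)

lemma Cons_in_words [simp]: "k # js \<in> words n (Suc m) \<longleftrightarrow> k \<in> {1..n} \<and> js \<in> words n m"
  by (auto simp: words_def)

lemma wordsD: "js \<in> words n m \<Longrightarrow> length js = m" "js \<in> words n m \<Longrightarrow> set js \<subseteq> {1..n}"
  by (auto simp: words_def)

lemma words_Suc: "words n (Suc m) = (\<Union>k\<in>{1..n}. (#) k ` words n m)"
proof -
  have "js \<in> (\<Union>k\<in>{1..n}. (#) k ` words n m)" if "js \<in> words n (Suc m)" for js
    using that by (cases js) (auto simp: words_def)
  then show ?thesis by auto
qed

lemma words_Suc_snoc: "words n (Suc m) = (\<Union>k\<in>{1..n}. (\<lambda>js. js @ [k]) ` words n m)"
proof -
  have "js \<in> (\<Union>k\<in>{1..n}. (\<lambda>js. js @ [k]) ` words n m)" if "js \<in> words n (Suc m)" for js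
    using that by (cases js rule: rev_cases) (auto simp: words_def)
  then show ?thesis by (auto simp: words_def)
qed

lemma upt_in_words: "[1..<Suc n] \<in> words n n"
  by (auto simp: words_def)

lemma word_Nil [simp]: "word A M [] [] = \<one>\<^bsub>A\<^esub>"
  and word_Cons [simp]: "word A M (i # is) (j # js) = M i j \<otimes>\<^bsub>A\<^esub> word A M is js"
  by (simp_all add: word_def)

lemma word_transpose: "word A (\<lambda>i j. M j i) js is = word A M is js"
  if "length is = length js"
  using that by (induction "is" js rule: list_induct2) simp_all

subsection \<open>The quantum Levi-Civita symbol\<close>

text \<open>The exchange affects the factor of this one pair only; all other pairs keep their
  relative order. If the two letters coincide, both sides are zero.\<close>

lemma qeps_swap:
  assumes "h j l * h l j = 1"
  shows "qeps h (us @ l # j # vs) = - h j l * qeps h (us @ j # l # vs)"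
proof (induction us)
  case Nil
  have "pair_sign h l j = - h j l * pair_sign h j l"
    using assms by (auto simp: pair_sign_def)
  then show ?case by (simp add: mult_ac)
qed (simp add: mult_ac)

lemma qeps_not_distinct:
  assumes "\<not> distinct xs"
  shows "qeps h xs = 0"
  using assms
proof (induction xs)
  case (Cons x xs)
  show ?case
  proof (cases "x \<in> set xs")
    case True
    then have "0 \<in> set (map (pair_sign h x) xs)" by (force simp: pair_sign_def)
    then have "(\<Prod>y\<leftarrow>xs. pair_sign h x y) = 0" by (simp only: prod_list_zero_iff)
    then show ?thesis by simp
  qed (use Cons in simp)
qed simp

lemma prod_list_inverse:
  fixes f g :: "'b \<Rightarrow> complex"
  assumes "\<And>y. y \<in> set ys \<Longrightarrow> f y * g y = 1"
  shows "(\<Prod>y\<leftarrow>ys. f y) * (\<Prod>y\<leftarrow>ys. g y) = 1"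
  using assms
proof (induction ys)
  case (Cons y ys)
  have "(\<Prod>y\<leftarrow>y # ys. f y) * (\<Prod>y\<leftarrow>y # ys. g y) = (f y * g y) * ((\<Prod>y\<leftarrow>ys. f y) * (\<Prod>y\<leftarrow>ys. g y))"
    by (simp add: mult_ac)
  then show ?case using Cons by simp
qed simp

text \<open>A pair in increasing order contributes \<open>1\<close> to both symbols, an inverted
  pair contributes \<open>- h\<close> with its two indices in opposite orders. So on words without
  repetition the transposed phases produce the reciprocal symbol, the \<open>E(i)\<close> to the
  power \<open>-1\<close> of the transposition argument.\<close>

lemma qeps_transpose:
  assumes "distinct xs" "\<And>i j. i \<in> set xs \<Longrightarrow> j \<in> set xs \<Longrightarrow> h i j * h j i = 1"
  shows "qeps (\<lambda>i j. h j i) xs * qeps h xs = 1"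
  using assms
proof (induction xs)
  case (Cons x xs)
  have "pair_sign (\<lambda>i j. h j i) x y * pair_sign h x y = 1" if "y \<in> set xs" for y
    using that Cons.prems(1) Cons.prems(2)[of x y] by (auto simp: pair_sign_def mult.commute)
  then have "(\<Prod>y\<leftarrow>xs. pair_sign (\<lambda>i j. h j i) x y) * (\<Prod>y\<leftarrow>xs. pair_sign h x y) = 1"
    by (rule prod_list_inverse)
  moreover have "qeps (\<lambda>i j. h j i) (x # xs) * qeps h (x # xs) =
      ((\<Prod>y\<leftarrow>xs. pair_sign (\<lambda>i j. h j i) x y) * (\<Prod>y\<leftarrow>xs. pair_sign h x y)) *
      (qeps (\<lambda>i j. h j i) xs * qeps h xs)"
    by (simp only: qeps.simps mult_ac)
  moreover have "qeps (\<lambda>i j. h j i) xs * qeps h xs = 1"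
    using Cons by simp
  ultimately show ?case by (simp only: mult_1)
qed simp

lemma qeps_nonzero:
  assumes "distinct xs" "\<And>i j. i \<in> set xs \<Longrightarrow> j \<in> set xs \<Longrightarrow> h i j * h j i = 1"
  shows "qeps h xs \<noteq> 0"
  using qeps_transpose[of xs h] assms by auto

lemma qeps_sorted: "sorted_wrt (<) xs \<Longrightarrow> qeps h xs = 1"
proof (induction xs)
  case (Cons x xs)
  then have "map (pair_sign h x) xs = map (\<lambda>_. 1) xs"
    by (intro map_cong) (auto simp: pair_sign_def)
  then show ?case using Cons by (simp add: map_replicate_const)
qed simp

lemma qeps_upt [simp]: "qeps h [a..<b] = 1"
  by (rule qeps_sorted) simp

subsection \<open>Sums over words\<close>

context complex_algebra
begin

lemma word_closed:
  assumes "\<And>i j. i \<in> {1..n} \<Longrightarrow> j \<in> {1..n} \<Longrightarrow> M i j \<in> carrier A"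
    and "is \<in> words n m" "js \<in> words n m"
  shows "word A M is js \<in> carrier A"
proof -
  have "length is = length js" using assms by (simp add: words_def)
  moreover have "set is \<subseteq> {1..n}" "set js \<subseteq> {1..n}" using assms by (auto simp: words_def)
  ultimately show ?thesis
    by (induction "is" js rule: list_induct2) (auto intro!: assms(1))
qed

lemma word_append:
  assumes "\<And>i j. i \<in> {1..n} \<Longrightarrow> j \<in> {1..n} \<Longrightarrow> M i j \<in> carrier A"
    and "is \<in> words n m" "js \<in> words n m" "ks \<in> words n p" "ls \<in> words n p"
  shows "word A M (is @ ks) (js @ ls) = word A M is js \<otimes> word A M ks ls"
proof -
  have "length is = length js" using assms by (simp add: words_def)
  moreover have "set is \<subseteq> {1..n}" "set js \<subseteq> {1..n}" using assms by (auto simp: words_def)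
  ultimately show ?thesis
  proof (induction "is" js rule: list_induct2)
    case Nil
    then show ?case using word_closed[OF assms(1,4,5)] by simp
  next
    case (Cons i "is" j js)
    have "word A M is js \<in> carrier A"
      using Cons by (intro word_closed[OF assms(1), where m = "length is"]) (auto simp: words_def)
    then show ?case using Cons word_closed[OF assms(1,4,5)] assms(1)[of i j] by (simp add: m_assoc)
  qed
qed

lemma finsum_words_Suc:
  assumes "\<And>js. js \<in> words n (Suc m) \<Longrightarrow> f js \<in> carrier A"
  shows "(\<Oplus>js\<in>words n (Suc m). f js) = (\<Oplus>k\<in>{1..n}. \<Oplus>js\<in>words n m. f (k # js))"
proof -
  have "(\<Oplus>js\<in>words n (Suc m). f js) = (\<Oplus>k\<in>{1..n}. \<Oplus>js\<in>(#) k ` words n m. f js)"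
    unfolding words_Suc
    by (rule add.finprod_UN_disjoint) (use assms in \<open>auto simp: pairwise_def disjnt_def\<close>)
  also have "\<dots> = (\<Oplus>k\<in>{1..n}. \<Oplus>js\<in>words n m. f (k # js))"
  proof (rule finsum_eqI)
    fix k assume "k \<in> {1..n}"
    then show "(\<Oplus>js\<in>words n m. f (k # js)) \<in> carrier A"
      by (intro finsum_closed) (auto intro!: assms)
    show "(\<Oplus>js\<in>(#) k ` words n m. f js) = (\<Oplus>js\<in>words n m. f (k # js))"
      using \<open>k \<in> {1..n}\<close> by (intro finsum_reindex) (auto intro!: assms simp: inj_on_def)
  qed
  finally show ?thesis .
qed

text \<open>The variant for the left inverse, where the matrix entry must follow the minor; the
  right inverse splits off the leading letter by \<open>finsum_words_Suc\<close>.\<close>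

lemma finsum_words_Suc_snoc:
  assumes "\<And>js. js \<in> words n (Suc m) \<Longrightarrow> f js \<in> carrier A"
  shows "(\<Oplus>js\<in>words n (Suc m). f js) = (\<Oplus>k\<in>{1..n}. \<Oplus>js\<in>words n m. f (js @ [k]))"
proof -
  have snoc: "js @ [k] \<in> words n (Suc m)" if "k \<in> {1..n}" "js \<in> words n m" for k js
    using that by (auto simp: words_def)
  have "(\<Oplus>js\<in>words n (Suc m). f js) = (\<Oplus>k\<in>{1..n}. \<Oplus>js\<in>(\<lambda>js. js @ [k]) ` words n m. f js)"
    unfolding words_Suc_snoc
    by (rule add.finprod_UN_disjoint) (use assms snoc in \<open>auto simp: pairwise_def disjnt_def\<close>)
  also have "\<dots> = (\<Oplus>k\<in>{1..n}. \<Oplus>js\<in>words n m. f (js @ [k]))"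
  proof (rule finsum_eqI)
    fix k assume k: "k \<in> {1..n}"
    then show "(\<Oplus>js\<in>words n m. f (js @ [k])) \<in> carrier A"
      by (intro finsum_closed) (auto intro!: assms snoc)
    show "(\<Oplus>js\<in>(\<lambda>js. js @ [k]) ` words n m. f js) = (\<Oplus>js\<in>words n m. f (js @ [k]))"
      using k by (intro finsum_reindex) (auto intro!: assms snoc simp: inj_on_def)
  qed
  finally show ?thesis .
qed

text \<open>Over the complex numbers \<open>2\<close> can be divided out. This is what makes a minor
  with a repeated row vanish.\<close>

lemma self_neg_zero:
  assumes "x \<in> carrier A" "x = (-1) \<odot> x"
  shows "x = \<zero>"
proof -
  have "2 \<odot> x = 1 \<odot> x \<oplus> 1 \<odot> x" using smult_add_left[of x 1 1] assms(1) by simp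
  also have "\<dots> = x \<oplus> (-1) \<odot> x" using assms one_smult by metis
  also have "\<dots> = \<zero>" by (simp only: smult_minus_one[OF assms(1)] M.r_neg[OF assms(1)])
  finally show ?thesis using smult_cancel[of 2 x \<zero>] assms(1) by simp
qed

end

subsection \<open>Quantum matrices\<close>

text \<open>The condition \<open>phase\<close> makes the coefficient \<open>1\<close> when
  \<open>rel\<close> is applied twice. Note that the row indices enter \<open>h\<close> in the order
  \<open>k i\<close> and the column indices in the order \<open>j l\<close>; transposition therefore
  reverses the phases.\<close>

locale quantum_matrix = complex_algebra A for A (structure) +
  fixes n :: nat and h :: "nat \<Rightarrow> nat \<Rightarrow> complex" and M :: "nat \<Rightarrow> nat \<Rightarrow> 'a"
  assumes phase: "\<And>i j. i \<in> {1..n} \<Longrightarrow> j \<in> {1..n} \<Longrightarrow> h i j * h j i = 1"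
    and phase_diag: "\<And>i. i \<in> {1..n} \<Longrightarrow> h i i = 1"
    and entry: "\<And>i j. i \<in> {1..n} \<Longrightarrow> j \<in> {1..n} \<Longrightarrow> M i j \<in> carrier A"
    and rel: "\<And>i j k l. i \<in> {1..n} \<Longrightarrow> j \<in> {1..n} \<Longrightarrow> k \<in> {1..n} \<Longrightarrow> l \<in> {1..n} \<Longrightarrow>
      M i j \<otimes> M k l = (h k i * h j l) \<odot> (M k l \<otimes> M i j)"
begin

lemma word_in: "is \<in> words n m \<Longrightarrow> js \<in> words n m \<Longrightarrow> word A M is js \<in> carrier A"
  by (rule word_closed) (rule entry)

lemma word_app:
  assumes "is \<in> words n m" "js \<in> words n m" "ks \<in> words n p" "ls \<in> words n p"
  shows "word A M (is @ ks) (js @ ls) = word A M is js \<otimes> word A M ks ls"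
  by (rule word_append[OF _ assms]) (rule entry)

lemma qminor_closed: "is \<in> words n m \<Longrightarrow> qminor A n h M is \<in> carrier A"
  unfolding qminor_def using wordsD(1) by (intro finsum_closed) (auto intro!: smult_in word_in)

text \<open>Commuting the two neighbouring entries costs a row phase \<open>h k i\<close> and a
  column phase \<open>h j l\<close>. The column phase is absorbed when the columns are exchanged as
  well, leaving a sign and the row phase, which is the same for all summands.\<close>

lemma qminor_swap:
  assumes w: "us @ i # k # vs \<in> words n m"
  shows "qminor A n h M (us @ i # k # vs) = (- h k i) \<odot> qminor A n h M (us @ k # i # vs)"
proof -
  define p where "p = length us"
  \<comment> \<open>Exchange of the column letters in positions \<open>p\<close> and
    \<open>p + 1\<close>: an involution of the words, used to reindex the sum.\<close>
  define s where "s js = js[p := js ! Suc p, Suc p := js ! p]" for js :: "nat list"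
  have m: "m = length us + (2 + length vs)" using w by (simp add: words_def)
  have ik: "i \<in> {1..n}" "k \<in> {1..n}" and us: "us \<in> words n p" and vs: "vs \<in> words n (length vs)"
    using w by (auto simp: words_def p_def)
  have decomp: "\<exists>us' j l vs'. js = us' @ j # l # vs' \<and> us' \<in> words n p \<and> vs' \<in> words n (length vs)
      \<and> j \<in> {1..n} \<and> l \<in> {1..n}" if "js \<in> words n m" for js
  proof -
    have len: "length js = p + (2 + length vs)" using that m by (simp add: words_def p_def)
    then obtain j l vs' where d: "drop p js = j # l # vs'"
      by (cases "drop p js"; cases "tl (drop p js)") (auto dest!: arg_cong[where f = length])
    have js: "js = take p js @ j # l # vs'" using d by (metis append_take_drop_id)
    have "length vs' = length vs" using arg_cong[OF d, of length] len by simp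
    moreover have "set (take p js @ j # l # vs') \<subseteq> {1..n}"
      using that unfolding words_def js[symmetric] by simp
    moreover have "length (take p js) = p" using len by simp
    ultimately have "take p js \<in> words n p \<and> vs' \<in> words n (length vs) \<and> j \<in> {1..n} \<and> l \<in> {1..n}"
      by (simp add: words_def)
    then show ?thesis using js by blast
  qed
  have s: "s (us' @ j # l # vs') = us' @ l # j # vs'" if "us' \<in> words n p" for us' j l vs'
    using wordsD(1)[OF that] by (auto simp: s_def list_update_append nth_append)
  have s_words: "s js \<in> words n m" if "js \<in> words n m" for js
    using that decomp[OF that] s by (auto simp: words_def)
  have s_s: "s (s js) = js" if "js \<in> words n m" for js
    using decomp[OF that] s by auto
  have bij: "s ` words n m = words n m" "inj_on s (words n m)"
    using s_words s_s by (auto intro: inj_on_inverseI simp: image_iff) (metis s_s s_words)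
  have w': "us @ k # i # vs \<in> words n m" using w by (auto simp: words_def)
  have term_eq: "qeps h js \<odot> word A M (us @ i # k # vs) js =
      (- h k i) \<odot> (qeps h (s js) \<odot> word A M (us @ k # i # vs) (s js))" if js: "js \<in> words n m" for js
  proof -
    obtain us' j l vs' where d: "js = us' @ j # l # vs'" "us' \<in> words n p" "vs' \<in> words n (length vs)"
      "j \<in> {1..n}" "l \<in> {1..n}"
      using decomp[OF js] by blast
    have c: "word A M us us' \<in> carrier A" "word A M vs vs' \<in> carrier A"
      "M i j \<in> carrier A" "M k l \<in> carrier A"
      using word_in[OF us d(2)] word_in[OF vs d(3)] entry d(4,5) ik by simp_all
    have two: "x # y # zs \<in> words n (2 + length vs)" if "zs \<in> words n (length vs)" "x \<in> {1..n}" "y \<in> {1..n}"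
      for x y zs using that by (auto simp: words_def)
    have "word A M (us @ i # k # vs) js = word A M us us' \<otimes> (M i j \<otimes> (M k l \<otimes> word A M vs vs'))"
      unfolding d(1) using word_app[OF us d(2) two[OF vs ik] two[OF d(3-5)]] by simp
    also have "M i j \<otimes> (M k l \<otimes> word A M vs vs') = (M i j \<otimes> M k l) \<otimes> word A M vs vs'"
      using c by (simp add: m_assoc)
    also have "\<dots> = (h k i * h j l) \<odot> (M k l \<otimes> (M i j \<otimes> word A M vs vs'))"
      using c rel[of i j k l] ik d by (simp add: smult_mult_left m_assoc)
    also have "word A M us us' \<otimes> \<dots> = (h k i * h j l) \<odot> word A M (us @ k # i # vs) (s js)"
      unfolding d(1) s[OF d(2)]
      using c word_app[OF us d(2) two[OF vs ik(2,1)] two[OF d(3,5,4)]]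
      by (simp add: smult_mult_right)
    finally have "qeps h js \<odot> word A M (us @ i # k # vs) js =
        (qeps h js * (h k i * h j l)) \<odot> word A M (us @ k # i # vs) (s js)"
      using word_in[OF w' s_words[OF js]] by (simp add: smult_smult)
    \<comment> \<open>Here \<open>h j l\<close> disappears: by \<open>qeps_swap\<close> the symbol
      of \<open>js\<close> is \<open>- h l j\<close> times that of \<open>s js\<close>, and
      \<open>h l j * h j l = 1\<close>.\<close>
    also have "qeps h js * (h k i * h j l) = - h k i * qeps h (s js)"
      unfolding d(1) s[OF d(2)] using qeps_swap[of h l j us' vs'] phase[of l j] d by simp
    finally show ?thesis using word_in[OF w' s_words[OF js]] by (simp add: smult_smult)
  qed
  have "qminor A n h M (us @ i # k # vs) =
      (\<Oplus>js\<in>words n m. (- h k i) \<odot> (qeps h (s js) \<odot> word A M (us @ k # i # vs) (s js)))"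
    unfolding qminor_def wordsD(1)[OF w]
    by (rule finsum_eqI) (use term_eq word_in[OF w' s_words] in auto)
  also have "\<dots> = (- h k i) \<odot> (\<Oplus>js\<in>words n m. qeps h (s js) \<odot> word A M (us @ k # i # vs) (s js))"
    using word_in[OF w' s_words] by (intro finsum_smult[symmetric]) auto
  also have "(\<Oplus>js\<in>words n m. qeps h (s js) \<odot> word A M (us @ k # i # vs) (s js)) =
      (\<Oplus>js\<in>s ` words n m. qeps h js \<odot> word A M (us @ k # i # vs) js)"
    using bij word_in[OF w'] by (intro finsum_reindex[symmetric]) auto
  finally show ?thesis
    unfolding qminor_def wordsD(1)[OF w'] bij(1) .
qed

text \<open>Both sides change by the same factor under an exchange of neighbours, so the identity
  holds for a word as soon as it holds for one of its rearrangements. Words without repetition are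
  rearrangements of \<open>[1..<Suc n]\<close>, where it is trivial.\<close>

theorem qminor_eq:
  assumes "is \<in> words n n"
  shows "qminor A n h M is = qeps h is \<odot> qdet A n h M"
proof -
  let ?D = "qdet A n h M"
  have D: "?D \<in> carrier A" using qminor_closed upt_in_words by blast
  define P where "P is \<longleftrightarrow> is \<in> words n n \<and> qminor A n h M is = qeps h is \<odot> ?D" for "is"
  have swap: "P (us @ y # x # vs)" if "P (us @ x # y # vs)" for us x y vs
  proof -
    have w: "us @ y # x # vs \<in> words n n" and xy: "x \<in> {1..n}" "y \<in> {1..n}"
      using that by (auto simp: P_def words_def)
    have "qminor A n h M (us @ y # x # vs) = (- h x y) \<odot> (qeps h (us @ x # y # vs) \<odot> ?D)"
      using qminor_swap[OF w] that by (simp add: P_def)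
    then show ?thesis
      using w D qeps_swap[of h x y us vs] phase[OF xy] by (simp add: P_def smult_smult)
  qed
  have "P is"
  proof (cases "distinct is")
    case True
    have "set is = {1..n}"
      using assms True by (intro card_subset_eq) (auto simp: words_def distinct_card)
    moreover have "set [1..<Suc n] = {1..n}" by auto
    ultimately have "mset [1..<Suc n] = mset is"
      using True by (intro set_eq_iff_mset_eq_distinct[THEN iffD1]) (simp_all only: distinct_upt)
    moreover have "P [1..<Suc n]" unfolding P_def
      by (intro conjI upt_in_words) (simp only: qeps_upt one_smult[OF D])
    ultimately show ?thesis using mset_swap_closed[where P = P, OF swap] by metis
  next
    case False
    then obtain as bs cs y where "is": "is = as @ [y] @ bs @ [y] @ cs"
      using not_distinct_decomp by blast
    define zs where "zs = as @ bs @ cs"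
    have w: "[] @ y # y # zs \<in> words n n" and y: "y \<in> {1..n}"
      using assms unfolding "is" zs_def words_def by auto
    \<comment> \<open>With the repeated letter moved to the two front positions, the exchange leaves
      the word as it is, and \<open>h y y = 1\<close> turns the factor into
      \<open>-1\<close>.\<close>
    have "qminor A n h M (y # y # zs) = (-1) \<odot> qminor A n h M (y # y # zs)"
      using qminor_swap[OF w] phase_diag[OF y] by simp
    then have "qminor A n h M (y # y # zs) = \<zero>"
      using self_neg_zero qminor_closed[OF w] by simp
    then have "P (y # y # zs)"
      using w D by (simp add: P_def pair_sign_def)
    moreover have "mset (y # y # zs) = mset is" by (simp add: "is" zs_def)
    ultimately show ?thesis using mset_swap_closed[where P = P, OF swap] by metis
  qed
  then show ?thesis by (simp add: P_def)
qed

end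

subsection \<open>Inverse matrices\<close>

definition rest :: "nat \<Rightarrow> nat \<Rightarrow> nat list"
  where "rest n i = filter (\<lambda>k. k \<noteq> i) [1..<Suc n]"

lemma rest_in_words: "i \<in> {1..n} \<Longrightarrow> rest n i \<in> words n (n - 1)"
  and distinct_rest: "distinct (rest n i)"
  and set_rest: "set (rest n i) = {1..n} - {i}"
proof -
  show d: "distinct (rest n i)" unfolding rest_def by (intro distinct_filter distinct_upt)
  show s: "set (rest n i) = {1..n} - {i}" unfolding rest_def by auto
  show "rest n i \<in> words n (n - 1)" if "i \<in> {1..n}"
  proof -
    have "length (rest n i) = n - 1" using distinct_card[OF d] that unfolding s by simp
    then show ?thesis by (auto simp: words_def s)
  qed
qed

context complex_algebra
begin

lemma matrix_assoc:
  assumes "finite I" "i \<in> I" "j \<in> I"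
    and "\<And>i j. i \<in> I \<Longrightarrow> j \<in> I \<Longrightarrow> P i j \<in> carrier A"
    and "\<And>i j. i \<in> I \<Longrightarrow> j \<in> I \<Longrightarrow> Q i j \<in> carrier A"
    and "\<And>i j. i \<in> I \<Longrightarrow> j \<in> I \<Longrightarrow> R i j \<in> carrier A"
  shows "(\<Oplus>k\<in>I. P i k \<otimes> (\<Oplus>l\<in>I. Q k l \<otimes> R l j)) = (\<Oplus>l\<in>I. (\<Oplus>k\<in>I. P i k \<otimes> Q k l) \<otimes> R l j)"
proof -
  have "(\<Oplus>k\<in>I. P i k \<otimes> (\<Oplus>l\<in>I. Q k l \<otimes> R l j)) = (\<Oplus>k\<in>I. \<Oplus>l\<in>I. P i k \<otimes> Q k l \<otimes> R l j)"
    using assms by (intro finsum_eqI) (auto simp: finsum_mult_left m_assoc intro!: finsum_closed finsum_eqI)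
  also have "\<dots> = (\<Oplus>l\<in>I. \<Oplus>k\<in>I. P i k \<otimes> Q k l \<otimes> R l j)"
    using assms by (intro finsum_swap) auto
  also have "\<dots> = (\<Oplus>l\<in>I. (\<Oplus>k\<in>I. P i k \<otimes> Q k l) \<otimes> R l j)"
    using assms by (intro finsum_eqI) (auto simp: finsum_mult_right intro!: finsum_closed)
  finally show ?thesis .
qed

lemma finsum_delta_left:
  assumes "finite I" "i \<in> I" "\<And>k. k \<in> I \<Longrightarrow> f k \<in> carrier A"
  shows "(\<Oplus>k\<in>I. (if i = k then \<one> else \<zero>) \<otimes> f k) = f i"
proof -
  have "(\<Oplus>k\<in>I. (if i = k then \<one> else \<zero>) \<otimes> f k) = (\<Oplus>k\<in>I. if k = i then f k else \<zero>)"
    using assms by (intro finsum_eqI) auto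
  then show ?thesis using assms by (simp add: finsum_delta)
qed

lemma finsum_delta_right:
  assumes "finite I" "i \<in> I" "\<And>k. k \<in> I \<Longrightarrow> f k \<in> carrier A"
  shows "(\<Oplus>k\<in>I. f k \<otimes> (if k = i then \<one> else \<zero>)) = f i"
proof -
  have "(\<Oplus>k\<in>I. f k \<otimes> (if k = i then \<one> else \<zero>)) = (\<Oplus>k\<in>I. if k = i then f k else \<zero>)"
    using assms by (intro finsum_eqI) auto
  then show ?thesis using assms by (simp add: finsum_delta)
qed

text \<open>The usual computation \<open>C = C (M B) = (C M) B = B\<close>, which is valid over any
  ring.\<close>

lemma left_right_inverse_eq:
  assumes "finite I" "i \<in> I" "j \<in> I"
    and C: "\<And>i j. i \<in> I \<Longrightarrow> j \<in> I \<Longrightarrow> C i j \<in> carrier A"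
    and M: "\<And>i j. i \<in> I \<Longrightarrow> j \<in> I \<Longrightarrow> M i j \<in> carrier A"
    and B: "\<And>i j. i \<in> I \<Longrightarrow> j \<in> I \<Longrightarrow> B i j \<in> carrier A"
    and CM: "\<And>i j. i \<in> I \<Longrightarrow> j \<in> I \<Longrightarrow> (\<Oplus>k\<in>I. C i k \<otimes> M k j) = (if i = j then \<one> else \<zero>)"
    and MB: "\<And>i j. i \<in> I \<Longrightarrow> j \<in> I \<Longrightarrow> (\<Oplus>k\<in>I. M i k \<otimes> B k j) = (if i = j then \<one> else \<zero>)"
  shows "C i j = B i j"
proof -
  have "C i j = (\<Oplus>k\<in>I. C i k \<otimes> (if k = j then \<one> else \<zero>))"
    using assms by (simp add: finsum_delta_right)
  also have "\<dots> = (\<Oplus>k\<in>I. C i k \<otimes> (\<Oplus>l\<in>I. M k l \<otimes> B l j))"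
    using assms by (intro finsum_eqI) (auto intro!: finsum_closed)
  also have "\<dots> = (\<Oplus>l\<in>I. (\<Oplus>k\<in>I. C i k \<otimes> M k l) \<otimes> B l j)"
    by (rule matrix_assoc) (use assms in auto)
  also have "\<dots> = (\<Oplus>l\<in>I. (if i = l then \<one> else \<zero>) \<otimes> B l j)"
    using assms by (intro finsum_eqI) auto
  also have "\<dots> = B i j"
    using assms by (simp add: finsum_delta_left)
  finally show ?thesis .
qed

text \<open>Applied twice, this shows that the entries of the inverse matrix satisfy the opposite relations.\<close>

lemma inverse_commute:
  assumes fin: "finite I" and mn: "m \<in> I" "m' \<in> I"
    and y: "y \<in> carrier A"
    and M: "\<And>i j. i \<in> I \<Longrightarrow> j \<in> I \<Longrightarrow> M i j \<in> carrier A"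
    and B: "\<And>i j. i \<in> I \<Longrightarrow> j \<in> I \<Longrightarrow> B i j \<in> carrier A"
    and BM: "\<And>i j. i \<in> I \<Longrightarrow> j \<in> I \<Longrightarrow> (\<Oplus>k\<in>I. B i k \<otimes> M k j) = (if i = j then \<one> else \<zero>)"
    and MB: "\<And>i j. i \<in> I \<Longrightarrow> j \<in> I \<Longrightarrow> (\<Oplus>k\<in>I. M i k \<otimes> B k j) = (if i = j then \<one> else \<zero>)"
    and rel: "\<And>k l. k \<in> I \<Longrightarrow> l \<in> I \<Longrightarrow> p k \<odot> (y \<otimes> M k l) = q l \<odot> (M k l \<otimes> y)"
  shows "p m' \<odot> (B m m' \<otimes> y) = q m \<odot> (y \<otimes> B m m')"
proof -
  note closed = y M B
  \<comment> \<open>The identity matrix inserted on the right becomes \<open>M\<close> times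
    \<open>B\<close>. The scalar \<open>p k\<close> is attached to the summation index so that it
    can meet \<open>y \<otimes> M k l\<close>, where \<open>rel\<close> trades it for
    \<open>q l\<close> and brings \<open>M k l\<close> next to \<open>B m k\<close>; the inner sum
    is then the identity matrix.\<close>
  have "p m' \<odot> (B m m' \<otimes> y) = (\<Oplus>k\<in>I. (p k \<odot> (B m k \<otimes> y)) \<otimes> (if k = m' then \<one> else \<zero>))"
    using fin mn closed by (simp add: finsum_delta_right)
  also have "\<dots> = (\<Oplus>k\<in>I. (p k \<odot> (B m k \<otimes> y)) \<otimes> (\<Oplus>l\<in>I. M k l \<otimes> B l m'))"
    using mn closed MB by (intro finsum_eqI) (auto intro!: finsum_closed)
  also have "\<dots> = (\<Oplus>l\<in>I. (\<Oplus>k\<in>I. (p k \<odot> (B m k \<otimes> y)) \<otimes> M k l) \<otimes> B l m')"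
    by (rule matrix_assoc[where P = "\<lambda>m k. p k \<odot> (B m k \<otimes> y)"]) (use mn closed fin in auto)
  also have "\<dots> = (\<Oplus>l\<in>I. (if m = l then \<one> else \<zero>) \<otimes> (q l \<odot> (y \<otimes> B l m')))"
  proof (rule finsum_eqI)
    fix l assume l: "l \<in> I"
    have "(p k \<odot> (B m k \<otimes> y)) \<otimes> M k l = B m k \<otimes> M k l \<otimes> (q l \<odot> y)" if k: "k \<in> I" for k
    proof -
      have "(p k \<odot> (B m k \<otimes> y)) \<otimes> M k l = B m k \<otimes> (p k \<odot> (y \<otimes> M k l))"
        using closed mn l k by (simp add: smult_mult_left smult_mult_right m_assoc)
      then show ?thesis
        unfolding rel[OF k l] using closed mn l k by (simp add: smult_mult_right m_assoc)
    qed
    then have "(\<Oplus>k\<in>I. (p k \<odot> (B m k \<otimes> y)) \<otimes> M k l) = (\<Oplus>k\<in>I. B m k \<otimes> M k l \<otimes> (q l \<odot> y))"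
      using closed mn l by (intro finsum_eqI) auto
    also have "\<dots> = (\<Oplus>k\<in>I. B m k \<otimes> M k l) \<otimes> (q l \<odot> y)"
      using closed mn l by (intro finsum_mult_right[symmetric]) auto
    also have "\<dots> = (if m = l then \<one> else \<zero>) \<otimes> (q l \<odot> y)"
      using BM mn l by simp
    finally show "(\<Oplus>k\<in>I. (p k \<odot> (B m k \<otimes> y)) \<otimes> M k l) \<otimes> B l m' =
        (if m = l then \<one> else \<zero>) \<otimes> (q l \<odot> (y \<otimes> B l m'))"
      using closed mn l by (auto simp: smult_mult_left)
  qed (use closed mn in auto)
  also have "\<dots> = q m \<odot> (y \<otimes> B m m')"
    by (rule finsum_delta_left) (use closed mn fin in auto)
  finally show ?thesis .
qed

end

text \<open>What remains when the leading factor \<open>M i k\<close> is split off the minor with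
  row word \<open>i # rest n i\<close>. Dividing by the symbol of that word normalises the diagonal.
  The row \<open>i\<close> removed from the matrix is the column index of the inverse, as in the
  classical adjugate.\<close>

definition cofactor_inverse :: "(complex, 'a, 'm) module_scheme \<Rightarrow> nat \<Rightarrow> (nat \<Rightarrow> nat \<Rightarrow> complex) \<Rightarrow>
    (nat \<Rightarrow> nat \<Rightarrow> 'a) \<Rightarrow> nat \<Rightarrow> nat \<Rightarrow> 'a"
  where "cofactor_inverse A n h M k i = inverse (qeps h (i # rest n i)) \<odot>\<^bsub>A\<^esub>
    (\<Oplus>\<^bsub>A\<^esub>js\<in>words n (n - 1). qeps h (k # js) \<odot>\<^bsub>A\<^esub> word A M (rest n i) js)"

context quantum_matrix
begin

lemma qdet_closed: "qdet A n h M \<in> carrier A"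
  using qminor_closed upt_in_words by blast

lemma cofactor_inverse_closed: "i \<in> {1..n} \<Longrightarrow> cofactor_inverse A n h M k i \<in> carrier A"
  unfolding cofactor_inverse_def
  using word_in[OF rest_in_words] by (intro smult_in finsum_closed) auto

lemma qeps_words_nonzero:
  assumes "distinct xs" "set xs \<subseteq> {1..n}"
  shows "qeps h xs \<noteq> 0"
  by (rule qeps_nonzero[OF assms(1)]) (use assms(2) in \<open>blast intro: phase\<close>)

lemma qeps_Cons_rest: "i \<in> {1..n} \<Longrightarrow> qeps h (i # rest n i) \<noteq> 0"
  and qeps_snoc_rest: "i \<in> {1..n} \<Longrightarrow> qeps h (rest n i @ [i]) \<noteq> 0"
  by (rule qeps_words_nonzero; simp add: distinct_rest set_rest)+

text \<open>The sum over \<open>k\<close> reassembles the minor with row word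
  \<open>i # rest n j\<close>. For \<open>i = j\<close> this is the normalised determinant;
  otherwise row \<open>i\<close> occurs twice and the symbol is \<open>0\<close>.\<close>

lemma cofactor_inverse_right:
  assumes "i \<in> {1..n}" "j \<in> {1..n}"
  shows "(\<Oplus>k\<in>{1..n}. M i k \<otimes> cofactor_inverse A n h M k j) = (if i = j then qdet A n h M else \<zero>)"
proof -
  define m where "m = n - 1"
  have n: "n = Suc m" using assms by (auto simp: m_def)
  have r: "rest n j \<in> words n m" using rest_in_words[OF assms(2)] by (simp add: m_def)
  have w: "i # rest n j \<in> words n (Suc m)" using r assms by simp
  have "M i k \<otimes> cofactor_inverse A n h M k j = inverse (qeps h (j # rest n j)) \<odot>
      (\<Oplus>js\<in>words n m. qeps h (k # js) \<odot> word A M (i # rest n j) (k # js))" if k: "k \<in> {1..n}" for k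
  proof -
    have "M i k \<otimes> (\<Oplus>js\<in>words n m. qeps h (k # js) \<odot> word A M (rest n j) js) =
      (\<Oplus>js\<in>words n m. M i k \<otimes> (qeps h (k # js) \<odot> word A M (rest n j) js))"
      using k assms entry word_in[OF r] by (intro finsum_mult_left) auto
    also have "\<dots> = (\<Oplus>js\<in>words n m. qeps h (k # js) \<odot> word A M (i # rest n j) (k # js))"
      using k assms entry word_in[OF r] by (intro finsum_eqI) (auto simp: smult_mult_right)
    finally show ?thesis
      unfolding cofactor_inverse_def m_def[symmetric]
      using k assms entry word_in[OF r] by (subst smult_mult_right) (auto intro!: finsum_closed)
  qed
  then have "(\<Oplus>k\<in>{1..n}. M i k \<otimes> cofactor_inverse A n h M k j) =
     (\<Oplus>k\<in>{1..n}. inverse (qeps h (j # rest n j)) \<odot>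
      (\<Oplus>js\<in>words n m. qeps h (k # js) \<odot> word A M (i # rest n j) (k # js)))"
    using word_in[OF w] by (intro finsum_eqI) (auto intro!: smult_in finsum_closed simp del: word_Cons)
  also have "\<dots> = inverse (qeps h (j # rest n j)) \<odot>
      (\<Oplus>k\<in>{1..n}. \<Oplus>js\<in>words n m. qeps h (k # js) \<odot> word A M (i # rest n j) (k # js))"
    using word_in[OF w] by (intro finsum_smult[symmetric]) (auto intro!: finsum_closed simp del: word_Cons)
  also have "(\<Oplus>k\<in>{1..n}. \<Oplus>js\<in>words n m. qeps h (k # js) \<odot> word A M (i # rest n j) (k # js)) =
      qminor A n h M (i # rest n j)"
    unfolding qminor_def wordsD(1)[OF w]
    using word_in[OF w] by (intro finsum_words_Suc[symmetric]) auto
  also have "\<dots> = qeps h (i # rest n j) \<odot> qdet A n h M"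
    using w by (intro qminor_eq) (simp add: n)
  also have "inverse (qeps h (j # rest n j)) \<odot> \<dots> =
      (inverse (qeps h (j # rest n j)) * qeps h (i # rest n j)) \<odot> qdet A n h M"
    using qdet_closed by (simp add: smult_smult del: qeps.simps upt_Suc)
  also have "\<dots> = (if i = j then qdet A n h M else \<zero>)"
  proof (cases "i = j")
    case False
    then have "\<not> distinct (i # rest n j)" using assms by (simp add: set_rest)
    then have "qeps h (i # rest n j) = 0" by (rule qeps_not_distinct)
    then show ?thesis using qdet_closed False by (simp del: qeps.simps upt_Suc)
  qed (use assms qeps_Cons_rest qdet_closed in \<open>simp del: qeps.simps upt_Suc\<close>)
  finally show ?thesis .
qed

text \<open>Interchanging rows and columns interchanges the two phases in \<open>rel\<close>, whose
  indices are in opposite orders; hence the phases have to be transposed together with the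
  matrix.\<close>

lemma transpose: "quantum_matrix A n (\<lambda>i j. h j i) (\<lambda>i j. M j i)"
proof (intro quantum_matrix.intro quantum_matrix_axioms.intro)
  show "complex_algebra A" by (rule complex_algebra_axioms)
  fix i j assume ij: "i \<in> {1..n}" "j \<in> {1..n}"
  show "h j i * h i j = 1" by (rule phase[OF ij(2,1)])
  show "h i i = 1" by (rule phase_diag[OF ij(1)])
  show "M j i \<in> carrier A" by (rule entry[OF ij(2,1)])
  fix k l assume kl: "k \<in> {1..n}" "l \<in> {1..n}"
  show "M j i \<otimes> M l k = (h i k * h l j) \<odot> (M l k \<otimes> M j i)"
    unfolding rel[OF ij(2,1) kl(2,1)] by (simp only: mult.commute)
qed

text \<open>The weighted double sum over row and column words equals \<open>c \<odot> D\<close> when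
  the columns are summed inside and \<open>c \<odot> D'\<close> when the rows are, with the same
  scalar \<open>c\<close>.\<close>

lemma qdet_transpose: "qdet A n (\<lambda>i j. h j i) (\<lambda>i j. M j i) = qdet A n h M"
proof -
  interpret t: quantum_matrix A n "\<lambda>i j. h j i" "\<lambda>i j. M j i" by (rule transpose)
  let ?h = "\<lambda>i j. h j i" and ?M = "\<lambda>i j. M j i"
  let ?J = "words n n"
  \<comment> \<open>This scalar counts the words without repetition: each of them contributes
    \<open>1\<close> by \<open>qeps_transpose\<close>, all others \<open>0\<close>.\<close>
  define c where "c = (\<Sum>is\<in>?J. qeps ?h is * qeps h is)"
  have e: "qeps ?h is * qeps h is = (if distinct is then 1 else 0)" if "is \<in> ?J" for "is"
  proof -
    have "h i j * h j i = 1" if "i \<in> set is" "j \<in> set is" for i j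
      using that wordsD(2)[OF \<open>is \<in> ?J\<close>] phase by blast
    then show ?thesis using qeps_transpose[of "is" h] qeps_not_distinct[of "is"] by simp
  qed
  have "c = (\<Sum>is\<in>?J. if distinct is then 1 else 0)"
    unfolding c_def by (rule sum.cong) (simp_all add: e)
  also have "\<dots> = of_nat (card {is \<in> ?J. distinct is})"
    by (simp add: sum.If_cases Int_def)
  finally have c_card: "c = of_nat (card {is \<in> ?J. distinct is})" .
  have fin: "finite {is \<in> ?J. distinct is}" by simp
  \<comment> \<open>A single word without repetition suffices for \<open>c \<noteq> 0\<close>, which
    allows cancelling \<open>c\<close>.\<close>
  have "[1..<Suc n] \<in> {is \<in> ?J. distinct is}"
    by (intro CollectI conjI upt_in_words distinct_upt)
  then have "card {is \<in> ?J. distinct is} \<noteq> 0"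
    using card_0_eq[OF fin] by blast
  then have c: "c \<noteq> 0" by (simp only: c_card of_nat_eq_0_iff not_False_eq_True)
  have wT: "word A ?M js is = word A M is js" if "is \<in> ?J" "js \<in> ?J" for "is" js
    using that by (intro word_transpose) (simp add: words_def)
  have wc: "word A M is js \<in> carrier A" "word A ?M is js \<in> carrier A" if "is \<in> ?J" "js \<in> ?J" for "is" js
    using word_in[OF that] t.word_in[OF that] by auto
  define D where "D = qdet A n h M"
  define D' where "D' = qdet A n ?h ?M"
  have D: "D \<in> carrier A" "D' \<in> carrier A"
    unfolding D_def D'_def by (rule qdet_closed t.qdet_closed)+
  have qm: "qminor A n h M is = qeps h is \<odot> D" "qminor A n ?h ?M is = qeps ?h is \<odot> D'" if "is \<in> ?J" for "is"
    unfolding D_def D'_def using that by (rule qminor_eq t.qminor_eq)+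
  have "c \<odot> D = (\<Oplus>is\<in>?J. (qeps ?h is * qeps h is) \<odot> D)"
    unfolding c_def using D by (intro finsum_scalar[symmetric]) auto
  also have "\<dots> = (\<Oplus>is\<in>?J. qeps ?h is \<odot> qminor A n h M is)"
    using D by (intro finsum_eqI) (auto simp: qm smult_smult)
  also have "\<dots> = (\<Oplus>is\<in>?J. \<Oplus>js\<in>?J. (qeps ?h is * qeps h js) \<odot> word A M is js)"
  proof (rule finsum_eqI)
    fix "is" assume i: "is \<in> ?J"
    show "qeps ?h is \<odot> qminor A n h M is = (\<Oplus>js\<in>?J. (qeps ?h is * qeps h js) \<odot> word A M is js)"
      unfolding qminor_def wordsD(1)[OF i]
      using wc i by (subst finsum_smult) (auto simp: smult_smult intro!: finsum_eqI)
  qed (use wc in \<open>auto intro!: finsum_closed\<close>)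
  also have "\<dots> = (\<Oplus>js\<in>?J. \<Oplus>is\<in>?J. (qeps ?h is * qeps h js) \<odot> word A M is js)"
    using wc by (intro finsum_swap) auto
  also have "\<dots> = (\<Oplus>js\<in>?J. qeps h js \<odot> qminor A n ?h ?M js)"
  proof (rule finsum_eqI)
    fix js assume j: "js \<in> ?J"
    show "(\<Oplus>is\<in>?J. (qeps ?h is * qeps h js) \<odot> word A M is js) = qeps h js \<odot> qminor A n ?h ?M js"
      unfolding qminor_def wordsD(1)[OF j]
      using wc j by (subst finsum_smult) (auto simp: smult_smult wT mult.commute intro!: finsum_eqI)
  qed (use D qm in auto)
  also have "\<dots> = (\<Oplus>js\<in>?J. (qeps ?h js * qeps h js) \<odot> D')"
    using D by (intro finsum_eqI) (auto simp: qm smult_smult mult.commute)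
  also have "\<dots> = c \<odot> D'"
    unfolding c_def using D by (intro finsum_scalar) auto
  finally have "D = D'"
    using smult_cancel[OF c] D by blast
  then show ?thesis by (simp only: D_def D'_def)
qed

text \<open>In a word of the transposed matrix the last factor for row \<open>j\<close> and column
  \<open>k\<close> is \<open>M k j\<close>. Splitting it off puts the entries of \<open>M\<close> to
  the right of the minors, as a left inverse requires. The coefficients \<open>C\<close> come from
  transposed minors, and their agreement with \<open>cofactor_inverse\<close> is not visible from
  the formulas.\<close>

lemma left_inverse_exists:
  assumes det: "qdet A n h M = \<one>"
  obtains C where "\<And>i j. i \<in> {1..n} \<Longrightarrow> j \<in> {1..n} \<Longrightarrow> C i j \<in> carrier A"
    and "\<And>i j. i \<in> {1..n} \<Longrightarrow> j \<in> {1..n} \<Longrightarrow>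
      (\<Oplus>k\<in>{1..n}. C i k \<otimes> M k j) = (if i = j then \<one> else \<zero>)"
proof -
  interpret t: quantum_matrix A n "\<lambda>i j. h j i" "\<lambda>i j. M j i" by (rule transpose)
  let ?h = "\<lambda>i j. h j i" and ?M = "\<lambda>i j. M j i"
  define C where "C i k = inverse (qeps ?h (rest n i @ [i])) \<odot>
    (\<Oplus>js\<in>words n (n - 1). qeps ?h (js @ [k]) \<odot> word A ?M (rest n i) js)" for i k
  have closed: "C i k \<in> carrier A" if "i \<in> {1..n}" for i k
    unfolding C_def using t.word_in[OF rest_in_words[OF that]] by (intro smult_in finsum_closed) auto
  have "(\<Oplus>k\<in>{1..n}. C i k \<otimes> M k j) = (if i = j then \<one> else \<zero>)" if ij: "i \<in> {1..n}" "j \<in> {1..n}" for i j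
  proof -
    define m where "m = n - 1"
    have n: "n = Suc m" using ij by (auto simp: m_def)
    have r: "rest n i \<in> words n m" using rest_in_words[OF ij(1)] by (simp add: m_def)
    have w: "rest n i @ [j] \<in> words n (Suc m)" using r ij by (auto simp: words_def)
    have snoc: "js @ [k] \<in> words n (Suc m)" if "js \<in> words n m" "k \<in> {1..n}" for js k
      using that by (auto simp: words_def)
    have "C i k \<otimes> M k j = inverse (qeps ?h (rest n i @ [i])) \<odot>
        (\<Oplus>js\<in>words n m. qeps ?h (js @ [k]) \<odot> word A ?M (rest n i @ [j]) (js @ [k]))" if k: "k \<in> {1..n}" for k
    proof -
      have app: "word A ?M (rest n i @ [j]) (js @ [k]) = word A ?M (rest n i) js \<otimes> M k j" if "js \<in> words n m" for js
        using t.word_app[OF r that, of "[j]" 1 "[k]"] k ij entry by (simp add: words_def)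
      have "(\<Oplus>js\<in>words n m. qeps ?h (js @ [k]) \<odot> word A ?M (rest n i) js) \<otimes> M k j =
        (\<Oplus>js\<in>words n m. (qeps ?h (js @ [k]) \<odot> word A ?M (rest n i) js) \<otimes> M k j)"
        using k ij entry t.word_in[OF r] by (intro finsum_mult_right) auto
      also have "\<dots> = (\<Oplus>js\<in>words n m. qeps ?h (js @ [k]) \<odot> word A ?M (rest n i @ [j]) (js @ [k]))"
        using k ij entry t.word_in[OF r] by (intro finsum_eqI) (auto simp: app smult_mult_left)
      finally show ?thesis
        unfolding C_def m_def[symmetric]
        using k ij entry t.word_in[OF r] by (subst smult_mult_left) (auto intro!: finsum_closed)
    qed
    then have "(\<Oplus>k\<in>{1..n}. C i k \<otimes> M k j) =
       (\<Oplus>k\<in>{1..n}. inverse (qeps ?h (rest n i @ [i])) \<odot>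
        (\<Oplus>js\<in>words n m. qeps ?h (js @ [k]) \<odot> word A ?M (rest n i @ [j]) (js @ [k])))"
      using t.word_in[OF w snoc] by (intro finsum_eqI) (auto intro!: smult_in finsum_closed)
    also have "\<dots> = inverse (qeps ?h (rest n i @ [i])) \<odot>
        (\<Oplus>k\<in>{1..n}. \<Oplus>js\<in>words n m. qeps ?h (js @ [k]) \<odot> word A ?M (rest n i @ [j]) (js @ [k]))"
      using t.word_in[OF w snoc] by (intro finsum_smult[symmetric]) (auto intro!: finsum_closed)
    also have "(\<Oplus>k\<in>{1..n}. \<Oplus>js\<in>words n m. qeps ?h (js @ [k]) \<odot> word A ?M (rest n i @ [j]) (js @ [k])) =
        qminor A n ?h ?M (rest n i @ [j])"
      unfolding qminor_def wordsD(1)[OF w]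
      using t.word_in[OF w] by (intro finsum_words_Suc_snoc[symmetric]) auto
    also have "\<dots> = qeps ?h (rest n i @ [j]) \<odot> qdet A n ?h ?M"
      using w by (intro t.qminor_eq) (simp add: n)
    also have "\<dots> = qeps ?h (rest n i @ [j]) \<odot> \<one>"
      using det qdet_transpose by simp
    also have "inverse (qeps ?h (rest n i @ [i])) \<odot> \<dots> =
        (inverse (qeps ?h (rest n i @ [i])) * qeps ?h (rest n i @ [j])) \<odot> \<one>"
      by (simp add: smult_smult)
    also have "\<dots> = (if i = j then \<one> else \<zero>)"
    proof (cases "i = j")
      case False
      then have "\<not> distinct (rest n i @ [j])" using ij by (simp add: set_rest)
      then have "qeps ?h (rest n i @ [j]) = 0" by (rule qeps_not_distinct)
      then show ?thesis using False by simp
    qed (use ij t.qeps_snoc_rest in simp)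
    finally show ?thesis .
  qed
  with closed show thesis by (intro that[of C])
qed

text \<open>Uniqueness of inverses identifies the left inverse, known only to exist, with the
  explicit right inverse; no commutation of minors with entries is computed.\<close>

lemma cofactor_inverse_left:
  assumes "qdet A n h M = \<one>" "i \<in> {1..n}" "j \<in> {1..n}"
  shows "(\<Oplus>k\<in>{1..n}. cofactor_inverse A n h M i k \<otimes> M k j) = (if i = j then \<one> else \<zero>)"
proof -
  let ?B = "cofactor_inverse A n h M"
  obtain C where C: "\<And>i j. i \<in> {1..n} \<Longrightarrow> j \<in> {1..n} \<Longrightarrow> C i j \<in> carrier A"
    "\<And>i j. i \<in> {1..n} \<Longrightarrow> j \<in> {1..n} \<Longrightarrow>
      (\<Oplus>k\<in>{1..n}. C i k \<otimes> M k j) = (if i = j then \<one> else \<zero>)"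
    using left_inverse_exists[OF assms(1)] by blast
  have "C i k = ?B i k" if "k \<in> {1..n}" for k
    by (rule left_right_inverse_eq[where I = "{1..n}" and M = M])
      (use assms that C entry cofactor_inverse_closed cofactor_inverse_right in auto)
  then have "(\<Oplus>k\<in>{1..n}. ?B i k \<otimes> M k j) = (\<Oplus>k\<in>{1..n}. C i k \<otimes> M k j)"
    using assms entry C(1) by (intro finsum_eqI) (auto intro!: m_closed cofactor_inverse_closed)
  then show ?thesis using C(2)[OF assms(2,3)] by simp
qed

end

subsection \<open>The opposite algebra and the inverse matrix\<close>

text \<open>Over this algebra \<open>word\<close> and \<open>qminor\<close> multiply in the reverse
  order, so the theory of quantum matrices applies unchanged to the values of an
  anti-homomorphism.\<close>

definition opposite :: "('a, 'm) monoid_scheme \<Rightarrow> ('a, 'm) monoid_scheme"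
  where "opposite A = A\<lparr>monoid.mult := (\<lambda>x y. y \<otimes>\<^bsub>A\<^esub> x)\<rparr>"

lemma opposite_simps [simp]:
  fixes A :: "(complex, 'a, 'm) module_scheme"
  shows "carrier (opposite A) = carrier A" "x \<otimes>\<^bsub>opposite A\<^esub> y = y \<otimes>\<^bsub>A\<^esub> x"
    "\<one>\<^bsub>opposite A\<^esub> = \<one>\<^bsub>A\<^esub>" "\<zero>\<^bsub>opposite A\<^esub> = \<zero>\<^bsub>A\<^esub>" "x \<oplus>\<^bsub>opposite A\<^esub> y = x \<oplus>\<^bsub>A\<^esub> y"
    "c \<odot>\<^bsub>opposite A\<^esub> x = c \<odot>\<^bsub>A\<^esub> x" "finsum (opposite A) = finsum A"
  by (simp_all add: opposite_def finsum_def fun_eq_iff)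

lemma (in complex_algebra) opposite_algebra: "complex_algebra (opposite A)"
  by (rule complex_algebraI)
    (simp_all add: M.a_assoc smult_minus_one M.l_neg m_assoc l_distr r_distr smult_add_left
      smult_add_right smult_smult smult_mult_left smult_mult_right, simp_all add: a_comm)

text \<open>This turns the antipode into a homomorphism, so that it can be obtained from a universal
  property.\<close>

lemma antihoms_opposite: "algebra_antihoms A B = algebra_homs A (opposite B)"
  for B :: "(complex, 'b, 'm) module_scheme"
  by (auto simp: algebra_antihoms_def algebra_homs_def linear_maps_def ring_hom_def)

context complex_algebra
begin

lemma word_opposite_closed:
  assumes "\<And>i j. i \<in> {1..n} \<Longrightarrow> j \<in> {1..n} \<Longrightarrow> B i j \<in> carrier A"
    and "ks \<in> words n m" "is \<in> words n m"
  shows "word (opposite A) B ks is \<in> carrier A"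
  using complex_algebra.word_closed[OF opposite_algebra, of n B ks m "is"] assms by simp

text \<open>The word in \<open>B\<close> is read backwards, so its leading letters meet the leading
  letters of the word in \<open>M\<close> in the middle of the product. Summing over that middle
  index collapses the pair to a Kronecker delta, and the product collapses from the inside
  outwards.\<close>

lemma word_inverse:
  assumes B: "\<And>i j. i \<in> {1..n} \<Longrightarrow> j \<in> {1..n} \<Longrightarrow> B i j \<in> carrier A"
    and M: "\<And>i j. i \<in> {1..n} \<Longrightarrow> j \<in> {1..n} \<Longrightarrow> M i j \<in> carrier A"
    and BM: "\<And>i j. i \<in> {1..n} \<Longrightarrow> j \<in> {1..n} \<Longrightarrow>
      (\<Oplus>k\<in>{1..n}. B i k \<otimes> M k j) = (if i = j then \<one> else \<zero>)"
    and "ks \<in> words n m" "js \<in> words n m"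
  shows "(\<Oplus>is\<in>words n m. word (opposite A) B ks is \<otimes> word A M is js) = (if ks = js then \<one> else \<zero>)"
  using assms(4,5)
proof (induction m arbitrary: ks js)
  case 0
  then show ?case by simp
next
  case (Suc m)
  obtain k ks' where ks: "ks = k # ks'" "k \<in> {1..n}" "ks' \<in> words n m"
    using Suc.prems(1) by (cases ks) (auto simp: words_def)
  obtain j js' where js: "js = j # js'" "j \<in> {1..n}" "js' \<in> words n m"
    using Suc.prems(2) by (cases js) (auto simp: words_def)
  note ow = word_opposite_closed[of n B, OF B]
  note mw = word_closed[of n M, OF M]
  let ?o = "\<lambda>is. word (opposite A) B ks' is"
  have oc: "?o is \<in> carrier A" and mc: "word A M is js' \<in> carrier A" if "is \<in> words n m" for "is"
    using ow[OF _ _ ks(3) that] mw[OF _ _ that js(3)] by simp_all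
  have Bc: "B k i \<in> carrier A" and Mc: "M i j \<in> carrier A" if "i \<in> {1..n}" for i
    using B M ks js that by auto
  have "(\<Oplus>is\<in>words n (Suc m). word (opposite A) B ks is \<otimes> word A M is js) =
     (\<Oplus>i\<in>{1..n}. \<Oplus>is\<in>words n m. word (opposite A) B ks (i # is) \<otimes> word A M (i # is) js)"
    using ow[OF _ _ Suc.prems(1)] mw[OF _ _ _ Suc.prems(2)] by (intro finsum_words_Suc) simp
  also have "\<dots> = (\<Oplus>is\<in>words n m. \<Oplus>i\<in>{1..n}. word (opposite A) B ks (i # is) \<otimes> word A M (i # is) js)"
    unfolding ks(1) js(1) using oc mc Bc Mc by (intro finsum_swap) simp_all
  also have "\<dots> = (\<Oplus>is\<in>words n m. (if k = j then \<one> else \<zero>) \<otimes> (?o is \<otimes> word A M is js'))"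
  proof (rule finsum_eqI)
    fix "is" assume i: "is \<in> words n m"
    have "(\<Oplus>i\<in>{1..n}. word (opposite A) B ks (i # is) \<otimes> word A M (i # is) js) =
        (\<Oplus>i\<in>{1..n}. ?o is \<otimes> ((B k i \<otimes> M i j) \<otimes> word A M is js'))"
      unfolding ks(1) js(1) using oc[OF i] mc[OF i] Bc Mc by (intro finsum_eqI) (simp_all add: m_assoc)
    also have "\<dots> = ?o is \<otimes> (\<Oplus>i\<in>{1..n}. (B k i \<otimes> M i j) \<otimes> word A M is js')"
      using oc[OF i] mc[OF i] Bc Mc by (intro finsum_mult_left[symmetric]) simp_all
    also have "(\<Oplus>i\<in>{1..n}. (B k i \<otimes> M i j) \<otimes> word A M is js') = (\<Oplus>i\<in>{1..n}. B k i \<otimes> M i j) \<otimes> word A M is js'"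
      using mc[OF i] Bc Mc by (intro finsum_mult_right[symmetric]) simp_all
    also have "\<dots> = (if k = j then \<one> else \<zero>) \<otimes> word A M is js'"
      using BM ks js by simp
    finally show "(\<Oplus>i\<in>{1..n}. word (opposite A) B ks (i # is) \<otimes> word A M (i # is) js) =
        (if k = j then \<one> else \<zero>) \<otimes> (?o is \<otimes> word A M is js')"
      using oc[OF i] mc[OF i] by (simp split: if_splits)
  qed (use oc mc in simp)
  also have "\<dots> = (if k = j then \<one> else \<zero>) \<otimes> (\<Oplus>is\<in>words n m. ?o is \<otimes> word A M is js')"
    using oc mc by (intro finsum_mult_left[symmetric]) simp_all
  also have "\<dots> = (if ks = js then \<one> else \<zero>)"
    using Suc.IH[OF ks(3) js(3)] by (simp add: ks js)
  finally show ?case .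
qed

end

context quantum_matrix
begin

text \<open>Taking \<open>y\<close> to be an entry of \<open>M\<close> yields the relations between
  \<open>B\<close> and \<open>M\<close>; taking \<open>y\<close> to be an entry of \<open>B\<close>
  turns these into relations among the entries of \<open>B\<close>. The resulting phases belong to
  the products in reversed order, that is, to the opposite algebra.\<close>

lemma inverse_quantum_matrix:
  assumes det: "qdet A n h M = \<one>"
  shows "quantum_matrix (opposite A) n h (cofactor_inverse A n h M)"
proof (intro quantum_matrix.intro quantum_matrix_axioms.intro)
  let ?B = "cofactor_inverse A n h M"
  show "complex_algebra (opposite A)" by (rule opposite_algebra)
  note right = cofactor_inverse_right[unfolded det]
  note left = cofactor_inverse_left[OF det]
  fix i j assume ij: "i \<in> {1..n}" "j \<in> {1..n}"
  show "h i j * h j i = 1" by (rule phase[OF ij])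
  show "h i i = 1" by (rule phase_diag[OF ij(1)])
  show "?B i j \<in> carrier (opposite A)" using cofactor_inverse_closed[OF ij(2)] by simp
  fix k l assume kl: "k \<in> {1..n}" "l \<in> {1..n}"
  have mixed: "h p j \<odot> (?B i j \<otimes> M p q) = h q i \<odot> (M p q \<otimes> ?B i j)" if "p \<in> {1..n}" "q \<in> {1..n}" for p q
  proof (rule inverse_commute[where I = "{1..n}" and M = M and p = "\<lambda>k. h p k" and q = "\<lambda>l. h q l"])
    fix k l assume "k \<in> {1..n}" "l \<in> {1..n}"
    then show "h p k \<odot> (M p q \<otimes> M k l) = h q l \<odot> (M k l \<otimes> M p q)"
      using rel[of p q k l] phase[of p k] that entry by (simp add: smult_smult mult.assoc[symmetric])
  qed (use that ij entry cofactor_inverse_closed left right in simp_all)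
  have "h l j \<odot> (?B k l \<otimes> ?B i j) = h k i \<odot> (?B i j \<otimes> ?B k l)"
    by (rule inverse_commute[where I = "{1..n}" and M = M and p = "\<lambda>p. h p j" and q = "\<lambda>q. h q i"])
      (use mixed ij kl entry cofactor_inverse_closed left right in simp_all)
  then have "h j l \<odot> (h l j \<odot> (?B k l \<otimes> ?B i j)) = h j l \<odot> (h k i \<odot> (?B i j \<otimes> ?B k l))"
    by simp
  then show "?B i j \<otimes>\<^bsub>opposite A\<^esub> ?B k l = (h k i * h j l) \<odot>\<^bsub>opposite A\<^esub> (?B k l \<otimes>\<^bsub>opposite A\<^esub> ?B i j)"
    using phase[of j l] ij kl cofactor_inverse_closed by (simp add: smult_smult mult.commute)
qed

text \<open>Since the determinant of \<open>M\<close> is \<open>1\<close>, each coefficient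
  \<open>qeps h is\<close> may be replaced by the minor of \<open>M\<close> with rows
  \<open>is\<close>. The product of the reversed word in \<open>B\<close> with the words in
  \<open>M\<close> then collapses by \<open>word_inverse\<close>, and only the coefficient of
  \<open>[1..<Suc n]\<close> survives.\<close>

lemma qdet_inverse:
  assumes det: "qdet A n h M = \<one>"
  shows "qdet (opposite A) n h (cofactor_inverse A n h M) = \<one>"
proof -
  let ?B = "cofactor_inverse A n h M"
  let ?ks = "[1..<Suc n]" and ?J = "words n n"
  have oc: "word (opposite A) ?B ?ks is \<in> carrier A" if "is \<in> ?J" for "is"
    using word_opposite_closed[of n ?B] cofactor_inverse_closed upt_in_words that by blast
  note mc = word_in[of _ n]
  have "qdet (opposite A) n h ?B = (\<Oplus>is\<in>?J. qeps h is \<odot> word (opposite A) ?B ?ks is)"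
    unfolding qminor_def opposite_simps wordsD(1)[OF upt_in_words] ..
  also have "\<dots> = (\<Oplus>is\<in>?J. word (opposite A) ?B ?ks is \<otimes> qminor A n h M is)"
  proof (rule finsum_eqI)
    fix "is" assume i: "is \<in> ?J"
    show "qeps h is \<odot> word (opposite A) ?B ?ks is = word (opposite A) ?B ?ks is \<otimes> qminor A n h M is"
      unfolding qminor_eq[OF i] det using oc[OF i] by (simp only: smult_mult_right one_closed r_one)
  qed (use oc qminor_closed in blast)
  also have "\<dots> = (\<Oplus>is\<in>?J. \<Oplus>js\<in>?J. qeps h js \<odot> (word (opposite A) ?B ?ks is \<otimes> word A M is js))"
  proof (rule finsum_eqI)
    fix "is" assume i: "is \<in> ?J"
    have "word (opposite A) ?B ?ks is \<otimes> qminor A n h M is =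
        (\<Oplus>js\<in>?J. word (opposite A) ?B ?ks is \<otimes> (qeps h js \<odot> word A M is js))"
      unfolding qminor_def wordsD(1)[OF i] using oc[OF i] mc[OF i]
      by (intro finsum_mult_left) (simp_all only: smult_in)
    also have "\<dots> = (\<Oplus>js\<in>?J. qeps h js \<odot> (word (opposite A) ?B ?ks is \<otimes> word A M is js))"
      using oc[OF i] mc[OF i] by (intro finsum_eqI) (simp_all only: smult_in m_closed smult_mult_right)
    finally show "word (opposite A) ?B ?ks is \<otimes> qminor A n h M is =
       (\<Oplus>js\<in>?J. qeps h js \<odot> (word (opposite A) ?B ?ks is \<otimes> word A M is js))" .
    show "(\<Oplus>js\<in>?J. qeps h js \<odot> (word (opposite A) ?B ?ks is \<otimes> word A M is js)) \<in> carrier A"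
      using oc[OF i] mc[OF i] by (intro finsum_closed funcsetI) (simp only: m_closed smult_in)
  qed
  also have "\<dots> = (\<Oplus>js\<in>?J. \<Oplus>is\<in>?J. qeps h js \<odot> (word (opposite A) ?B ?ks is \<otimes> word A M is js))"
    using oc mc by (intro finsum_swap) (simp_all only: smult_in m_closed finite_words)
  also have "\<dots> = (\<Oplus>js\<in>?J. if js = ?ks then qeps h js \<odot> \<one> else \<zero>)"
  proof (rule finsum_eqI)
    fix js assume j: "js \<in> ?J"
    have "(\<Oplus>is\<in>?J. qeps h js \<odot> (word (opposite A) ?B ?ks is \<otimes> word A M is js)) =
        qeps h js \<odot> (\<Oplus>is\<in>?J. word (opposite A) ?B ?ks is \<otimes> word A M is js)"
      using oc mc[OF _ j] by (intro finsum_smult[symmetric]) (simp only: m_closed)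
    also have "(\<Oplus>is\<in>?J. word (opposite A) ?B ?ks is \<otimes> word A M is js) = (if ?ks = js then \<one> else \<zero>)"
      by (rule word_inverse[OF _ _ cofactor_inverse_left[OF det] upt_in_words j])
        (simp_all only: cofactor_inverse_closed entry)
    finally have e: "(\<Oplus>is\<in>?J. qeps h js \<odot> (word (opposite A) ?B ?ks is \<otimes> word A M is js)) =
      qeps h js \<odot> (if ?ks = js then \<one> else \<zero>)" .
    show "(\<Oplus>is\<in>?J. qeps h js \<odot> (word (opposite A) ?B ?ks is \<otimes> word A M is js)) =
      (if js = ?ks then qeps h js \<odot> \<one> else \<zero>)"
    proof (cases "js = ?ks")
      case True
      show ?thesis using e unfolding True by (simp only: if_True simp_thms)
    next
      case False
      show ?thesis
        using e unfolding if_not_P[OF False] if_not_P[OF not_sym[OF False]] smult_zero_right .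
    qed
  qed simp
  also have "\<dots> = qeps h ?ks \<odot> \<one>"
    by (rule finsum_delta) (simp_all only: finite_words upt_in_words smult_in one_closed)
  finally show ?thesis by (simp only: qeps_upt one_smult one_closed)
qed

end

subsection \<open>Products of commuting quantum matrices\<close>

text \<open>The model is the pair \<open>A \<otimes> 1\<close> and \<open>1 \<otimes> A\<close> in
  the tensor square, whose matrix product is the prescribed coproduct of the entries.\<close>

locale commuting_quantum_matrices = P: quantum_matrix A n h P + Q: quantum_matrix A n h Q
  for A (structure) and n h P Q +
  assumes commute: "\<And>i j k l. i \<in> {1..n} \<Longrightarrow> j \<in> {1..n} \<Longrightarrow> k \<in> {1..n} \<Longrightarrow> l \<in> {1..n} \<Longrightarrow>
    P i j \<otimes> Q k l = Q k l \<otimes> P i j"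
begin

definition R where "R i j = (\<Oplus>k\<in>{1..n}. P i k \<otimes> Q k j)"

lemma R_closed: "i \<in> {1..n} \<Longrightarrow> j \<in> {1..n} \<Longrightarrow> R i j \<in> carrier A"
  unfolding R_def using P.entry Q.entry by (intro P.finsum_closed) auto

lemma product_relation:
  assumes ij: "i \<in> {1..n}" "j \<in> {1..n}" and kl: "k \<in> {1..n}" "l \<in> {1..n}"
  shows "R i j \<otimes> R k l = (h k i * h j l) \<odot> (R k l \<otimes> R i j)"
proof -
  have prod: "R i j \<otimes> R k l = (\<Oplus>m\<in>{1..n}. \<Oplus>p\<in>{1..n}. (P i m \<otimes> Q m j) \<otimes> (P k p \<otimes> Q p l))"
    if "i \<in> {1..n}" "j \<in> {1..n}" "k \<in> {1..n}" "l \<in> {1..n}" for i j k l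
  proof -
    have "R i j \<otimes> R k l = (\<Oplus>m\<in>{1..n}. (P i m \<otimes> Q m j) \<otimes> R k l)"
      unfolding R_def[of i] using that P.entry Q.entry R_closed by (intro P.finsum_mult_right) simp_all
    also have "\<dots> = (\<Oplus>m\<in>{1..n}. \<Oplus>p\<in>{1..n}. (P i m \<otimes> Q m j) \<otimes> (P k p \<otimes> Q p l))"
      unfolding R_def using that P.entry Q.entry
      by (intro P.finsum_eqI P.finsum_mult_left) (simp_all add: P.finsum_closed)
    finally show ?thesis .
  qed
  have swap: "(P i m \<otimes> Q m j) \<otimes> (P k p \<otimes> Q p l) =
      (h k i * h j l) \<odot> ((P k p \<otimes> Q p l) \<otimes> (P i m \<otimes> Q m j))" if "m \<in> {1..n}" "p \<in> {1..n}" for m p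
  proof -
    note c = P.entry[OF ij(1) that(1)] P.entry[OF kl(1) that(2)] Q.entry[OF that(1) ij(2)] Q.entry[OF that(2) kl(2)]
    have "(P i m \<otimes> Q m j) \<otimes> (P k p \<otimes> Q p l) = P i m \<otimes> (Q m j \<otimes> P k p) \<otimes> Q p l"
      using c by (simp add: P.m_assoc)
    also have "\<dots> = (P i m \<otimes> P k p) \<otimes> (Q m j \<otimes> Q p l)"
      unfolding commute[OF kl(1) that(2) that(1) ij(2), symmetric] using c by (simp add: P.m_assoc)
    also have "\<dots> = ((h k i * h m p) * (h p m * h j l)) \<odot> ((P k p \<otimes> P i m) \<otimes> (Q p l \<otimes> Q m j))"
      unfolding P.rel[OF ij(1) that(1) kl(1) that(2)] Q.rel[OF that(1) ij(2) that(2) kl(2)]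
      using c by (simp add: P.smult_mult_left P.smult_mult_right P.smult_smult mult_ac)
    \<comment> \<open>The summation indices are column indices of \<open>P\<close> and row indices
      of \<open>Q\<close>, so their phases appear in opposite orders and cancel. Hence all summands
      acquire the same factor.\<close>
    also have "(h k i * h m p) * (h p m * h j l) = h k i * h j l"
      using P.phase[OF that] by (metis (no_types, lifting) mult.assoc mult.commute mult_1)
    also have "(P k p \<otimes> P i m) \<otimes> (Q p l \<otimes> Q m j) = P k p \<otimes> (P i m \<otimes> Q p l) \<otimes> Q m j"
      using c by (simp add: P.m_assoc)
    also have "\<dots> = (P k p \<otimes> Q p l) \<otimes> (P i m \<otimes> Q m j)"
      unfolding commute[OF ij(1) that(1) that(2) kl(2)] using c by (simp add: P.m_assoc)
    finally show ?thesis .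
  qed
  have "R i j \<otimes> R k l =
      (\<Oplus>m\<in>{1..n}. \<Oplus>p\<in>{1..n}. (h k i * h j l) \<odot> ((P k p \<otimes> Q p l) \<otimes> (P i m \<otimes> Q m j)))"
    unfolding prod[OF ij kl] using ij kl P.entry Q.entry
    by (intro P.finsum_eqI swap) (simp_all add: P.finsum_closed)
  also have "\<dots> = (\<Oplus>p\<in>{1..n}. \<Oplus>m\<in>{1..n}. (h k i * h j l) \<odot> ((P k p \<otimes> Q p l) \<otimes> (P i m \<otimes> Q m j)))"
    using ij kl P.entry Q.entry by (intro P.finsum_swap) simp_all
  also have "\<dots> = (\<Oplus>p\<in>{1..n}. (h k i * h j l) \<odot> (\<Oplus>m\<in>{1..n}. (P k p \<otimes> Q p l) \<otimes> (P i m \<otimes> Q m j)))"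
    using ij kl P.entry Q.entry by (intro P.finsum_eqI P.finsum_smult[symmetric]) (simp_all add: P.finsum_closed)
  also have "\<dots> = (h k i * h j l) \<odot> (R k l \<otimes> R i j)"
    unfolding prod[OF kl ij] using ij kl P.entry Q.entry
    by (intro P.finsum_smult[symmetric]) (simp add: P.finsum_closed)
  finally show ?thesis .
qed

lemma product_quantum_matrix: "quantum_matrix A n h R"
  by (intro quantum_matrix.intro quantum_matrix_axioms.intro P.complex_algebra_axioms
      P.phase P.phase_diag R_closed product_relation)

lemma commute_word:
  assumes "k \<in> {1..n}" "l \<in> {1..n}" "is \<in> words n m" "js \<in> words n m"
  shows "Q k l \<otimes> word A P is js = word A P is js \<otimes> Q k l"
  using assms(3,4)
proof (induction m arbitrary: "is" js)
  case 0
  then show ?case using Q.entry assms by simp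
next
  case (Suc m)
  obtain i is' where i: "is = i # is'" "i \<in> {1..n}" "is' \<in> words n m"
    using Suc.prems(1) by (cases "is") (auto simp: words_def)
  obtain j js' where j: "js = j # js'" "j \<in> {1..n}" "js' \<in> words n m"
    using Suc.prems(2) by (cases js) (auto simp: words_def)
  note c = P.entry[OF i(2) j(2)] Q.entry[OF assms(1,2)] P.word_in[OF i(3) j(3)]
  have "Q k l \<otimes> (P i j \<otimes> word A P is' js') = (P i j \<otimes> Q k l) \<otimes> word A P is' js'"
    unfolding commute[OF i(2) j(2) assms(1,2)] using c by (simp add: P.m_assoc)
  also have "\<dots> = P i j \<otimes> (word A P is' js' \<otimes> Q k l)"
    unfolding Suc.IH[OF i(3) j(3), symmetric] using c by (simp add: P.m_assoc)
  finally show ?case unfolding i(1) j(1) using c by (simp add: P.m_assoc)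
qed

text \<open>Entries of \<open>Q\<close> pass through words in \<open>P\<close> unchanged, which
  separates the product into a \<open>P\<close> part and a \<open>Q\<close> part joined by the
  intermediate word \<open>ks\<close>.\<close>

lemma word_product:
  assumes "is \<in> words n m" "js \<in> words n m"
  shows "word A R is js = (\<Oplus>ks\<in>words n m. word A P is ks \<otimes> word A Q ks js)"
  using assms
proof (induction m arbitrary: "is" js)
  case 0
  then show ?case by simp
next
  case (Suc m)
  obtain i is' where i: "is = i # is'" "i \<in> {1..n}" "is' \<in> words n m"
    using Suc.prems(1) by (cases "is") (auto simp: words_def)
  obtain j js' where j: "js = j # js'" "j \<in> {1..n}" "js' \<in> words n m"
    using Suc.prems(2) by (cases js) (auto simp: words_def)
  have pc: "word A P is' ks \<in> carrier A" and qc: "word A Q ks js' \<in> carrier A" if "ks \<in> words n m" for ks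
    using P.word_in[OF i(3) that] Q.word_in[OF that j(3)] by simp_all
  have ec: "P i k \<in> carrier A" "Q k j \<in> carrier A" if "k \<in> {1..n}" for k
    using P.entry[OF i(2) that] Q.entry[OF that j(2)] by simp_all
  have "word A R is js = R i j \<otimes> (\<Oplus>ks\<in>words n m. word A P is' ks \<otimes> word A Q ks js')"
    unfolding i(1) j(1) word_Cons Suc.IH[OF i(3) j(3)] ..
  also have "\<dots> = (\<Oplus>k\<in>{1..n}. (P i k \<otimes> Q k j) \<otimes> (\<Oplus>ks\<in>words n m. word A P is' ks \<otimes> word A Q ks js'))"
    unfolding R_def using ec pc qc by (intro P.finsum_mult_right) (simp_all add: P.finsum_closed)
  also have "\<dots> = (\<Oplus>k\<in>{1..n}. \<Oplus>ks\<in>words n m. (P i k \<otimes> Q k j) \<otimes> (word A P is' ks \<otimes> word A Q ks js'))"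
    using ec pc qc by (intro P.finsum_eqI P.finsum_mult_left) (simp_all add: P.finsum_closed)
  also have "\<dots> = (\<Oplus>k\<in>{1..n}. \<Oplus>ks\<in>words n m. word A P is (k # ks) \<otimes> word A Q (k # ks) js)"
  proof (intro P.finsum_eqI)
    fix k ks assume k: "k \<in> {1..n}" and ks: "ks \<in> words n m"
    have "(P i k \<otimes> Q k j) \<otimes> (word A P is' ks \<otimes> word A Q ks js') =
        P i k \<otimes> (Q k j \<otimes> word A P is' ks) \<otimes> word A Q ks js'"
      using ec[OF k] pc[OF ks] qc[OF ks] by (simp add: P.m_assoc)
    also have "\<dots> = word A P is (k # ks) \<otimes> word A Q (k # ks) js"
      unfolding commute_word[OF k j(2) i(3) ks] i(1) j(1) using ec[OF k] pc[OF ks] qc[OF ks]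
      by (simp add: P.m_assoc)
    finally show "(P i k \<otimes> Q k j) \<otimes> (word A P is' ks \<otimes> word A Q ks js') =
        word A P is (k # ks) \<otimes> word A Q (k # ks) js" .
  qed (use i j ec pc qc in \<open>simp_all add: P.finsum_closed\<close>)
  also have "\<dots> = (\<Oplus>ks\<in>words n (Suc m). word A P is ks \<otimes> word A Q ks js)"
    using P.word_in[OF Suc.prems(1)] Q.word_in[OF _ Suc.prems(2)]
    by (intro P.finsum_words_Suc[symmetric]) simp
  finally show ?case .
qed

text \<open>For each intermediate word \<open>ls\<close> the inner sum is the minor of
  \<open>Q\<close> with rows \<open>ls\<close>, that is, \<open>qeps h ls\<close> times the
  determinant of \<open>Q\<close>. The factor \<open>qeps h ls\<close> is just the coefficient that
  completes the determinant of \<open>P\<close>.\<close>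

theorem qdet_product: "qdet A n h R = qdet A n h P \<otimes> qdet A n h Q"
proof -
  let ?ks = "[1..<Suc n]" and ?J = "words n n"
  note pc = P.word_in[OF upt_in_words]
  have D: "qdet A n h Q \<in> carrier A" by (rule Q.qdet_closed)
  have "qdet A n h R = (\<Oplus>js\<in>?J. \<Oplus>ls\<in>?J. qeps h js \<odot> (word A P ?ks ls \<otimes> word A Q ls js))"
    unfolding qminor_def wordsD(1)[OF upt_in_words]
  proof (rule P.finsum_eqI)
    fix js assume j: "js \<in> ?J"
    show "qeps h js \<odot> word A R ?ks js = (\<Oplus>ls\<in>?J. qeps h js \<odot> (word A P ?ks ls \<otimes> word A Q ls js))"
      unfolding word_product[OF upt_in_words j]
      using pc Q.word_in[OF _ j] by (intro P.finsum_smult) (simp only: P.m_closed)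
    show "(\<Oplus>ls\<in>?J. qeps h js \<odot> (word A P ?ks ls \<otimes> word A Q ls js)) \<in> carrier A"
      using pc Q.word_in[OF _ j] by (intro P.finsum_closed funcsetI) (simp only: P.m_closed P.smult_in)
  qed
  also have "\<dots> = (\<Oplus>ls\<in>?J. \<Oplus>js\<in>?J. qeps h js \<odot> (word A P ?ks ls \<otimes> word A Q ls js))"
    using pc Q.word_in by (intro P.finsum_swap) (simp_all only: P.m_closed P.smult_in finite_words)
  also have "\<dots> = (\<Oplus>ls\<in>?J. (qeps h ls \<odot> word A P ?ks ls) \<otimes> qdet A n h Q)"
  proof (rule P.finsum_eqI)
    fix ls assume l: "ls \<in> ?J"
    have "(\<Oplus>js\<in>?J. qeps h js \<odot> (word A P ?ks ls \<otimes> word A Q ls js)) =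
        (\<Oplus>js\<in>?J. word A P ?ks ls \<otimes> (qeps h js \<odot> word A Q ls js))"
      using pc[OF l] Q.word_in[OF l]
      by (intro P.finsum_eqI) (simp_all only: P.m_closed P.smult_in P.smult_mult_right)
    also have "\<dots> = word A P ?ks ls \<otimes> qminor A n h Q ls"
      unfolding qminor_def wordsD(1)[OF l] using pc[OF l] Q.word_in[OF l]
      by (intro P.finsum_mult_left[symmetric]) (simp_all only: P.smult_in)
    also have "\<dots> = (qeps h ls \<odot> word A P ?ks ls) \<otimes> qdet A n h Q"
      unfolding Q.qminor_eq[OF l] using pc[OF l] D by (simp only: P.smult_mult_right P.smult_mult_left)
    finally show "(\<Oplus>js\<in>?J. qeps h js \<odot> (word A P ?ks ls \<otimes> word A Q ls js)) =
      (qeps h ls \<odot> word A P ?ks ls) \<otimes> qdet A n h Q" .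
  qed (use pc D in \<open>simp only: P.m_closed P.smult_in\<close>)
  also have "\<dots> = (\<Oplus>ls\<in>?J. qeps h ls \<odot> word A P ?ks ls) \<otimes> qdet A n h Q"
    using pc D by (intro P.finsum_mult_right[symmetric]) (simp_all only: P.smult_in)
  also have "(\<Oplus>ls\<in>?J. qeps h ls \<odot> word A P ?ks ls) = qdet A n h P"
    unfolding qminor_def wordsD(1)[OF upt_in_words] ..
  finally show ?thesis .
qed

end

text \<open>Only the column word \<open>[1..<Suc n]\<close> gives a nonzero product, and its
  coefficient is \<open>1\<close>. The counit is obtained from this matrix.\<close>

lemma qdet_delta:
  assumes "complex_algebra A"
  shows "qdet A n h (\<lambda>i j. if i = j then \<one>\<^bsub>A\<^esub> else \<zero>\<^bsub>A\<^esub>) = \<one>\<^bsub>A\<^esub>" (is "qdet A n h ?M = _")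
proof -
  interpret complex_algebra A by fact
  have word: "word A ?M is js = (if js = is then \<one>\<^bsub>A\<^esub> else \<zero>\<^bsub>A\<^esub>)" if "length is = length js" for "is" js
    using that by (induction "is" js rule: list_induct2) auto
  have "qdet A n h ?M = (\<Oplus>\<^bsub>A\<^esub>js\<in>words n n. if js = [1..<Suc n] then qeps h js \<odot>\<^bsub>A\<^esub> \<one>\<^bsub>A\<^esub> else \<zero>\<^bsub>A\<^esub>)"
    unfolding qminor_def wordsD(1)[OF upt_in_words]
  proof (rule finsum_eqI)
    fix js assume "js \<in> words n n"
    then have "length [1..<Suc n] = length js" using wordsD(1) upt_in_words by metis
    from word[OF this]
    show "qeps h js \<odot>\<^bsub>A\<^esub> word A ?M [1..<Suc n] js = (if js = [1..<Suc n] then qeps h js \<odot>\<^bsub>A\<^esub> \<one>\<^bsub>A\<^esub> else \<zero>\<^bsub>A\<^esub>)"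
      by (simp del: upt_Suc)
  qed simp
  also have "\<dots> = qeps h [1..<Suc n] \<odot>\<^bsub>A\<^esub> \<one>\<^bsub>A\<^esub>"
    by (rule finsum_delta) (simp_all only: finite_words upt_in_words smult_in one_closed)
  finally show ?thesis by (simp only: qeps_upt one_smult one_closed)
qed

subsection \<open>Signs of permutations\<close>

lemma qeps_one_move: "qeps (\<lambda>_ _. 1) (us @ a # vs @ ws) = (-1) ^ length vs * qeps (\<lambda>_ _. 1) (us @ vs @ a # ws)"
proof (induction vs arbitrary: us)
  case (Cons v vs)
  show ?case
    using qeps_swap[of "\<lambda>_ _. 1" v a us "vs @ ws"] Cons[of "us @ [v]"] by simp
qed simp

text \<open>Letter \<open>a\<close> moves across \<open>vs\<close>, changes places with
  \<open>b\<close>, and \<open>b\<close> moves back across \<open>vs\<close>. The two moves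
  contribute the same power of \<open>-1\<close>, so only the middle exchange counts.\<close>

lemma qeps_one_swap: "qeps (\<lambda>_ _. 1) (us @ a # vs @ b # ws) = - qeps (\<lambda>_ _. 1) (us @ b # vs @ a # ws)"
proof -
  let ?E = "qeps (\<lambda>_ _. 1)"
  have "?E (us @ a # vs @ b # ws) = (-1) ^ length vs * ?E (us @ vs @ a # b # ws)"
    using qeps_one_move[of us a vs "b # ws"] by simp
  also have "?E (us @ vs @ a # b # ws) = - ?E (us @ vs @ b # a # ws)"
    using qeps_swap[of "\<lambda>_ _. 1" b a "us @ vs" ws] by simp
  also have "(-1) ^ length vs * - ?E (us @ vs @ b # a # ws) = - ?E (us @ b # vs @ a # ws)"
    using qeps_one_move[of us b vs "a # ws"] by simp
  finally show ?thesis .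
qed

lemma qeps_one_transpose:
  assumes "distinct js" "a \<in> set js" "b \<in> set js" "a \<noteq> b"
  shows "qeps (\<lambda>_ _. 1) (map (Transposition.transpose a b) js) = - qeps (\<lambda>_ _. 1) js"
proof -
  obtain us ts where js: "js = us @ a # ts" using assms(2) by (meson split_list)
  have other: "map (Transposition.transpose a b) xs = xs" if "a \<notin> set xs" "b \<notin> set xs" for xs
    using that by (intro map_idI) (metis transpose_apply_other)
  have "b \<in> set us \<or> b \<in> set ts" using assms js by auto
  then show ?thesis
  proof
    assume "b \<in> set ts"
    then obtain vs ws where ts: "ts = vs @ b # ws" by (meson split_list)
    have "map (Transposition.transpose a b) js = us @ b # vs @ a # ws"
      using assms(1) by (simp add: js ts other)
    then show ?thesis using qeps_one_swap[of us b vs a ws] by (simp add: js ts)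
  next
    assume "b \<in> set us"
    then obtain vs ws where us: "us = vs @ b # ws" by (meson split_list)
    have "map (Transposition.transpose a b) js = vs @ a # ws @ b # ts"
      using assms(1) by (simp add: js us other)
    then show ?thesis using qeps_one_swap[of vs a ws b ts] by (simp add: js us)
  qed
qed

text \<open>With all phases equal to \<open>1\<close> the symbol counts inversions modulo two. The
  comparison with \<open>sign\<close> goes through transpositions of values, each of which negates
  both sides.\<close>

lemma sign_qeps:
  assumes "sorted_wrt (<) xs" "\<sigma> permutes set xs"
  shows "of_int (sign \<sigma>) = qeps (\<lambda>_ _. 1) (map \<sigma> xs)"
proof -
  have d: "distinct xs"
    using assms(1) strict_sorted_iff by blast
  from assms(2) finite_set[of xs] show ?thesis
  proof (induction rule: permutes_induct)
    case id
    then show ?case using qeps_sorted[OF assms(1)] by simp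
  next
    case (swap a b p)
    have pp: "p permutes set xs" and IH: "of_int (sign p) = qeps (\<lambda>_ _. 1) (map p xs)"
      using swap by blast+
    have perm: "permutation p" using pp permutes_imp_permutation by blast
    have "distinct (map p xs)"
      using d permutes_inj_on[OF pp] by (simp add: distinct_map)
    moreover have "set (map p xs) = set xs" using permutes_image[OF pp] by simp
    ultimately have "qeps (\<lambda>_ _. 1) (map (Transposition.transpose a b) (map p xs)) = - qeps (\<lambda>_ _. 1) (map p xs)"
      using swap by (intro qeps_one_transpose) auto
    moreover have "sign (Transposition.transpose a b \<circ> p) = - sign p"
      using \<open>a \<noteq> b\<close> by (subst sign_compose) (simp_all add: perm permutation_swap_id sign_swap_id)
    ultimately show ?case by (simp only: map_map IH of_int_minus)
  qed
qed

text \<open>A permutation is determined by its values on \<open>xs\<close>, and both sets have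
  \<open>fact (card (set xs))\<close> elements, so injectivity implies surjectivity.\<close>

lemma bij_betw_permutes_lists:
  assumes "distinct xs"
  shows "bij_betw (\<lambda>\<sigma>. map \<sigma> xs) {\<sigma>. \<sigma> permutes set xs} {js. distinct js \<and> set js = set xs}"
proof -
  have inj: "inj_on (\<lambda>\<sigma>. map \<sigma> xs) {\<sigma>. \<sigma> permutes set xs}"
  proof (rule inj_onI)
    fix \<sigma> \<tau> assume *: "\<sigma> \<in> {\<sigma>. \<sigma> permutes set xs}" "\<tau> \<in> {\<sigma>. \<sigma> permutes set xs}" "map \<sigma> xs = map \<tau> xs"
    show "\<sigma> = \<tau>"
    proof
      fix x show "\<sigma> x = \<tau> x"
        using * by (cases "x \<in> set xs") (auto simp: permutes_not_in)
    qed
  qed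
  have sub: "(\<lambda>\<sigma>. map \<sigma> xs) ` {\<sigma>. \<sigma> permutes set xs} \<subseteq> {js. distinct js \<and> set js = set xs}"
    using assms by (auto simp: distinct_map permutes_inj_on permutes_image simp flip: image_set)
  have "{js. distinct js \<and> set js = set xs} = permutations_of_set (set xs)"
    by (auto simp: permutations_of_set_def)
  then have "card {js. distinct js \<and> set js = set xs} = fact (card (set xs))" "finite {js. distinct js \<and> set js = set xs}"
    by simp_all
  moreover have "card ((\<lambda>\<sigma>. map \<sigma> xs) ` {\<sigma>. \<sigma> permutes set xs}) = fact (card (set xs))"
    using inj by (simp add: card_image card_permutations)
  ultimately have "(\<lambda>\<sigma>. map \<sigma> xs) ` {\<sigma>. \<sigma> permutes set xs} = {js. distinct js \<and> set js = set xs}"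
    using sub by (intro card_subset_eq) auto
  with inj show ?thesis by (simp add: bij_betw_def)
qed

subsection \<open>The phases of the quantum group\<close>

lemma mu_cnj: "\<mu> \<theta> * cnj (\<mu> \<theta>) = 1"
proof -
  have "cmod (\<mu> \<theta>) = 1" by (simp add: \<mu>_def)
  then show ?thesis by (simp add: complex_norm_square[symmetric])
qed

lemma mu_simps [simp]:
  "\<mu> \<theta> * cnj (\<mu> \<theta>) = 1" "cnj (\<mu> \<theta>) * \<mu> \<theta> = 1"
  "\<mu> \<theta> * (cnj (\<mu> \<theta>) * x) = x" "cnj (\<mu> \<theta>) * (\<mu> \<theta> * x) = x"
  using mu_cnj[of \<theta>] by (simp_all only: mult.commute[of "cnj (\<mu> \<theta>)" "\<mu> \<theta>"] mult.assoc[symmetric] mult_1)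

lemma index_cases: "i \<in> {1..4} \<longleftrightarrow> i = 1 \<or> i = 2 \<or> i = 3 \<or> i = (4::nat)"
  by auto

lemma eta_phase:
  assumes "i \<in> {1..4}" "j \<in> {1..4}"
  shows "\<eta> \<theta> i j * \<eta> \<theta> j i = 1"
  using assms unfolding index_cases by (elim disjE) (simp_all add: \<eta>_def)

lemma eta_diag: "i \<in> {1..4} \<Longrightarrow> \<eta> \<theta> i i = 1"
  unfolding index_cases by (elim disjE) (simp_all add: \<eta>_def)

text \<open>A rotation of a list of length four depends on \<open>n\<close> modulo \<open>4\<close>
  only; this makes the conditions in \<open>det_phase\<close> accessible to simplification.\<close>

lemma rotate_4:
  "(\<exists>n. js = rotate n [a, b, c, d]) \<longleftrightarrow>
    js = [a, b, c, d] \<or> js = [b, c, d, a] \<or> js = [c, d, a, b] \<or> js = [d, a, b, c]"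
proof -
  have *: "rotate 0 [a, b, c, d] = [a, b, c, d]" "rotate 1 [a, b, c, d] = [b, c, d, a]"
    "rotate 2 [a, b, c, d] = [c, d, a, b]" "rotate 3 [a, b, c, d] = [d, a, b, c]"
    by (simp_all add: numeral_2_eq_2 numeral_3_eq_3)
  show ?thesis
  proof
    assume "\<exists>n. js = rotate n [a, b, c, d]"
    then obtain n where "js = rotate n [a, b, c, d]" by blast
    then have js: "js = rotate (n mod 4) [a, b, c, d]"
      using rotate_conv_mod[of n "[a, b, c, d]"] by simp
    have "n mod 4 < 4" by simp
    then consider "n mod 4 = 0" | "n mod 4 = 1" | "n mod 4 = 2" | "n mod 4 = 3" by linarith
    then show "js = [a, b, c, d] \<or> js = [b, c, d, a] \<or> js = [c, d, a, b] \<or> js = [d, a, b, c]"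
      by cases (simp_all only: js * simp_thms)
  qed (use *[symmetric] in blast)
qed

text \<open>The prescribed phases are the products of \<open>\<eta>\<close> over the inverted pairs.
  Pairs inside \<open>{1, 2}\<close> or \<open>{3, 4}\<close> have phase \<open>1\<close>; the
  phases of the mixed pairs cancel for every permutation outside the eight listed rotations. The
  proof is a check of all arrangements.\<close>

lemma det_phase_qeps:
  assumes "distinct js" "set js = {1..4}"
  shows "qeps (\<lambda>_ _. 1) js * det_phase \<theta> js = qeps (\<eta> \<theta>) js"
proof -
  have "length js = 4" using distinct_card[OF assms(1)] assms(2) by simp
  then obtain a b c d where js: "js = [a, b, c, d]"
    by (auto simp: length_Suc_conv eval_nat_numeral)
  have "a \<in> {1..4}" "b \<in> {1..4}" "c \<in> {1..4}" "d \<in> {1..4}"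
    using assms(2) unfolding js by auto
  then show ?thesis
    using assms(1) unfolding js index_cases
    by (elim disjE) (simp_all add: det_phase_def rotate_4 pair_sign_def \<eta>_def)
qed

lemma upt_4: "[1..<Suc 4] = [1, 2, 3, 4]"
  by (simp add: eval_nat_numeral)

text \<open>The bridge between sums over all words, which suit exchanges and splitting, and the sums
  over permutations in which determinant and complements are defined.\<close>

lemma (in complex_algebra) finsum_words_permutes:
  assumes "distinct xs" "set xs \<subseteq> {1..n}" "length xs = m"
    and "\<And>js. js \<in> words n m \<Longrightarrow> f js \<in> carrier A"
    and "\<And>js. js \<in> words n m \<Longrightarrow> \<not> (distinct js \<and> set js = set xs) \<Longrightarrow> f js = \<zero>"
  shows "(\<Oplus>js\<in>words n m. f js) = (\<Oplus>\<sigma>\<in>{\<sigma>. \<sigma> permutes set xs}. f (map \<sigma> xs))"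
proof -
  let ?D = "{js. distinct js \<and> set js = set xs}"
  have sub: "?D \<subseteq> words n m"
    using assms(1-3) by (auto simp: words_def distinct_card[symmetric])
  have "(\<Oplus>js\<in>words n m. f js) = (\<Oplus>js\<in>?D. f js)"
    by (rule add.finprod_mono_neutral_cong_right[OF finite_words sub]) (use assms(4,5) in auto)
  also have "\<dots> = (\<Oplus>js\<in>(\<lambda>\<sigma>. map \<sigma> xs) ` {\<sigma>. \<sigma> permutes set xs}. f js)"
    using bij_betw_permutes_lists[OF assms(1)] by (simp only: bij_betw_def)
  also have "\<dots> = (\<Oplus>\<sigma>\<in>{\<sigma>. \<sigma> permutes set xs}. f (map \<sigma> xs))"
    using bij_betw_permutes_lists[OF assms(1)] sub assms(4)
    by (intro finsum_reindex) (auto simp: bij_betw_def)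
  finally show ?thesis .
qed

lemma quantum_det_eq:
  assumes "complex_algebra B" "\<And>i j. i \<in> {1..4} \<Longrightarrow> j \<in> {1..4} \<Longrightarrow> M i j \<in> carrier B"
  shows "quantum_det \<theta> B M = qdet B 4 (\<eta> \<theta>) M"
proof -
  interpret complex_algebra B by fact
  have set4: "set [1, 2, 3, 4] = {1..4::nat}" by auto
  have w4: "[1, 2, 3, 4] \<in> words 4 4" by (simp add: words_def)
  have wc: "word B M [1, 2, 3, 4] js \<in> carrier B" if "js \<in> words 4 4" for js
    by (rule word_closed[OF _ w4 that]) (rule assms(2))
  have dist: "distinct js \<and> set js = set [1, 2, 3, 4]" if "js \<in> words 4 4" "distinct js" for js
  proof -
    have "card (set js) = card {1..4::nat}"
      using wordsD[OF that(1)] distinct_card[OF that(2)] by simp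
    then show ?thesis
      using that wordsD[OF that(1)] unfolding set4 by (metis card_subset_eq finite_atLeastAtMost)
  qed
  have "qdet B 4 (\<eta> \<theta>) M = (\<Oplus>\<^bsub>B\<^esub>js\<in>words 4 4. qeps (\<eta> \<theta>) js \<odot>\<^bsub>B\<^esub> word B M [1, 2, 3, 4] js)"
    unfolding qminor_def upt_4 by (simp only: wordsD(1)[OF w4])
  also have "\<dots> = (\<Oplus>\<^bsub>B\<^esub>\<sigma>\<in>{\<sigma>. \<sigma> permutes set [1, 2, 3, 4]}.
      qeps (\<eta> \<theta>) (map \<sigma> [1, 2, 3, 4]) \<odot>\<^bsub>B\<^esub> word B M [1, 2, 3, 4] (map \<sigma> [1, 2, 3, 4]))"
  proof (rule finsum_words_permutes)
    show "qeps (\<eta> \<theta>) js \<odot>\<^bsub>B\<^esub> word B M [1, 2, 3, 4] js \<in> carrier B" if "js \<in> words 4 4" for js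
      using wc[OF that] by blast
    show "qeps (\<eta> \<theta>) js \<odot>\<^bsub>B\<^esub> word B M [1, 2, 3, 4] js = \<zero>\<^bsub>B\<^esub>"
      if "js \<in> words 4 4" "\<not> (distinct js \<and> set js = set [1, 2, 3, 4])" for js
    proof -
      have "\<not> distinct js" using dist that by blast
      from qeps_not_distinct[OF this] show ?thesis
        using smult_zero_left[OF wc[OF that(1)]] by (simp only:)
    qed
  qed auto
  also have "\<dots> = quantum_det \<theta> B M"
    unfolding quantum_det_def set4
  proof (rule finsum_eqI)
    fix \<sigma> :: "nat \<Rightarrow> nat" assume "\<sigma> \<in> {\<sigma>. \<sigma> permutes {1..4}}"
    then have p: "\<sigma> permutes set [1, 2, 3, 4]" by (simp only: set4 mem_Collect_eq)
    have im: "distinct (map \<sigma> [1, 2, 3, 4])" "set (map \<sigma> [1, 2, 3, 4]) = {1..4}"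
      using permutes_inj_on[OF p] permutes_image[OF p] unfolding distinct_map set_map set4 by simp_all
    have c: "\<sigma> k \<in> {1..4}" if "k \<in> {1..4}" for k
      using permutes_in_image[OF p] that unfolding set4 by blast
    have Mc: "M k (\<sigma> k) \<in> carrier B" if "k \<in> {1..4}" for k
      using assms(2) c that by blast
    have "qeps (\<eta> \<theta>) (map \<sigma> [1, 2, 3, 4]) = of_int (sign \<sigma>) * det_phase \<theta> [\<sigma> 1, \<sigma> 2, \<sigma> 3, \<sigma> 4]"
      using det_phase_qeps[OF im, of \<theta>] sign_qeps[OF _ p] by simp
    moreover have "word B M [1, 2, 3, 4] (map \<sigma> [1, 2, 3, 4]) =
        M 1 (\<sigma> 1) \<otimes>\<^bsub>B\<^esub> M 2 (\<sigma> 2) \<otimes>\<^bsub>B\<^esub> M 3 (\<sigma> 3) \<otimes>\<^bsub>B\<^esub> M 4 (\<sigma> 4)"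
      using Mc[of 1] Mc[of 2] Mc[of 3] Mc[of 4] by (simp add: m_assoc)
    ultimately show "qeps (\<eta> \<theta>) (map \<sigma> [1, 2, 3, 4]) \<odot>\<^bsub>B\<^esub> word B M [1, 2, 3, 4] (map \<sigma> [1, 2, 3, 4]) =
        (of_int (sign \<sigma>) * det_phase \<theta> [\<sigma> 1, \<sigma> 2, \<sigma> 3, \<sigma> 4]) \<odot>\<^bsub>B\<^esub>
        (M 1 (\<sigma> 1) \<otimes>\<^bsub>B\<^esub> M 2 (\<sigma> 2) \<otimes>\<^bsub>B\<^esub> M 3 (\<sigma> 3) \<otimes>\<^bsub>B\<^esub> M 4 (\<sigma> 4))"
      by simp
    show "(of_int (sign \<sigma>) * det_phase \<theta> [\<sigma> 1, \<sigma> 2, \<sigma> 3, \<sigma> 4]) \<odot>\<^bsub>B\<^esub>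
        (M 1 (\<sigma> 1) \<otimes>\<^bsub>B\<^esub> M 2 (\<sigma> 2) \<otimes>\<^bsub>B\<^esub> M 3 (\<sigma> 3) \<otimes>\<^bsub>B\<^esub> M 4 (\<sigma> 4)) \<in> carrier B"
      using Mc[of 1] Mc[of 2] Mc[of 3] Mc[of 4] by simp
  qed
  finally show ?thesis by simp
qed

section \<open>Algebraic complements as entries of the inverse matrix\<close>

lemma qeps_move:
  assumes "\<And>y. y \<in> set us \<Longrightarrow> h y l * h l y = 1"
  shows "qeps h (l # us @ vs) = (\<Prod>y\<leftarrow>us. - h y l) * qeps h (us @ l # vs)"
  using assms
proof (induction us)
  case (Cons u us)
  have "qeps h (l # (u # us) @ vs) = - h u l * qeps h (u # l # us @ vs)"
    using qeps_swap[of h u l "[]" "us @ vs"] Cons.prems by simp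
  also have "qeps h (u # l # us @ vs) = (\<Prod>y\<leftarrow>us @ l # vs. pair_sign h u y) * qeps h (l # us @ vs)"
    by (simp add: mult_ac)
  also have "qeps h (l # us @ vs) = (\<Prod>y\<leftarrow>us. - h y l) * qeps h (us @ l # vs)"
    using Cons by simp
  finally show ?case by (simp add: mult_ac)
qed simp

text \<open>The complement inserts \<open>l\<close> as the \<open>i\<close>-th letter of the column
  word, the inverse matrix puts it in front. Moving it there crosses \<open>i - 1\<close> letters
  \<open>y\<close>, each contributing a sign and a phase \<open>\<eta> \<theta> y l\<close>, which
  accounts for the product of phases in the complement. The remaining signs compare permutations of
  three columns with arrangements of all four.\<close>

lemma complement_coefficient:
  assumes i: "i \<in> {1..4}" and l: "l \<in> {1..4}" and js: "distinct js" "set js = {1..4} - {l}"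
  shows "(-1) ^ (l + i) * (qeps (\<lambda>_ _. 1) js * det_phase \<theta> (take (i - 1) js @ l # drop (i - 1) js)
      * (\<Prod>m<i - 1. \<eta> \<theta> (js ! m) l)) = inverse (qeps (\<eta> \<theta>) (i # rest 4 i)) * qeps (\<eta> \<theta>) (l # js)"
proof -
  let ?E = "qeps (\<lambda>_ _. 1)"
  define us where "us = take (i - 1) js"
  define vs where "vs = drop (i - 1) js"
  have js': "js = us @ vs" by (simp add: us_def vs_def)
  have "length js = 3" using distinct_card[OF js(1)] js(2) l by simp
  then have len: "length us = i - 1" using i by (auto simp: us_def min_def)
  have "set (us @ l # vs) = {1..4}" "distinct (us @ l # vs)"
    using js l unfolding js' by auto
  then have full: "?E (us @ l # vs) * det_phase \<theta> (us @ l # vs) = qeps (\<eta> \<theta>) (us @ l # vs)"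
    by (intro det_phase_qeps)
  have rest: "rest 4 i = filter (\<lambda>k. k \<noteq> i) [1, 2, 3, 4]"
    unfolding rest_def upt_4 ..
  \<comment> \<open>Only the sign is left, because the phases in each column cancel:
    \<open>\<eta> 1 3\<close> with \<open>\<eta> 2 3\<close>, and \<open>\<eta> 1 4\<close> with
    \<open>\<eta> 2 4\<close>.\<close>
  have inv: "inverse (qeps (\<eta> \<theta>) (i # rest 4 i)) = (-1) ^ (i - 1)"
    unfolding rest using i unfolding index_cases
    by (elim disjE) (simp_all add: pair_sign_def \<eta>_def)
  have "\<eta> \<theta> y l * \<eta> \<theta> l y = 1" if "y \<in> set us" for y
  proof -
    have "set us \<subseteq> set js" unfolding js' by simp
    then have "y \<in> {1..4}" using that js(2) by blast
    then show ?thesis using l by (rule eta_phase)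
  qed
  then have move: "qeps (\<eta> \<theta>) (l # js) = (\<Prod>y\<leftarrow>us. - \<eta> \<theta> y l) * qeps (\<eta> \<theta>) (us @ l # vs)"
    unfolding js' by (rule qeps_move)
  have "(\<Prod>y\<leftarrow>us. - \<eta> \<theta> y l) = (\<Prod>m<length us. - \<eta> \<theta> (us ! m) l)"
    by (induction us rule: rev_induct) (simp_all add: nth_append cong: prod.cong_simp)
  also have "\<dots> = (-1) ^ (i - 1) * (\<Prod>m<i - 1. \<eta> \<theta> (us ! m) l)"
    by (simp add: len prod_uminus)
  also have "(\<Prod>m<i - 1. \<eta> \<theta> (us ! m) l) = (\<Prod>m<i - 1. \<eta> \<theta> (js ! m) l)"
    by (simp add: us_def)
  finally have phases: "(\<Prod>y\<leftarrow>us. - \<eta> \<theta> y l) = (-1) ^ (i - 1) * (\<Prod>m<i - 1. \<eta> \<theta> (js ! m) l)" .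
  have "?E (l # js) = (-1) ^ (i - 1) * ?E (us @ l # vs)"
    using qeps_one_move[of "[]" l us vs] by (simp add: js' len)
  \<comment> \<open>In front of the word, \<open>l\<close> is inverted with the \<open>l - 1\<close>
    smaller columns.\<close>
  moreover have "?E (l # js) = (-1) ^ (l - 1) * ?E js"
  proof -
    have "(\<Prod>y\<leftarrow>js. pair_sign (\<lambda>_ _. 1) l y) = (\<Prod>y\<in>{1..4} - {l}. pair_sign (\<lambda>_ _. 1) l y)"
      using js by (metis prod.distinct_set_conv_list)
    also have "{1..4} = {1, 2, 3, 4::nat}" by auto
    also have "(\<Prod>y\<in>{1, 2, 3, 4} - {l}. pair_sign (\<lambda>_ _. 1) l y) = (-1) ^ (l - 1)"
      using l unfolding index_cases by (elim disjE) (simp_all add: pair_sign_def insert_Diff_if)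
    finally show ?thesis by simp
  qed
  ultimately have "(-1) ^ (l - 1) * ?E js = (-1) ^ (i - 1) * ?E (us @ l # vs)" by simp
  then have "(-1) ^ (l - 1) * ((-1) ^ (l - 1) * ?E js) = (-1) ^ (l - 1) * ((-1) ^ (i - 1) * ?E (us @ l # vs))"
    by simp
  then have E: "?E js = (-1) ^ (l - 1) * ((-1) ^ (i - 1) * ?E (us @ l # vs))"
    by (simp add: mult.assoc[symmetric] flip: power_add)
  \<comment> \<open>The exponents add up to \<open>2 * (l + i - 1)\<close>.\<close>
  have sgn: "(-1) ^ (l + i) * ((-1) ^ (l - 1) * (-1) ^ (i - 1)) = (1 :: complex)"
    using i l unfolding index_cases by (elim disjE) simp_all
  have "(-1) ^ (l + i) * (?E js * det_phase \<theta> (us @ l # vs) * (\<Prod>m<i - 1. \<eta> \<theta> (js ! m) l)) =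
      ((-1) ^ (l + i) * ((-1) ^ (l - 1) * (-1) ^ (i - 1))) *
      (?E (us @ l # vs) * det_phase \<theta> (us @ l # vs)) * (\<Prod>m<i - 1. \<eta> \<theta> (js ! m) l)"
    unfolding E by (simp only: mult_ac)
  also have "\<dots> = (-1) ^ (i - 1) * ((-1) ^ (i - 1) * (\<Prod>m<i - 1. \<eta> \<theta> (js ! m) l) * qeps (\<eta> \<theta>) (us @ l # vs))"
    unfolding sgn full by (simp add: mult_ac flip: mult.assoc[of "(-1) ^ _" "(-1) ^ _"] power_add)
  also have "\<dots> = inverse (qeps (\<eta> \<theta>) (i # rest 4 i)) * qeps (\<eta> \<theta>) (l # js)"
    unfolding inv move phases ..
  finally show ?thesis unfolding us_def vs_def .
qed

text \<open>Both sides are sums over the permutations of the columns other than \<open>l\<close>,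
  and agree term by term. The complement with indices \<open>i l\<close> is the inverse entry with
  indices \<open>l i\<close>, which explains the exchange of indices in the antipode.\<close>

lemma algebraic_complement_eq:
  assumes "complex_algebra B" "\<And>i j. i \<in> {1..4} \<Longrightarrow> j \<in> {1..4} \<Longrightarrow> M i j \<in> carrier B"
    and il: "i \<in> {1..4}" "l \<in> {1..4}"
  shows "(-1) ^ (l + i) \<odot>\<^bsub>B\<^esub> algebraic_complement \<theta> B M i l = cofactor_inverse B 4 (\<eta> \<theta>) M l i"
proof -
  interpret complex_algebra B by fact
  define xs where "xs = filter (\<lambda>k. k \<noteq> l) [1, 2, 3, 4::nat]"
  have rest: "rest 4 i = filter (\<lambda>k. k \<noteq> i) [1, 2, 3, 4]"
    unfolding rest_def upt_4 ..
  have xs: "distinct xs" "set xs = {1..4} - {l}" "sorted_wrt (<) xs"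
    unfolding xs_def by (auto intro!: sorted_wrt_filter)
  have len: "length xs = 3" using distinct_card[OF xs(1)] xs(2) il by simp
  have rw: "rest 4 i \<in> words 4 3" using rest_in_words[OF il(1)] by simp
  have wc: "word B M (rest 4 i) js \<in> carrier B" if "js \<in> words 4 3" for js
    by (rule word_closed[OF _ rw that]) (rule assms(2))
  have dist: "distinct js \<and> set js = set xs" if "js \<in> words 4 3" "distinct (l # js)" for js
  proof -
    have "set js \<subseteq> {1..4} - {l}" using that wordsD(2) by fastforce
    moreover have "card (set js) = card ({1..4} - {l})"
      using wordsD(1)[OF that(1)] distinct_card[of js] that(2) il by simp
    ultimately have "set js = {1..4} - {l}" by (intro card_subset_eq) simp_all
    then show ?thesis using that(2) xs(2) by simp
  qed
  let ?c = "inverse (qeps (\<eta> \<theta>) (i # rest 4 i))"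
  have "cofactor_inverse B 4 (\<eta> \<theta>) M l i =
      ?c \<odot>\<^bsub>B\<^esub> (\<Oplus>\<^bsub>B\<^esub>js\<in>words 4 3. qeps (\<eta> \<theta>) (l # js) \<odot>\<^bsub>B\<^esub> word B M (rest 4 i) js)"
    unfolding cofactor_inverse_def by simp
  also have "(\<Oplus>\<^bsub>B\<^esub>js\<in>words 4 3. qeps (\<eta> \<theta>) (l # js) \<odot>\<^bsub>B\<^esub> word B M (rest 4 i) js) =
      (\<Oplus>\<^bsub>B\<^esub>\<sigma>\<in>{\<sigma>. \<sigma> permutes set xs}. qeps (\<eta> \<theta>) (l # map \<sigma> xs) \<odot>\<^bsub>B\<^esub> word B M (rest 4 i) (map \<sigma> xs))"
  proof (rule finsum_words_permutes[OF xs(1) _ len])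
    show "set xs \<subseteq> {1..4}" using xs(2) by blast
    show "qeps (\<eta> \<theta>) (l # js) \<odot>\<^bsub>B\<^esub> word B M (rest 4 i) js \<in> carrier B" if "js \<in> words 4 3" for js
      using wc[OF that] by blast
    show "qeps (\<eta> \<theta>) (l # js) \<odot>\<^bsub>B\<^esub> word B M (rest 4 i) js = \<zero>\<^bsub>B\<^esub>"
      if "js \<in> words 4 3" "\<not> (distinct js \<and> set js = set xs)" for js
    proof -
      have "\<not> distinct (l # js)" using dist that by blast
      from qeps_not_distinct[OF this] show ?thesis
        using smult_zero_left[OF wc[OF that(1)]] by (simp only:)
    qed
  qed
  also have "?c \<odot>\<^bsub>B\<^esub> \<dots> = (\<Oplus>\<^bsub>B\<^esub>\<sigma>\<in>{\<sigma>. \<sigma> permutes set xs}.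
      ?c \<odot>\<^bsub>B\<^esub> (qeps (\<eta> \<theta>) (l # map \<sigma> xs) \<odot>\<^bsub>B\<^esub> word B M (rest 4 i) (map \<sigma> xs)))"
  proof (rule finsum_smult)
    fix \<sigma> assume "\<sigma> \<in> {\<sigma>. \<sigma> permutes set xs}"
    then have "map \<sigma> xs \<in> words 4 3"
      using permutes_image[of \<sigma> "set xs"] xs(2) len by (auto simp: words_def simp flip: image_set)
    then show "qeps (\<eta> \<theta>) (l # map \<sigma> xs) \<odot>\<^bsub>B\<^esub> word B M (rest 4 i) (map \<sigma> xs) \<in> carrier B"
      using wc by blast
  qed
  finally have cof: "cofactor_inverse B 4 (\<eta> \<theta>) M l i = \<dots>" .
  let ?f = "\<lambda>\<sigma>. (of_int (sign \<sigma>) * det_phase \<theta> (take (i - 1) (map \<sigma> xs) @ l # drop (i - 1) (map \<sigma> xs))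
      * (\<Prod>m<i - 1. \<eta> \<theta> (map \<sigma> xs ! m) l)) \<odot>\<^bsub>B\<^esub> word B M (rest 4 i) (map \<sigma> xs)"
  have mw: "map \<sigma> xs \<in> words 4 3" "distinct (map \<sigma> xs)" "set (map \<sigma> xs) = {1..4} - {l}"
    if "\<sigma> permutes set xs" for \<sigma>
  proof -
    show d: "distinct (map \<sigma> xs)" using xs(1) permutes_inj_on[OF that] by (simp add: distinct_map)
    show s: "set (map \<sigma> xs) = {1..4} - {l}" using permutes_image[OF that] xs(2) by simp
    then show "map \<sigma> xs \<in> words 4 3" using len unfolding words_def by simp
  qed
  have "algebraic_complement \<theta> B M i l = (\<Oplus>\<^bsub>B\<^esub>\<sigma>\<in>{\<sigma>. \<sigma> permutes set xs}. ?f \<sigma>)"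
    unfolding algebraic_complement_def Let_def word_def rest xs(2) unfolding xs_def ..
  then have "(-1) ^ (l + i) \<odot>\<^bsub>B\<^esub> algebraic_complement \<theta> B M i l =
      (\<Oplus>\<^bsub>B\<^esub>\<sigma>\<in>{\<sigma>. \<sigma> permutes set xs}. (-1) ^ (l + i) \<odot>\<^bsub>B\<^esub> ?f \<sigma>)"
    by (simp only:) (rule finsum_smult, use wc[OF mw(1)] in blast)
  also have "\<dots> = cofactor_inverse B 4 (\<eta> \<theta>) M l i"
    unfolding cof
  proof (rule finsum_eqI)
    fix \<sigma> assume "\<sigma> \<in> {\<sigma>. \<sigma> permutes set xs}"
    then have p: "\<sigma> permutes set xs" by simp
    note c = wc[OF mw(1)[OF p]]
    show "?c \<odot>\<^bsub>B\<^esub> (qeps (\<eta> \<theta>) (l # map \<sigma> xs) \<odot>\<^bsub>B\<^esub> word B M (rest 4 i) (map \<sigma> xs)) \<in> carrier B"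
      using c by blast
    show "(-1) ^ (l + i) \<odot>\<^bsub>B\<^esub> ?f \<sigma> =
        ?c \<odot>\<^bsub>B\<^esub> (qeps (\<eta> \<theta>) (l # map \<sigma> xs) \<odot>\<^bsub>B\<^esub> word B M (rest 4 i) (map \<sigma> xs))"
      using complement_coefficient[OF il mw(2,3)[OF p], of \<theta>, folded sign_qeps[OF xs(3) p]] c
      by (simp only: smult_smult)
  qed
  finally show ?thesis .
qed

subsection \<open>Images of quantum matrices\<close>

lemma hom_word:
  assumes "f \<in> algebra_homs A B" "complex_algebra A"
    and "\<And>i j. i \<in> {1..n} \<Longrightarrow> j \<in> {1..n} \<Longrightarrow> M i j \<in> carrier A" "is \<in> words n m" "js \<in> words n m"
  shows "f (word A M is js) = word B (\<lambda>i j. f (M i j)) is js"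
proof -
  interpret A: complex_algebra A by fact
  have "length is = length js" "set is \<subseteq> {1..n}" "set js \<subseteq> {1..n}"
    using assms(4,5) by (auto simp: words_def)
  then show ?thesis
  proof (induction "is" js rule: list_induct2)
    case (Cons i "is" j js)
    have "word A M is js \<in> carrier A"
      using Cons by (intro A.word_closed[OF assms(3), where m = "length is"]) (auto simp: words_def)
    then show ?case using Cons assms(3)[of i j] by (simp add: algebra_homsD[OF assms(1)])
  qed (simp add: algebra_homsD[OF assms(1)])
qed

lemma (in quantum_matrix) hom_qminor:
  assumes f: "f \<in> algebra_homs A B" and B: "complex_algebra B" and "is \<in> words n m"
  shows "f (qminor A n h M is) = qminor B n h (\<lambda>i j. f (M i j)) is"
  unfolding qminor_def
proof (rule linear_maps_finsum_eq[OF algebra_homsD(1)[OF f] complex_algebra_axioms B])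
  fix js assume "js \<in> words n (length is)"
  then have js: "js \<in> words n m" using wordsD(1)[OF assms(3)] by simp
  note w = word_in[OF assms(3) js]
  show "qeps h js \<odot> word A M is js \<in> carrier A" using w by blast
  show "f (qeps h js \<odot> word A M is js) = qeps h js \<odot>\<^bsub>B\<^esub> word B (\<lambda>i j. f (M i j)) is js"
    using hom_word[OF f complex_algebra_axioms entry assms(3) js] w by (simp add: algebra_homsD(4)[OF f])
qed

lemma (in quantum_matrix) hom_quantum_matrix:
  assumes f: "f \<in> algebra_homs A B" and B: "complex_algebra B"
  shows "quantum_matrix B n h (\<lambda>i j. f (M i j))"
proof (intro quantum_matrix.intro quantum_matrix_axioms.intro B phase phase_diag algebra_homsD(2)[OF f] entry)
  fix i j k l assume "i \<in> {1..n}" "j \<in> {1..n}" "k \<in> {1..n}" "l \<in> {1..n}"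
  note e = entry[OF this(1,2)] entry[OF this(3,4)] and r = rel[OF this]
  have "f (M i j \<otimes> M k l) = f ((h k i * h j l) \<odot> (M k l \<otimes> M i j))" by (simp only: r)
  then show "f (M i j) \<otimes>\<^bsub>B\<^esub> f (M k l) = (h k i * h j l) \<odot>\<^bsub>B\<^esub> (f (M k l) \<otimes>\<^bsub>B\<^esub> f (M i j))"
    using e by (simp add: algebra_homsD[OF f])
qed

lemma (in quantum_matrix) hom_qdet:
  assumes "f \<in> algebra_homs A B" "complex_algebra B"
  shows "f (qdet A n h M) = qdet B n h (\<lambda>i j. f (M i j))"
  by (rule hom_qminor[OF assms upt_in_words])

section \<open>The free *-algebra\<close>

lemma module_extend_simps [simp]:
  "carrier (module.extend B m) = carrier B" "monoid.mult (module.extend B m) = monoid.mult B"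
  "\<one>\<^bsub>module.extend B m\<^esub> = \<one>\<^bsub>B\<^esub>" "\<zero>\<^bsub>module.extend B m\<^esub> = \<zero>\<^bsub>B\<^esub>"
  "add (module.extend B m) = add B" "module.smult (module.extend B m) = module.smult B"
  by (simp_all add: module.extend_def)

lemma complex_algebra_extend:
  assumes "complex_algebra B"
  shows "complex_algebra (module.extend B m)"
proof -
  interpret complex_algebra B by fact
  show ?thesis
    by (rule complex_algebraI)
      (simp_all add: M.a_assoc smult_minus_one M.l_neg m_assoc l_distr r_distr smult_add_left
        smult_add_right smult_smult smult_mult_left smult_mult_right, simp add: a_comm)
qed

lemma algebra_homs_extend:
  "algebra_homs (module.extend A m) B = algebra_homs A B"
  "algebra_homs A' (module.extend A m) = algebra_homs A' A"
  by (simp_all add: algebra_homs_def linear_maps_def ring_hom_def)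

lemma word_monoid: "monoid word_monoid"
  by (rule monoidI) (simp_all add: word_monoid_def)

lemma free_star_algebra: "complex_algebra free_star_algebra"
  unfolding free_star_algebra_def
  by (intro complex_algebra_extend monoid.monoid_algebra word_monoid)

interpretation free: complex_algebra free_star_algebra
  by (rule free_star_algebra)

lemma free_carrier [simp]: "carrier free_star_algebra = UNIV"
  by (simp add: free_star_algebra_def monoid_algebra_def word_monoid_def)

lemma free_zero: "\<zero>\<^bsub>free_star_algebra\<^esub> = 0"
  by (simp add: free_star_algebra_def monoid_algebra_simps)

lemma free_simps:
  "p \<oplus>\<^bsub>free_star_algebra\<^esub> q = p + q"
  "c \<odot>\<^bsub>free_star_algebra\<^esub> p = Poly_Mapping.map ((*) c) p"
  "Poly_Mapping.single v a \<otimes>\<^bsub>free_star_algebra\<^esub> Poly_Mapping.single w b = Poly_Mapping.single (v @ w) (a * b)"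
  by (simp_all add: free_star_algebra_def monoid_algebra_simps monoid_algebra_single)
    (simp add: word_monoid_def)

lemma free_induct [case_names zero single add]:
  fixes p :: "('g \<times> bool) list \<Rightarrow>\<^sub>0 complex"
  assumes "P 0" "\<And>w c. P (Poly_Mapping.single w c)" "\<And>p q. P p \<Longrightarrow> P q \<Longrightarrow> P (p + q)"
  shows "P p"
  by (rule poly_mapping_keys_induct[of p UNIV]) (use assms in auto)

abbreviation free_star :: "(('g \<times> bool) list \<Rightarrow>\<^sub>0 complex) \<Rightarrow> ('g \<times> bool) list \<Rightarrow>\<^sub>0 complex"
  where "free_star \<equiv> star free_star_algebra"

lemma free_star_eq:
  "free_star p = (\<Sum>w\<in>Poly_Mapping.keys p. Poly_Mapping.single (word_star w) (cnj (Poly_Mapping.lookup p w)))"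
  by (simp add: free_star_algebra_def module.extend_def star_algebra.fields_def)

lemma free_star_zero: "free_star 0 = 0"
  by (simp add: free_star_eq)

lemma free_star_single: "free_star (Poly_Mapping.single w c) = Poly_Mapping.single (word_star w) (cnj c)"
  by (simp add: free_star_eq)

lemma free_star_add: "free_star (p + q) = free_star p + free_star q"
  unfolding free_star_eq by (rule setsum_keys_plus_distrib) (simp_all add: single_add)

lemma free_star_smult: "free_star (c \<odot>\<^bsub>free_star_algebra\<^esub> p) = cnj c \<odot>\<^bsub>free_star_algebra\<^esub> free_star p"
  by (induction p rule: free_induct)
    (simp_all add: free_simps map_times_zero map_times_single map_times_add free_star_zero
      free_star_single free_star_add)

lemma word_star_append: "word_star (v @ w) = word_star w @ word_star v"
  by (simp add: word_star_def)

lemma free_mult_simps: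
  "0 \<otimes>\<^bsub>free_star_algebra\<^esub> p = 0" "p \<otimes>\<^bsub>free_star_algebra\<^esub> 0 = 0"
  "(p + q) \<otimes>\<^bsub>free_star_algebra\<^esub> r = p \<otimes>\<^bsub>free_star_algebra\<^esub> r + q \<otimes>\<^bsub>free_star_algebra\<^esub> r"
  "r \<otimes>\<^bsub>free_star_algebra\<^esub> (p + q) = r \<otimes>\<^bsub>free_star_algebra\<^esub> p + r \<otimes>\<^bsub>free_star_algebra\<^esub> q"
  by (simp_all add: free_star_algebra_def monoid_algebra_mult_zero monoid_algebra_distrib)

lemma free_star_mult: "free_star (p \<otimes>\<^bsub>free_star_algebra\<^esub> q) = free_star q \<otimes>\<^bsub>free_star_algebra\<^esub> free_star p"
proof (induction p rule: free_induct)
  case (single v a)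
  show ?case
    by (induction q rule: free_induct)
      (simp_all add: free_mult_simps free_simps(3) free_star_zero free_star_single free_star_add
        word_star_append mult.commute)
qed (simp_all add: free_mult_simps free_star_zero free_star_add)

lemma free_star_diff:
  "free_star (p \<ominus>\<^bsub>free_star_algebra\<^esub> q) = free_star p \<ominus>\<^bsub>free_star_algebra\<^esub> free_star q"
proof -
  have *: "x \<ominus>\<^bsub>free_star_algebra\<^esub> y = x + ((-1) \<odot>\<^bsub>free_star_algebra\<^esub> y)"
    for x y :: "('a \<times> bool) list \<Rightarrow>\<^sub>0 complex"
    using free.smult_minus_one[of y] by (simp add: a_minus_def free_simps(1))
  show ?thesis unfolding * by (simp add: free_star_add free_star_smult)
qed

text \<open>The star is additive, conjugate linear and reverses products, so the elements whose star
  lies in the generated ideal form an ideal themselves. If it contains \<open>R\<close>, it contains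
  the generated ideal, which is then stable under the star.\<close>

lemma star_ideal_generated_eq:
  fixes R :: "(('g \<times> bool) list \<Rightarrow>\<^sub>0 complex) set"
  assumes "\<And>r. r \<in> R \<Longrightarrow> free_star r \<in> Idl\<^bsub>free_star_algebra\<^esub> R"
  shows "star_ideal_generated free_star_algebra R = Idl\<^bsub>free_star_algebra\<^esub> R"
proof
  let ?I = "Idl\<^bsub>free_star_algebra\<^esub> R"
  have id: "ideal ?I free_star_algebra" by (rule free.genideal_ideal) simp
  then interpret I: algebra_ideal free_star_algebra ?I
    by (intro algebra_ideal.intro free_star_algebra)
  have "ideal {x. free_star x \<in> ?I} free_star_algebra"
  proof (rule idealI)
    show "ring (free_star_algebra :: (('g \<times> bool) list \<Rightarrow>\<^sub>0 complex) star_algebra)"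
      by (rule free.ring_axioms)
    show "subgroup {x. free_star x \<in> ?I} (add_monoid free_star_algebra)"
    proof (rule free.add.subgroupI)
      have "0 \<in> {x. free_star x \<in> ?I}"
        using I.zero_closed by (simp add: free_star_zero free_zero)
      then show "{x. free_star x \<in> ?I} \<noteq> {}" by blast
      fix a assume "a \<in> {x. free_star x \<in> ?I}"
      then have "(-1) \<odot>\<^bsub>free_star_algebra\<^esub> free_star a \<in> ?I" using I.smult_ideal by blast
      then show "\<ominus>\<^bsub>free_star_algebra\<^esub> a \<in> {x. free_star x \<in> ?I}"
        by (simp add: free_star_smult flip: free.smult_minus_one)
    next
      fix a b assume "a \<in> {x. free_star x \<in> ?I}" "b \<in> {x. free_star x \<in> ?I}"
      then show "a \<oplus>\<^bsub>free_star_algebra\<^esub> b \<in> {x. free_star x \<in> ?I}"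
        using I.a_closed[of "free_star a" "free_star b"] by (simp add: free_simps(1) free_star_add)
    qed simp
  qed (simp_all add: free_star_mult I.I_l_closed I.I_r_closed)
  then have "?I \<subseteq> {x. free_star x \<in> ?I}"
    by (rule free.genideal_minimal) (use assms in auto)
  then have "free_star ` ?I \<subseteq> ?I" by auto
  then show "star_ideal_generated free_star_algebra R \<subseteq> ?I"
    using id free.genideal_self[of R] unfolding star_ideal_generated_def by auto
  show "?I \<subseteq> star_ideal_generated free_star_algebra R"
    unfolding star_ideal_generated_def
    by (intro Inter_greatest free.genideal_minimal) auto
qed

section \<open>The quantum group\<close>

lemma free_matrix_eq:
  "free_matrix 1 1 = Poly_Mapping.single [(a\<^sub>1, False)] 1" "free_matrix 1 2 = Poly_Mapping.single [(a\<^sub>2, False)] 1"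
  "free_matrix 1 3 = Poly_Mapping.single [(b\<^sub>1, False)] 1" "free_matrix 1 4 = Poly_Mapping.single [(b\<^sub>2, False)] 1"
  "free_matrix 2 1 = Poly_Mapping.single [(a\<^sub>2, True)] (-1)" "free_matrix 2 2 = Poly_Mapping.single [(a\<^sub>1, True)] 1"
  "free_matrix 2 3 = Poly_Mapping.single [(b\<^sub>2, True)] (-1)" "free_matrix 2 4 = Poly_Mapping.single [(b\<^sub>1, True)] 1"
  "free_matrix 3 1 = Poly_Mapping.single [(c\<^sub>1, False)] 1" "free_matrix 3 2 = Poly_Mapping.single [(c\<^sub>2, False)] 1"
  "free_matrix 3 3 = Poly_Mapping.single [(d\<^sub>1, False)] 1" "free_matrix 3 4 = Poly_Mapping.single [(d\<^sub>2, False)] 1"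
  "free_matrix 4 1 = Poly_Mapping.single [(c\<^sub>2, True)] (-1)" "free_matrix 4 2 = Poly_Mapping.single [(c\<^sub>1, True)] 1"
  "free_matrix 4 3 = Poly_Mapping.single [(d\<^sub>2, True)] (-1)" "free_matrix 4 4 = Poly_Mapping.single [(d\<^sub>1, True)] 1"
  by (simp_all add: free_matrix_def Let_def free_generator_def free_star_single word_star_def single_uminus)

text \<open>The involution exchanging \<open>1\<close> with \<open>2\<close> and \<open>3\<close>
  with \<open>4\<close>: it describes how the star acts within the two-by-two quaternionic
  blocks.\<close>

definition partner :: "nat \<Rightarrow> nat"
  where "partner i = (if odd i then i + 1 else i - 1)"

lemma partner_in: "i \<in> {1..4} \<Longrightarrow> partner i \<in> {1..4}"
  unfolding index_cases partner_def by (elim disjE) simp_all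

lemma partner_simps: "partner 1 = 2" "partner 2 = 1" "partner 3 = 4" "partner 4 = 3"
  by (simp_all add: partner_def)

lemma free_star_matrix:
  assumes "i \<in> {1..4}" "j \<in> {1..4}"
  shows "free_star (free_matrix i j) = (-1) ^ (i + j) \<odot>\<^bsub>free_star_algebra\<^esub> free_matrix (partner i) (partner j)"
  using assms unfolding index_cases
  by (elim disjE; simp only: partner_simps free_matrix_eq; simp add: free_simps(2) free_star_single
      word_star_def map_times_single)

lemma eta_partner:
  assumes "i \<in> {1..4}" "k \<in> {1..4}"
  shows "cnj (\<eta> \<theta> k i) = \<eta> \<theta> (partner i) (partner k)"
  using assms unfolding index_cases by (elim disjE; simp only: partner_simps; simp add: \<eta>_def)

definition M_relator where
  "M_relator \<theta> i j k l = free_matrix i j \<otimes>\<^bsub>free_star_algebra\<^esub> free_matrix k l \<ominus>\<^bsub>free_star_algebra\<^esub>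
    (\<eta> \<theta> k i * \<eta> \<theta> j l) \<odot>\<^bsub>free_star_algebra\<^esub> (free_matrix k l \<otimes>\<^bsub>free_star_algebra\<^esub> free_matrix i j)"

lemma M_relators_eq:
  "M_relators \<theta> = {M_relator \<theta> i j k l | i j k l. i \<in> {1..4} \<and> j \<in> {1..4} \<and> k \<in> {1..4} \<and> l \<in> {1..4}}"
  unfolding M_relators_def M_relator_def Let_def ..

lemma M_relatorI:
  assumes "i \<in> {1..4}" "j \<in> {1..4}" "k \<in> {1..4}" "l \<in> {1..4}"
  shows "M_relator \<theta> i j k l \<in> M_relators \<theta>"
  unfolding M_relators_eq
  by (rule CollectI, rule exI[of _ i], rule exI[of _ j], rule exI[of _ k], rule exI[of _ l]) (use assms in blast)

text \<open>The star reverses products, so the two index pairs change places, and each entry moves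
  to its partner position with a sign. The conjugated phases are those of the relator at the new
  indices by \<open>eta_partner\<close>.\<close>

lemma free_star_relator:
  assumes "i \<in> {1..4}" "j \<in> {1..4}" "k \<in> {1..4}" "l \<in> {1..4}"
  shows "free_star (M_relator \<theta> i j k l) = ((-1) ^ (k + l) * (-1) ^ (i + j)) \<odot>\<^bsub>free_star_algebra\<^esub>
    M_relator \<theta> (partner k) (partner l) (partner i) (partner j)"
proof -
  have c: "cnj (\<eta> \<theta> k i * \<eta> \<theta> j l) = \<eta> \<theta> (partner i) (partner k) * \<eta> \<theta> (partner l) (partner j)"
    by (simp only: complex_cnj_mult eta_partner[OF assms(1,3)] eta_partner[OF assms(4,2)])
  show ?thesis
    unfolding M_relator_def free_star_diff free_star_mult free_star_smult c
      free_star_matrix[OF assms(1,2)] free_star_matrix[OF assms(3,4)]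
    by (simp add: free.smult_diff free.smult_mult_left free.smult_mult_right free.smult_smult mult_ac)
qed

text \<open>Membership in the star ideal is thereby controlled by the relators alone, and algebra
  homomorphisms that kill them descend whether or not they respect a star.\<close>

lemma M_ideal_eq: "M_ideal \<theta> = Idl\<^bsub>free_star_algebra\<^esub> (M_relators \<theta>)"
  unfolding M_ideal_def
proof (rule star_ideal_generated_eq)
  let ?I = "Idl\<^bsub>free_star_algebra\<^esub> (M_relators \<theta>)"
  have "ideal ?I free_star_algebra" by (rule free.genideal_ideal) simp
  then interpret I: algebra_ideal free_star_algebra ?I
    by (intro algebra_ideal.intro free_star_algebra)
  fix r assume "r \<in> M_relators \<theta>"
  then obtain i j k l where *: "r = M_relator \<theta> i j k l" "i \<in> {1..4}" "j \<in> {1..4}" "k \<in> {1..4}" "l \<in> {1..4}"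
    unfolding M_relators_eq by blast
  have "M_relator \<theta> (partner k) (partner l) (partner i) (partner j) \<in> M_relators \<theta>"
    by (intro M_relatorI partner_in *(2-))
  then have "M_relator \<theta> (partner k) (partner l) (partner i) (partner j) \<in> ?I"
    by (rule subsetD[OF free.genideal_self, rotated]) simp
  then show "free_star r \<in> ?I"
    unfolding *(1) free_star_relator[OF *(2-)] by (rule I.smult_ideal)
qed

lemma M_ideal: "algebra_ideal free_star_algebra (M_ideal \<theta>)"
  unfolding M_ideal_eq
  by (intro algebra_ideal.intro free_star_algebra free.genideal_ideal) simp

lemma M_complex_algebra: "complex_algebra (M_algebra \<theta>)"
proof -
  interpret I: algebra_ideal free_star_algebra "M_ideal \<theta>" by (rule M_ideal)
  show ?thesis
    unfolding M_algebra_def quotient_star_algebra_def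
    by (rule complex_algebra_extend) (rule I.quot.complex_algebra_axioms)
qed

definition M_proj where "M_proj \<theta> p = M_ideal \<theta> +>\<^bsub>free_star_algebra\<^esub> p"

lemma M_proj_hom: "M_proj \<theta> \<in> algebra_homs free_star_algebra (M_algebra \<theta>)"
proof -
  interpret I: algebra_ideal free_star_algebra "M_ideal \<theta>" by (rule M_ideal)
  show ?thesis
    unfolding M_algebra_def quotient_star_algebra_def algebra_homs_extend M_proj_def[abs_def]
    by (rule I.quot_hom)
qed

lemma M_proj_surj: "x \<in> carrier (M_algebra \<theta>) \<Longrightarrow> \<exists>p. x = M_proj \<theta> p"
proof -
  interpret I: algebra_ideal free_star_algebra "M_ideal \<theta>" by (rule M_ideal)
  show "x \<in> carrier (M_algebra \<theta>) \<Longrightarrow> \<exists>p. x = M_proj \<theta> p"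
    by (auto simp: M_algebra_def quotient_star_algebra_def I.quot_carrier M_proj_def)
qed

lemma M_matrix_proj: "M_matrix \<theta> i j = M_proj \<theta> (free_matrix i j)"
  by (simp add: M_matrix_def M_proj_def)

lemma M_quantum_matrix: "quantum_matrix (M_algebra \<theta>) 4 (\<eta> \<theta>) (M_matrix \<theta>)"
proof (intro quantum_matrix.intro quantum_matrix_axioms.intro M_complex_algebra eta_phase eta_diag)
  interpret I: algebra_ideal free_star_algebra "M_ideal \<theta>" by (rule M_ideal)
  show "M_matrix \<theta> i j \<in> carrier (M_algebra \<theta>)" for i j
    unfolding M_matrix_proj by (rule algebra_homsD(2)[OF M_proj_hom]) simp
  fix i j k l :: nat assume "i \<in> {1..4}" "j \<in> {1..4}" "k \<in> {1..4}" "l \<in> {1..4}"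
  then have "M_relator \<theta> i j k l \<in> M_relators \<theta>" by (rule M_relatorI)
  then have "M_relator \<theta> i j k l \<in> M_ideal \<theta>"
    unfolding M_ideal_eq by (rule subsetD[OF free.genideal_self, rotated]) simp
  then have "M_proj \<theta> (free_matrix i j \<otimes>\<^bsub>free_star_algebra\<^esub> free_matrix k l) =
      M_proj \<theta> ((\<eta> \<theta> k i * \<eta> \<theta> j l) \<odot>\<^bsub>free_star_algebra\<^esub> (free_matrix k l \<otimes>\<^bsub>free_star_algebra\<^esub> free_matrix i j))"
    unfolding M_proj_def M_relator_def by (subst I.coset_eq_iff) simp_all
  then show "M_matrix \<theta> i j \<otimes>\<^bsub>M_algebra \<theta>\<^esub> M_matrix \<theta> k l =
      (\<eta> \<theta> k i * \<eta> \<theta> j l) \<odot>\<^bsub>M_algebra \<theta>\<^esub> (M_matrix \<theta> k l \<otimes>\<^bsub>M_algebra \<theta>\<^esub> M_matrix \<theta> i j)"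
    unfolding M_matrix_proj by (simp add: algebra_homsD[OF M_proj_hom])
qed

text \<open>The values on the sixteen letters that are forced by prescribing the sixteen entries: a
  letter and its star are independent, and the four entries carrying a minus sign are negated
  back.\<close>

definition letter_image where
  "letter_image B M x = (case x of
      (a\<^sub>1, s) \<Rightarrow> if s then M 2 2 else M 1 1
    | (a\<^sub>2, s) \<Rightarrow> if s then \<ominus>\<^bsub>B\<^esub> M 2 1 else M 1 2
    | (b\<^sub>1, s) \<Rightarrow> if s then M 2 4 else M 1 3
    | (b\<^sub>2, s) \<Rightarrow> if s then \<ominus>\<^bsub>B\<^esub> M 2 3 else M 1 4
    | (c\<^sub>1, s) \<Rightarrow> if s then M 4 2 else M 3 1
    | (c\<^sub>2, s) \<Rightarrow> if s then \<ominus>\<^bsub>B\<^esub> M 4 1 else M 3 2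
    | (d\<^sub>1, s) \<Rightarrow> if s then M 4 4 else M 3 3
    | (d\<^sub>2, s) \<Rightarrow> if s then \<ominus>\<^bsub>B\<^esub> M 4 3 else M 3 4)"

text \<open>As an algebra without star, the free star algebra on eight generators is free on the
  sixteen letters, hence also on the sixteen entries of the matrix.\<close>

lemma free_universal:
  assumes B: "complex_algebra B" and M: "\<And>i j. i \<in> {1..4} \<Longrightarrow> j \<in> {1..4} \<Longrightarrow> M i j \<in> carrier B"
  obtains f where "f \<in> algebra_homs free_star_algebra B"
    and "\<And>i j. i \<in> {1..4} \<Longrightarrow> j \<in> {1..4} \<Longrightarrow> f (free_matrix i j) = M i j"
proof -
  interpret B: complex_algebra B by (rule B)
  let ?l = "letter_image B M"
  define g where "g w = foldr (\<lambda>x y. ?l x \<otimes>\<^bsub>B\<^esub> y) w \<one>\<^bsub>B\<^esub>" for w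
  have lc: "?l x \<in> carrier B" for x
  proof -
    obtain y s where x: "x = (y, s)" by (cases x)
    show ?thesis unfolding x letter_image_def by (cases y) (simp_all add: M)
  qed
  have gc: "g w \<in> carrier B" for w
    unfolding g_def by (induction w) (simp_all add: lc)
  have "g (v @ w) = g v \<otimes>\<^bsub>B\<^esub> g w" for v w
  proof (induction v)
    case Nil
    then show ?case using gc[of w] by (simp add: g_def)
  next
    case (Cons x v)
    then show ?case using gc[of w] gc[of v] lc[of x] by (simp add: g_def B.m_assoc)
  qed
  then have "linear_ext B g \<in> algebra_homs (monoid_algebra word_monoid) B"
    by (intro B.linear_ext_hom word_monoid) (simp_all add: gc word_monoid_def, simp add: g_def)
  then have "linear_ext B g \<in> algebra_homs free_star_algebra B"
    by (simp add: free_star_algebra_def algebra_homs_extend)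
  moreover have "linear_ext B g (free_matrix i j) = M i j" if "i \<in> {1..4}" "j \<in> {1..4}" for i j
  proof -
    have s: "linear_ext B g (Poly_Mapping.single [x] c) = c \<odot>\<^bsub>B\<^esub> ?l x" for x c
      using B.linear_ext_single[of g "[x]" c] gc[of "[x]"] lc[of x] by (simp add: g_def)
    show ?thesis
      using that M[OF that] unfolding index_cases
      by (elim disjE; simp only:; simp add: s letter_image_def free_matrix_eq[unfolded One_nat_def] B.minus_smult)
  qed
  ultimately show thesis by (rule that)
qed

lemma M_universal:
  assumes X: "quantum_matrix B 4 (\<eta> \<theta>) M"
  obtains f where "f \<in> algebra_homs (M_algebra \<theta>) B"
    and "\<And>i j. i \<in> {1..4} \<Longrightarrow> j \<in> {1..4} \<Longrightarrow> f (M_matrix \<theta> i j) = M i j"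
proof -
  interpret X: quantum_matrix B 4 "\<eta> \<theta>" M by (rule X)
  interpret I: algebra_ideal free_star_algebra "M_ideal \<theta>" by (rule M_ideal)
  obtain f where f: "f \<in> algebra_homs free_star_algebra B"
    and fM: "\<And>i j. i \<in> {1..4} \<Longrightarrow> j \<in> {1..4} \<Longrightarrow> f (free_matrix i j) = M i j"
    using free_universal[where B = B and M = M, OF X.complex_algebra_axioms X.entry] by blast
  let ?K = "{x \<in> carrier free_star_algebra. f x = \<zero>\<^bsub>B\<^esub>}"
  have "M_relators \<theta> \<subseteq> ?K"
  proof
    fix r assume "r \<in> M_relators \<theta>"
    then obtain i j k l where r: "r = M_relator \<theta> i j k l"
      and ij: "i \<in> {1..4}" "j \<in> {1..4}" and kl: "k \<in> {1..4}" "l \<in> {1..4}"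
      unfolding M_relators_eq by blast
    note X.entry[OF ij] X.entry[OF kl]
    then have "f r = \<zero>\<^bsub>B\<^esub>"
      unfolding r M_relator_def
      using X.rel[OF ij kl]
      by (simp add: linear_maps_diff[OF algebra_homsD(1)[OF f] free_star_algebra X.complex_algebra_axioms]
          algebra_homsD[OF f] fM[OF ij] fM[OF kl])
    then show "r \<in> ?K" by simp
  qed
  then have "M_ideal \<theta> \<subseteq> ?K"
    unfolding M_ideal_eq
    by (intro free.genideal_minimal ideal_kernel f free_star_algebra X.complex_algebra_axioms)
  then have kill: "f x = \<zero>\<^bsub>B\<^esub>" if "x \<in> M_ideal \<theta>" for x using that by blast
  show thesis
  proof (rule that)
    show "(\<lambda>Z. the_elem (f ` Z)) \<in> algebra_homs (M_algebra \<theta>) B"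
      unfolding M_algebra_def quotient_star_algebra_def algebra_homs_extend
      by (rule I.quot_lift_hom[OF f X.complex_algebra_axioms kill])
    show "the_elem (f ` M_matrix \<theta> i j) = M i j" if "i \<in> {1..4}" "j \<in> {1..4}" for i j
      using I.the_elem_coset[OF algebra_homsD(1)[OF f] X.complex_algebra_axioms kill, of "free_matrix i j"] fM[OF that]
      by (simp add: M_matrix_def)
  qed
qed

lemma M_quantum_det: "quantum_det \<theta> (M_algebra \<theta>) (M_matrix \<theta>) = qdet (M_algebra \<theta>) 4 (\<eta> \<theta>) (M_matrix \<theta>)"
  by (rule quantum_det_eq[OF M_complex_algebra]) (rule quantum_matrix.entry[OF M_quantum_matrix])

section \<open>The quotient by the determinant relation\<close>

lemma SL_ideal: "algebra_ideal (M_algebra \<theta>) (SL_ideal \<theta>)"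
proof -
  interpret M: quantum_matrix "M_algebra \<theta>" 4 "\<eta> \<theta>" "M_matrix \<theta>" by (rule M_quantum_matrix)
  have "quantum_det \<theta> (M_algebra \<theta>) (M_matrix \<theta>) \<in> carrier (M_algebra \<theta>)"
    unfolding M_quantum_det by (rule M.qdet_closed)
  then show ?thesis
    unfolding SL_ideal_def by (intro algebra_ideal.intro M_complex_algebra M.genideal_ideal) simp
qed

lemma SL_complex_algebra: "complex_algebra (SL_algebra \<theta>)"
proof -
  interpret J: algebra_ideal "M_algebra \<theta>" "SL_ideal \<theta>" by (rule SL_ideal)
  show ?thesis
    unfolding SL_algebra_def quotient_star_algebra_def
    by (rule complex_algebra_extend) (rule J.quot.complex_algebra_axioms)
qed

definition SL_proj where "SL_proj \<theta> x = SL_ideal \<theta> +>\<^bsub>M_algebra \<theta>\<^esub> x"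

lemma SL_proj_hom: "SL_proj \<theta> \<in> algebra_homs (M_algebra \<theta>) (SL_algebra \<theta>)"
proof -
  interpret J: algebra_ideal "M_algebra \<theta>" "SL_ideal \<theta>" by (rule SL_ideal)
  show ?thesis
    unfolding SL_algebra_def quotient_star_algebra_def algebra_homs_extend SL_proj_def[abs_def]
    by (rule J.quot_hom)
qed

lemma SL_proj_surj: "x \<in> carrier (SL_algebra \<theta>) \<Longrightarrow> \<exists>y\<in>carrier (M_algebra \<theta>). x = SL_proj \<theta> y"
proof -
  interpret J: algebra_ideal "M_algebra \<theta>" "SL_ideal \<theta>" by (rule SL_ideal)
  show "x \<in> carrier (SL_algebra \<theta>) \<Longrightarrow> \<exists>y\<in>carrier (M_algebra \<theta>). x = SL_proj \<theta> y"
    by (auto simp: SL_algebra_def quotient_star_algebra_def J.quot_carrier SL_proj_def)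
qed

lemma SL_matrix_proj: "SL_matrix \<theta> i j = SL_proj \<theta> (M_matrix \<theta> i j)"
  by (simp add: SL_matrix_def SL_proj_def)

lemma SL_quantum_matrix: "quantum_matrix (SL_algebra \<theta>) 4 (\<eta> \<theta>) (SL_matrix \<theta>)"
  using quantum_matrix.hom_quantum_matrix[OF M_quantum_matrix SL_proj_hom SL_complex_algebra]
  by (simp add: SL_matrix_proj[abs_def])

lemma SL_qdet: "qdet (SL_algebra \<theta>) 4 (\<eta> \<theta>) (SL_matrix \<theta>) = \<one>\<^bsub>SL_algebra \<theta>\<^esub>"
proof -
  interpret M: quantum_matrix "M_algebra \<theta>" 4 "\<eta> \<theta>" "M_matrix \<theta>" by (rule M_quantum_matrix)
  interpret J: algebra_ideal "M_algebra \<theta>" "SL_ideal \<theta>" by (rule SL_ideal)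
  let ?D = "qdet (M_algebra \<theta>) 4 (\<eta> \<theta>) (M_matrix \<theta>)"
  have "?D \<ominus>\<^bsub>M_algebra \<theta>\<^esub> \<one>\<^bsub>M_algebra \<theta>\<^esub> \<in> SL_ideal \<theta>"
    unfolding SL_ideal_def M_quantum_det
    by (rule M.genideal_self'[OF M.minus_closed[OF M.qdet_closed M.one_closed]])
  then have "SL_proj \<theta> ?D = SL_proj \<theta> \<one>\<^bsub>M_algebra \<theta>\<^esub>"
    unfolding SL_proj_def using J.coset_eq_iff[OF M.qdet_closed M.one_closed] by simp
  then show ?thesis
    using M.hom_qdet[OF SL_proj_hom SL_complex_algebra]
    by (simp only: SL_matrix_proj[abs_def] algebra_homsD(6)[OF SL_proj_hom])
qed

text \<open>The common source of coproduct, counit and antipode: each is specified by a quantum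
  matrix of determinant \<open>1\<close> in its target. The homomorphism carries the determinant of
  the generic matrix to that of \<open>M\<close>, so it kills the generator of
  \<open>SL_ideal\<close>.\<close>

lemma SL_universal:
  assumes X: "quantum_matrix B 4 (\<eta> \<theta>) M" and det: "qdet B 4 (\<eta> \<theta>) M = \<one>\<^bsub>B\<^esub>"
  obtains f where "f \<in> algebra_homs (SL_algebra \<theta>) B"
    and "\<And>i j. i \<in> {1..4} \<Longrightarrow> j \<in> {1..4} \<Longrightarrow> f (SL_matrix \<theta> i j) = M i j"
proof -
  interpret X: quantum_matrix B 4 "\<eta> \<theta>" M by (rule X)
  interpret M: quantum_matrix "M_algebra \<theta>" 4 "\<eta> \<theta>" "M_matrix \<theta>" by (rule M_quantum_matrix)
  interpret J: algebra_ideal "M_algebra \<theta>" "SL_ideal \<theta>" by (rule SL_ideal)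
  let ?D = "qdet (M_algebra \<theta>) 4 (\<eta> \<theta>) (M_matrix \<theta>)"
  obtain f where f: "f \<in> algebra_homs (M_algebra \<theta>) B"
    and fM: "\<And>i j. i \<in> {1..4} \<Longrightarrow> j \<in> {1..4} \<Longrightarrow> f (M_matrix \<theta> i j) = M i j"
    using M_universal[OF X] by blast
  let ?K = "{x \<in> carrier (M_algebra \<theta>). f x = \<zero>\<^bsub>B\<^esub>}"
  have "f ?D = qminor B 4 (\<eta> \<theta>) (\<lambda>i j. f (M_matrix \<theta> i j)) [1..<Suc 4]"
    by (rule M.hom_qdet[OF f X.complex_algebra_axioms])
  also have "\<dots> = qdet B 4 (\<eta> \<theta>) M"
    unfolding qminor_def wordsD(1)[OF upt_in_words]
  proof (rule X.finsum_eqI)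
    fix js assume js: "js \<in> words 4 4"
    \<comment> \<open>The two matrices are known to agree for indices in \<open>{1..4}\<close> only,
      not as functions, so the determinants are compared word by word.\<close>
    have "word B (\<lambda>i j. f (M_matrix \<theta> i j)) is js = word B M is js" if "is \<in> words 4 4" for "is"
    proof -
      have "length is = length js" "set is \<subseteq> {1..4}" "set js \<subseteq> {1..4}"
        using that js by (auto simp: words_def)
      then show ?thesis
        by (induction "is" js rule: list_induct2) (simp_all add: fM)
    qed
    from this[OF upt_in_words]
    show "qeps (\<eta> \<theta>) js \<odot>\<^bsub>B\<^esub> word B (\<lambda>i j. f (M_matrix \<theta> i j)) [1..<Suc 4] js =
        qeps (\<eta> \<theta>) js \<odot>\<^bsub>B\<^esub> word B M [1..<Suc 4] js"
      by (simp only:)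
    show "qeps (\<eta> \<theta>) js \<odot>\<^bsub>B\<^esub> word B M [1..<Suc 4] js \<in> carrier B"
      by (rule X.smult_in[OF X.word_in[OF upt_in_words js]])
  qed
  finally have fD: "f ?D = \<one>\<^bsub>B\<^esub>" using det by simp
  have "?D \<ominus>\<^bsub>M_algebra \<theta>\<^esub> \<one>\<^bsub>M_algebra \<theta>\<^esub> \<in> ?K"
    using linear_maps_diff[OF algebra_homsD(1)[OF f] M_complex_algebra X.complex_algebra_axioms M.qdet_closed M.one_closed]
      M.minus_closed[OF M.qdet_closed M.one_closed]
    unfolding fD algebra_homsD(6)[OF f] by simp
  then have "SL_ideal \<theta> \<subseteq> ?K"
    unfolding SL_ideal_def M_quantum_det
    by (intro M.genideal_minimal ideal_kernel f M_complex_algebra X.complex_algebra_axioms) blast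
  then have kill: "f x = \<zero>\<^bsub>B\<^esub>" if "x \<in> SL_ideal \<theta>" for x using that by blast
  show thesis
  proof (rule that)
    show "(\<lambda>Z. the_elem (f ` Z)) \<in> algebra_homs (SL_algebra \<theta>) B"
      unfolding SL_algebra_def quotient_star_algebra_def algebra_homs_extend
      by (rule J.quot_lift_hom[OF f X.complex_algebra_axioms kill])
    show "the_elem (f ` SL_matrix \<theta> i j) = M i j" if "i \<in> {1..4}" "j \<in> {1..4}" for i j
      using J.the_elem_coset[OF algebra_homsD(1)[OF f] X.complex_algebra_axioms kill M.entry[OF that]] fM[OF that]
      by (simp add: SL_matrix_def)
  qed
qed

text \<open>Each letter is a matrix entry up to sign, and the sign is removed by a scalar. Products
  of letters and linear combinations then give every element.\<close>

lemma free_span: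
  "p \<in> alg_span free_star_algebra {free_matrix i j | i j. i \<in> {1..4} \<and> j \<in> {1..4}}" (is "_ \<in> ?S")
proof -
  have gen: "free_matrix i j \<in> ?S" if "i \<in> {1..4}" "j \<in> {1..4}" for i j
    by (rule alg_span.base) (use that in blast)
  have neg: "Poly_Mapping.single [x] 1 \<in> ?S" if "Poly_Mapping.single [x] (-1) \<in> ?S" for x
    using alg_span.smult[OF that, of "-1"] by (simp add: free_simps(2) map_times_single)
  note gens = gen[of 1 1] gen[of 1 2] gen[of 1 3] gen[of 1 4] gen[of 2 1] gen[of 2 2] gen[of 2 3] gen[of 2 4]
    gen[of 3 1] gen[of 3 2] gen[of 3 3] gen[of 3 4] gen[of 4 1] gen[of 4 2] gen[of 4 3] gen[of 4 4]
  have letter: "Poly_Mapping.single [x] 1 \<in> ?S" for x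
  proof -
    obtain y s where x: "x = (y, s)" by (cases x)
    show ?thesis
      unfolding x using gens[unfolded free_matrix_eq] neg
      by (cases y; cases s; simp only:) simp_all
  qed
  have one: "Poly_Mapping.single [] 1 \<in> ?S"
    using alg_span.one[of free_star_algebra "{free_matrix i j | i j. i \<in> {1..4} \<and> j \<in> {1..4}}"]
    by (simp add: free_star_algebra_def monoid_algebra_simps word_monoid_def)
  have word: "Poly_Mapping.single w 1 \<in> ?S" for w
  proof (induction w)
    case (Cons x w)
    from alg_span.mult[OF letter[of x] this] show ?case by (simp add: free_simps(3))
  qed (rule one)
  have single: "Poly_Mapping.single w c \<in> ?S" for w c
    using alg_span.smult[OF word, of c w] by (simp add: free_simps(2) map_times_single)
  show ?thesis
  proof (induction p rule: free_induct)
    case zero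
    show ?case using single[of "[]" 0] by simp
  next
    case (add p q)
    from alg_span.add[OF this] show ?case by (simp add: free_simps(1))
  qed (rule single)
qed

lemma SL_span: "carrier (SL_algebra \<theta>) \<subseteq> alg_span (SL_algebra \<theta>) {SL_matrix \<theta> i j | i j. i \<in> {1..4} \<and> j \<in> {1..4}}"
proof
  fix x assume "x \<in> carrier (SL_algebra \<theta>)"
  then obtain p where x: "x = SL_proj \<theta> (M_proj \<theta> p)"
    using SL_proj_surj M_proj_surj by metis
  let ?g = "{free_matrix i j | i j. i \<in> {1..4} \<and> j \<in> {1..4}}"
  have "SL_proj \<theta> (M_proj \<theta> p) \<in> alg_span (SL_algebra \<theta>) ((\<lambda>p. SL_proj \<theta> (M_proj \<theta> p)) ` ?g)"
    by (rule alg_span_hom[OF algebra_homs_comp[OF M_proj_hom SL_proj_hom] free_star_algebra _ free_span]) simp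
  also have "(\<lambda>p. SL_proj \<theta> (M_proj \<theta> p)) ` ?g = {SL_matrix \<theta> i j | i j. i \<in> {1..4} \<and> j \<in> {1..4}}"
    unfolding SL_matrix_proj M_matrix_proj by blast
  finally show "x \<in> alg_span (SL_algebra \<theta>) {SL_matrix \<theta> i j | i j. i \<in> {1..4} \<and> j \<in> {1..4}}"
    by (simp only: x)
qed

theorem proposition3p3:
  fixes \<theta> :: real
  defines "H \<equiv> SL_algebra \<theta>" and "A \<equiv> SL_matrix \<theta>"
  shows "\<exists>\<Delta> \<epsilon> S.
    \<Delta> \<in> algebra_homs H (tensor_algebra H H) \<and>
    (\<forall>i\<in>{1..4}. \<forall>j\<in>{1..4}.
      \<Delta> (A i j) = (\<Oplus>\<^bsub>tensor_algebra H H\<^esub>k\<in>{1..4}. pure_tensor H H (A i k) (A k j))) \<and>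
    \<epsilon> \<in> algebra_homs H complex_numbers_algebra \<and>
    (\<forall>i\<in>{1..4}. \<forall>j\<in>{1..4}. \<epsilon> (A i j) = (if i = j then 1 else 0)) \<and>
    S \<in> algebra_antihoms H H \<and>
    (\<forall>i\<in>{1..4}. \<forall>j\<in>{1..4}.
      S (A i j) = (-1) ^ (i + j) \<odot>\<^bsub>H\<^esub> algebraic_complement \<theta> H A j i) \<and>
    hopf_algebra H \<Delta> \<epsilon> S"
proof -
  have H: "complex_algebra H" unfolding H_def by (rule SL_complex_algebra)
  have A: "quantum_matrix H 4 (\<eta> \<theta>) A" unfolding H_def A_def by (rule SL_quantum_matrix)
  interpret A: quantum_matrix H 4 "\<eta> \<theta>" A by (rule A)
  interpret T: algebra_pair H H by (simp add: algebra_pair_def H)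
  let ?T = "tensor_algebra H H"
  have det: "qdet H 4 (\<eta> \<theta>) A = \<one>\<^bsub>H\<^esub>" unfolding H_def A_def by (rule SL_qdet)

  \<comment> \<open>\<open>P\<close> and \<open>Q\<close> are the images of the matrix under the two
    embeddings into the tensor square. Their entries commute because they occupy different factors,
    and their matrix product is the desired coproduct.\<close>
  define P where "P i j = pure_tensor H H (A i j) \<one>\<^bsub>H\<^esub>" for i j
  define Q where "Q i j = pure_tensor H H \<one>\<^bsub>H\<^esub> (A i j)" for i j
  have homP: "(\<lambda>x. pure_tensor H H x \<one>\<^bsub>H\<^esub>) \<in> algebra_homs H ?T"
    by (intro algebra_homsI linear_mapsI) (simp_all add: T.pure_simps T.pure_mult T.pure_one)
  have homQ: "(\<lambda>x. pure_tensor H H \<one>\<^bsub>H\<^esub> x) \<in> algebra_homs H ?T"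
    by (intro algebra_homsI linear_mapsI) (simp_all add: T.pure_simps T.pure_mult T.pure_one)
  have qP: "quantum_matrix ?T 4 (\<eta> \<theta>) P" and dP: "qdet ?T 4 (\<eta> \<theta>) P = \<one>\<^bsub>?T\<^esub>"
    using A.hom_quantum_matrix[OF homP T.tensor_complex_algebra] A.hom_qdet[OF homP T.tensor_complex_algebra]
    unfolding det algebra_homsD(6)[OF homP] by (simp_all only: P_def[abs_def])
  have qQ: "quantum_matrix ?T 4 (\<eta> \<theta>) Q" and dQ: "qdet ?T 4 (\<eta> \<theta>) Q = \<one>\<^bsub>?T\<^esub>"
    using A.hom_quantum_matrix[OF homQ T.tensor_complex_algebra] A.hom_qdet[OF homQ T.tensor_complex_algebra]
    unfolding det algebra_homsD(6)[OF homQ] by (simp_all only: Q_def[abs_def])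
  interpret PQ: commuting_quantum_matrices ?T 4 "\<eta> \<theta>" P Q
    by (intro commuting_quantum_matrices.intro commuting_quantum_matrices_axioms.intro qP qQ)
      (simp add: P_def Q_def T.pure_mult A.entry)
  have R: "PQ.R i j = (\<Oplus>\<^bsub>?T\<^esub>k\<in>{1..4}. pure_tensor H H (A i k) (A k j))"
    if "i \<in> {1..4}" "j \<in> {1..4}" for i j
    unfolding PQ.R_def P_def Q_def using that
    by (intro T.T.finsum_eqI) (simp_all add: T.pure_mult A.entry)
  have dR: "qdet ?T 4 (\<eta> \<theta>) PQ.R = \<one>\<^bsub>?T\<^esub>"
    unfolding PQ.qdet_product dP dQ by (rule T.T.r_one[OF T.T.one_closed])
  obtain \<Delta> where \<Delta>: "\<Delta> \<in> algebra_homs H ?T"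
    and \<Delta>R: "\<And>i j. i \<in> {1..4} \<Longrightarrow> j \<in> {1..4} \<Longrightarrow> \<Delta> (A i j) = PQ.R i j"
    by (rule SL_universal[OF PQ.product_quantum_matrix dR, folded H_def A_def]) (rule that)
  have \<Delta>A: "\<Delta> (A i j) = (\<Oplus>\<^bsub>?T\<^esub>k\<in>{1..4}. pure_tensor H H (A i k) (A k j))"
    if "i \<in> {1..4}" "j \<in> {1..4}" for i j
    using \<Delta>R[OF that] R[OF that] by (rule trans)

  let ?C = "complex_numbers_algebra" and ?\<delta> = "\<lambda>i j. if i = j then 1 else 0 :: complex"
  have q\<delta>: "quantum_matrix ?C 4 (\<eta> \<theta>) ?\<delta>"
  proof (intro quantum_matrix.intro quantum_matrix_axioms.intro complex_numbers_algebra eta_phase eta_diag)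
    fix i j k l :: nat assume "i \<in> {1..4}" "k \<in> {1..4}"
    \<comment> \<open>Both sides vanish unless \<open>i = j\<close> and \<open>k = l\<close>. In
      that case the phases are \<open>\<eta> \<theta> k i\<close> and
      \<open>\<eta> \<theta> i k\<close>, with product \<open>1\<close>.\<close>
    then show "?\<delta> i j \<otimes>\<^bsub>?C\<^esub> ?\<delta> k l = (\<eta> \<theta> k i * \<eta> \<theta> j l) \<odot>\<^bsub>?C\<^esub> (?\<delta> k l \<otimes>\<^bsub>?C\<^esub> ?\<delta> i j)"
      using eta_phase[of k i \<theta>] by (cases "k = l"; cases "i = j") (simp_all add: complex_numbers_simps)
  qed (simp_all add: complex_numbers_simps)
  have d\<delta>: "qdet ?C 4 (\<eta> \<theta>) ?\<delta> = \<one>\<^bsub>?C\<^esub>"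
    using qdet_delta[OF complex_numbers_algebra, of 4 "\<eta> \<theta>"] unfolding complex_numbers_simps .
  obtain \<epsilon> where \<epsilon>: "\<epsilon> \<in> algebra_homs H ?C"
    and \<epsilon>A: "\<And>i j. i \<in> {1..4} \<Longrightarrow> j \<in> {1..4} \<Longrightarrow> \<epsilon> (A i j) = (if i = j then 1 else 0)"
    by (rule SL_universal[OF q\<delta> d\<delta>, folded H_def A_def]) (rule that)

  \<comment> \<open>The inverse matrix has determinant \<open>1\<close> in the opposite algebra, so
    the universal property applies with that algebra as target and yields an anti-homomorphism of
    \<open>H\<close>.\<close>
  let ?B = "cofactor_inverse H 4 (\<eta> \<theta>) A"
  have dB: "qdet (opposite H) 4 (\<eta> \<theta>) ?B = \<one>\<^bsub>opposite H\<^esub>"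
    unfolding opposite_simps by (rule A.qdet_inverse[OF det])
  obtain S where S: "S \<in> algebra_homs H (opposite H)"
    and SA: "\<And>i j. i \<in> {1..4} \<Longrightarrow> j \<in> {1..4} \<Longrightarrow> S (A i j) = ?B i j"
    by (rule SL_universal[OF A.inverse_quantum_matrix[OF det] dB, folded H_def A_def]) (rule that)
  have S': "S \<in> algebra_antihoms H H" using S by (simp add: antihoms_opposite)
  have "matrix_bialgebra H {1..4} A \<Delta> \<epsilon> S"
  proof (intro matrix_bialgebra.intro matrix_bialgebra_axioms.intro H)
    show "carrier H \<subseteq> alg_span H {A i j |i j. i \<in> {1..4} \<and> j \<in> {1..4}}"
      unfolding H_def A_def by (rule SL_span)
    fix i j :: nat assume ij: "i \<in> {1..4}" "j \<in> {1..4}"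
    show "(\<Oplus>\<^bsub>H\<^esub>k\<in>{1..4}. S (A i k) \<otimes>\<^bsub>H\<^esub> A k j) = (if i = j then \<one>\<^bsub>H\<^esub> else \<zero>\<^bsub>H\<^esub>)"
      unfolding A.cofactor_inverse_left[OF det ij, symmetric]
      by (rule A.finsum_eqI) (simp_all only: SA ij A.m_closed A.cofactor_inverse_closed A.entry)
    show "(\<Oplus>\<^bsub>H\<^esub>k\<in>{1..4}. A i k \<otimes>\<^bsub>H\<^esub> S (A k j)) = (if i = j then \<one>\<^bsub>H\<^esub> else \<zero>\<^bsub>H\<^esub>)"
      unfolding A.cofactor_inverse_right[OF ij, unfolded det, symmetric]
      by (rule A.finsum_eqI) (simp_all only: SA ij A.m_closed A.cofactor_inverse_closed A.entry)
  qed (simp_all only: A.entry \<Delta> \<Delta>A \<epsilon> \<epsilon>A S' finite_atLeastAtMost)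
  then have "hopf_algebra H \<Delta> \<epsilon> S" by (rule matrix_bialgebra.hopf_algebra)
  moreover have "S (A i j) = (-1) ^ (i + j) \<odot>\<^bsub>H\<^esub> algebraic_complement \<theta> H A j i"
    if "i \<in> {1..4}" "j \<in> {1..4}" for i j
    using algebraic_complement_eq[where M = A, OF H A.entry that(2,1)] SA[OF that] by simp
  ultimately show ?thesis using \<Delta> \<Delta>A \<epsilon> \<epsilon>A S' by blast
qed

end
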